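(* Let $C(n)=B_0(n)-B_2(n)$, and let $a_k$ be the coefficient of $T^k$ in $\chi(T)$, the characteristic polynomial of a random matrix in $USp(2g)$ (distributed according to Haar measure). Let $n\ge 0$ be an integer. (i) For $g=2$, $$E[(a_2-2)^n]=C(n)C(n+2)-C(n+1)^2.$$ (ii) For $g=3$, $$E[(a_2-3)^n]=\sum_{n_1,n_2,n_3}\binom{n}{n_1,n_2,n_3}\det_{3\times 3}\bigl(C(n-n_j+i+j-2)\bigr),$$ the sum being over nonnegative integers with $n_1+n_2+n_3=n$. (iii) For $g=3$, $$E[a_3^n]=\sum_{n_1,n_2,n_3,m}\binom{n}{n_1,n_2,n_3,m}2^{n-m}\det_{3\times 3}\bigl(C(m+n_j+i+j-2)\bigr),$$ the sum being over nonnegative integers with $n_1+n_2+n_3+m=n$. Here $\det_{3\times 3}(x_{i,j})$ is the determinant of the matrix with $(i,j)$ entry $x_{i,j}$, $1\le i,j\le 3$.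
   Context: $USp(2g)$ is the compact Lie group of $2g\times 2g$ complex matrices that are both unitary and symplectic, with normalized Haar measure. The eigenvalues of a matrix in $USp(2g)$ are $e^{\pm i\theta_1},\ldots,e^{\pm i\theta_g}$ with $\theta_j\in[0,\pi]$, and the joint density of $(\theta_1,\ldots,\theta_g)$ under Haar measure is (Weyl) $$\mu=\frac{1}{g!}\Bigl(\prod_{j<l}(2\cos\theta_j-2\cos\theta_l)\Bigr)^2\prod_j\Bigl(\frac{2}{\pi}\sin^2\theta_j\,d\theta_j\Bigr).$$ The characteristic polynomial is $\chi(T)=\sum_k a_kT^k=\prod_{j=1}^g(T-e^{i\theta_j})(T-e^{-i\theta_j})$. For integers $\nu$ and $n\ge 0$, $B_\nu(n)=\binom{n}{(n+\nu)/2}$, taken to be zero when $(n+\nu)/2$ is not an integer in $[0,n]$. (Thus $C(2n)$ is the $n$th Catalan number and $C$ vanishes at odd integers.) $\binom{n}{n_1,\ldots,n_r}$ denotes the multinomial coefficient $n!/(n_1!\cdots n_r!)$. *)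

theory Defs
  imports "HOL-Probability.Probability" "HOL-Computational_Algebra.Polynomial"
begin

definition conj_transpose :: "complex^'n^'m \<Rightarrow> complex^'m^'n" where
  "conj_transpose A = map_matrix cnj (transpose A)"

definition unitary_matrix :: "complex^'n^'n \<Rightarrow> bool" where
  "unitary_matrix A \<longleftrightarrow> conj_transpose A ** A = mat 1 \<and> A ** conj_transpose A = mat 1"

text \<open>
  With \<open>g = CARD('g)\<close>, the index type \<open>'g + 'g\<close> has \<open>2 * g\<close> elements and
  \<open>symplectic_J\<close> is the block matrix with rows \<open>(0, 1)\<close> and \<open>(-1, 0)\<close>.
\<close>

definition symplectic_J :: "complex^('g::finite + 'g)^('g + 'g)" where
  "symplectic_J = (\<chi> i j. case (i, j) of
      (Inl a, Inr b) \<Rightarrow> if a = b then 1 else 0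
    | (Inr a, Inl b) \<Rightarrow> if a = b then -1 else 0
    | _ \<Rightarrow> 0)"

definition symplectic_matrix :: "complex^('g::finite + 'g)^('g + 'g) \<Rightarrow> bool" where
  "symplectic_matrix A \<longleftrightarrow> transpose A ** symplectic_J ** A = symplectic_J"

definition USp :: "(complex^('g::finite + 'g)^('g + 'g)) set" where
  "USp = {A. unitary_matrix A \<and> symplectic_matrix A}"

text \<open>
  For a compact group \<open>G\<close> of matrices there is exactly one such measure. It is
  characterised by left invariance alone; right invariance and regularity follow.
\<close>

definition normalized_haar_measure ::
    "(complex^'n^'n) set \<Rightarrow> (complex^'n^'n) measure \<Rightarrow> bool" where
  "normalized_haar_measure G M \<longleftrightarrow>
     prob_space M \<and> sets M = sets (restrict_space borel G) \<and>
     (\<forall>A\<in>G. distr M M (\<lambda>X. A ** X) = M)"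

definition char_polynomial :: "'a::comm_ring_1^'n^'n \<Rightarrow> 'a poly" where
  "char_polynomial A = det (mat [:0, 1:] - map_matrix (\<lambda>x. [:x:]) A)"

definition B :: "int \<Rightarrow> nat \<Rightarrow> int" where
  "B \<nu> n = (if even (int n + \<nu>) \<and> (int n + \<nu>) div 2 \<in> {0..int n}
             then int (n choose nat ((int n + \<nu>) div 2)) else 0)"

definition C :: "nat \<Rightarrow> int" where
  "C n = B 0 n - B 2 n"

text \<open>The division in the multinomial coefficient is exact.\<close>

definition multinomial :: "nat \<Rightarrow> nat list \<Rightarrow> nat" where
  "multinomial n ks = fact n div prod_list (map fact ks)"

text \<open>The entries of \<open>x\<close> are indexed from 1 to 3.\<close>

definition det3 :: "(nat \<Rightarrow> nat \<Rightarrow> int) \<Rightarrow> int" where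
  "det3 x = det (vector [vector [x 1 1, x 1 2, x 1 3],
                         vector [x 2 1, x 2 2, x 2 3],
                         vector [x 3 1, x 3 2, x 3 3]] :: int^3^3)"

end

theory Submission
  imports Defs "HOL-Computational_Algebra.Fundamental_Theorem_Algebra"
begin

text \<open>
  Every \<open>X\<close> in the group has eigenvalues \<open>\<lambda>\<^sub>j, 1 / \<lambda>\<^sub>j\<close>, so with \<open>x\<^sub>j = \<lambda>\<^sub>j + 1 / \<lambda>\<^sub>j\<close> its characteristic
  polynomial is the product of the \<open>T\<^sup>2 - x\<^sub>j T + 1\<close>. Hence \<open>a\<^sub>2 - g = e\<^sub>2\<close> and, for \<open>g = 3\<close>,
  \<open>a\<^sub>3 = - (e\<^sub>3 + 2 e\<^sub>1)\<close> in the elementary symmetric polynomials of the \<open>x\<^sub>j\<close>, and all that is needed are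
  the Haar moments of the monomials in \<open>e\<^sub>1, e\<^sub>2, e\<^sub>3\<close>. Weyl's formula says that they are the moments of
  independent semicircle variables \<open>x\<^sub>j\<close> weighted by the squared Vandermonde determinant divided by \<open>g!\<close>.
  Expanding that weight gives the determinants of the theorem, since \<open>C k\<close> is the \<open>k\<close>-th semicircle moment.

  The needed case of Weyl's formula is obtained without the geometry of conjugacy classes, by showing that
  both families of moments satisfy the same recurrences and that these have only one normalised solution.

  On the Haar side, left invariance under the curves \<open>(1 - t u / 2)\<^sup>-\<^sup>1 (1 + t u / 2)\<close> with \<open>u\<close> in the Lie algebra
  makes the integral of every derivative along \<open>u\<close> vanish (\<open>haar_derivative_zero\<close>). Applied to the vector
  field \<open>X \<mapsto> (X\<^sup>k - X\<^sup>-\<^sup>k) X\<close>, written in a generating set of the complexified Lie algebra, this yields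
  \<open>loop_equation\<close>. That field moves the eigenvalue parameters by
  \<open>x\<^sub>j \<mapsto> (\<lambda>\<^sub>j\<^sup>k - \<lambda>\<^sub>j\<^sup>-\<^sup>k) (\<lambda>\<^sub>j - 1 / \<lambda>\<^sub>j)\<close>, so on monomials in the \<open>e\<^sub>i\<close> the equation closes up to a
  recurrence for their moments (\<open>haar_loop_moments\<close>).

  On the Weyl side the same recurrences come from integration by parts against the semicircle law, which in
  terms of moments is the recurrence of the Catalan numbers (\<open>semicircle_ibp_pderiv\<close>, \<open>weyl_divergence\<close>).

  Uniqueness (\<open>loop_moments_unique\<close>) is the triangularity of the Casimir operator: a combination of the three
  recurrences multiplies the moment of a monomial by a positive number and otherwise involves only
  smaller monomials.
\<close>

section \<open>Matrix powers and characteristic polynomials\<close>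

lemma matrix_sub_rdistrib: "((A::'a::ring_1^'n^'m) - N) ** K = A ** K - N ** K"
  by (vector matrix_matrix_mult_def sum_subtractf[symmetric] left_diff_distrib)

lemma matrix_sub_ldistrib: "(A::'a::ring_1^'n^'m) ** (N - K) = A ** N - A ** K"
  by (vector matrix_matrix_mult_def sum_subtractf[symmetric] right_diff_distrib)

lemma matrix_minus_left: "(- (A::'a::ring_1^'n^'m)) ** N = - (A ** N)"
  by (vector matrix_matrix_mult_def sum_negf)

lemma matrix_minus_right: "(A::'a::ring_1^'n^'m) ** (- N) = - (A ** N)"
  by (vector matrix_matrix_mult_def sum_negf)

lemma mat_mult_component: "(mat c ** (A::'a::comm_ring_1^'n^'n)) $ i $ j = c * A $ i $ j"
proof -
  have "(mat c ** A) $ i $ j = (\<Sum>k\<in>UNIV. if i = k then c * A $ k $ j else 0)"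
    unfolding matrix_matrix_mult_def mat_def by (auto intro!: sum.cong simp: if_distrib if_distribR mult.commute cong: if_cong)
  thus ?thesis by simp
qed

lemma mult_mat_component: "((A::'a::comm_ring_1^'n^'n) ** mat c) $ i $ j = c * A $ i $ j"
proof -
  have "(A ** mat c) $ i $ j = (\<Sum>k\<in>UNIV. if k = j then c * A $ i $ k else 0)"
    unfolding matrix_matrix_mult_def mat_def by (auto intro!: sum.cong simp: if_distrib if_distribR mult.commute cong: if_cong)
  thus ?thesis by simp
qed

lemma mat_commute: "mat c ** (A::'a::comm_ring_1^'n^'n) = A ** mat c"
  by (simp add: vec_eq_iff mat_mult_component mult_mat_component)

lemma mat_mult_mat: "mat a ** (mat b :: 'a::comm_ring_1^'n^'n) = mat (a * b)"
  by (simp add: vec_eq_iff mat_mult_component) (simp add: mat_def)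

lemma det_mat: "det (mat c :: 'a::comm_ring_1^'n^'n) = c ^ CARD('n)"
  by (subst det_diagonal) (auto simp: mat_def)

lemma det_minus: "det (- (A::'a::comm_ring_1^'n^'n)) = (-1) ^ CARD('n) * det A"
proof -
  have "- A = mat (-1) ** A"
    by (simp add: vec_eq_iff mat_mult_component)
  thus ?thesis by (simp add: det_mul det_mat)
qed

primrec mpow :: "'a::semiring_1^'n^'n \<Rightarrow> nat \<Rightarrow> 'a^'n^'n" where
  "mpow A 0 = mat 1"
| "mpow A (Suc k) = A ** mpow A k"

lemma mpow_add: "mpow A (k + l) = mpow A k ** mpow A l"
  by (induction k) (simp_all add: matrix_mul_assoc)

lemma mpow_Suc_right: "mpow A (Suc k) = mpow A k ** A"
  using mpow_add[of A k 1] by simp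

lemma poly_det: "poly (det M) z = det (map_matrix (\<lambda>p. poly p z) M)"
  by (simp add: det_def poly_sum poly_prod)

lemma poly_ext:
  fixes p q :: "'a::{comm_ring_1,ring_no_zero_divisors,ring_char_0} poly"
  assumes "\<And>x. poly p x = poly q x"
  shows "p = q"
  using assms poly_eq_poly_eq_iff by blast

lemma poly_char_polynomial:
  fixes A :: "'a::comm_ring_1^'n^'n"
  shows "poly (char_polynomial A) z = det (mat z - A)"
  unfolding char_polynomial_def poly_det
  by (intro arg_cong[of _ _ det]) (simp add: vec_eq_iff mat_def)

lemma monic_prod_linear:
  fixes a :: "'i \<Rightarrow> 'a::idom"
  assumes "finite S"
  shows "degree (\<Prod>i\<in>S. [:- a i, 1:]) = card S" "lead_coeff (\<Prod>i\<in>S. [:- a i, 1:]) = 1"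
    "S \<noteq> {} \<Longrightarrow> coeff (\<Prod>i\<in>S. [:- a i, 1:]) (card S - 1) = - (\<Sum>i\<in>S. a i)"
proof -
  have *: "degree (\<Prod>i\<in>S. [:- a i, 1:]) = card S \<and> lead_coeff (\<Prod>i\<in>S. [:- a i, 1:]) = 1 \<and>
    (S \<noteq> {} \<longrightarrow> coeff (\<Prod>i\<in>S. [:- a i, 1:]) (card S - 1) = - (\<Sum>i\<in>S. a i))"
    using assms
  proof (induction S)
    case (insert x S)
    let ?p = "\<Prod>i\<in>S. [:- a i, 1:]"
    have nz: "?p \<noteq> 0" using insert by auto
    have "degree ([:- a x, 1:] * ?p) = Suc (card S)"
      by (subst degree_mult_eq) (use insert nz in auto)
    moreover have "lead_coeff ([:- a x, 1:] * ?p) = 1"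
      using insert by (subst lead_coeff_mult) auto
    moreover have "coeff ([:- a x, 1:] * ?p) (card S) = - (\<Sum>i\<in>insert x S. a i)"
    proof (cases "S = {}")
      case False
      then obtain m where m: "card S = Suc m" using insert(1) by (metis card_eq_0_iff not0_implies_Suc)
      have "coeff ?p (Suc m) = 1" using insert m by metis
      thus ?thesis using insert False m by (simp add: m)
    qed auto
    ultimately show ?case using insert by simp
  qed auto
  show "degree (\<Prod>i\<in>S. [:- a i, 1:]) = card S" "lead_coeff (\<Prod>i\<in>S. [:- a i, 1:]) = 1"
    "S \<noteq> {} \<Longrightarrow> coeff (\<Prod>i\<in>S. [:- a i, 1:]) (card S - 1) = - (\<Sum>i\<in>S. a i)"
    using * by blast+
qed

text \<open>
  In the Leibniz expansion a permutation other than the identity moves at least two points, so its term has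
  degree at most \<open>n - 2\<close>. The two top coefficients therefore come from the product of the diagonal entries.
\<close>

lemma char_polynomial_top:
  fixes A :: "'a::idom^'n^'n"
  shows "degree (char_polynomial A) = CARD('n)" "lead_coeff (char_polynomial A) = 1"
    "coeff (char_polynomial A) (CARD('n) - 1) = - trace A"
proof -
  let ?N = "CARD('n)"
  let ?M = "mat [:0, 1:] - map_matrix (\<lambda>x. [:x:]) A :: 'a poly^'n^'n"
  let ?t = "\<lambda>p. of_int (sign p) * (\<Prod>i\<in>UNIV. ?M $ i $ p i)"
  let ?D = "\<Prod>i\<in>UNIV. [:- A $ i $ i, 1:]"
  let ?R = "\<Sum>p\<in>{p. p permutes (UNIV::'n set)} - {id}. ?t p"
  have "char_polynomial A = ?t id + ?R"
    unfolding char_polynomial_def det_def by (rule sum.remove) (auto simp: permutes_id)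
  moreover have "?t id = ?D"
    by (auto simp: sign_id mat_def intro!: prod.cong)
  ultimately have split: "char_polynomial A = ?D + ?R" by simp
  have deg: "coeff ?R k = 0" if k: "?N - 1 \<le> k" for k
  proof -
    have "coeff (?t p) k = 0" if p: "p permutes (UNIV::'n set)" "p \<noteq> id" for p
    proof -
      have dM: "degree (?M $ i $ p i) \<le> (if p i = i then 1 else 0)" for i
        by (cases "p i = i") (auto simp: mat_def)
      obtain i where i: "p i \<noteq> i" using p(2) by (metis eq_id_iff)
      have ii: "p (p i) \<noteq> p i" using p(1) i by (metis permutes_inj injD)
      have "card {i. p i = i} + 2 \<le> ?N"
      proof -
        have "{i. p i = i} \<inter> {i, p i} = {}" using i ii by auto
        hence "card ({i. p i = i} \<union> {i, p i}) = card {i. p i = i} + card {i, p i}"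
          by (subst card_Un_disjoint) auto
        moreover have "card {i, p i} = 2" using i by auto
        moreover have "card ({i. p i = i} \<union> {i, p i}) \<le> ?N" by (rule card_mono) auto
        ultimately show ?thesis by linarith
      qed
      moreover have "degree (\<Prod>i\<in>UNIV. ?M $ i $ p i) \<le> (\<Sum>i\<in>(UNIV::'n set). if p i = i then 1 else 0)"
        by (rule order_trans[OF degree_prod_sum_le[OF finite] sum_mono]) (use dM in auto)
      moreover have "(\<Sum>i\<in>(UNIV::'n set). if p i = i then 1 else 0) = card {i. p i = i}"
        by (simp add: sum.If_cases)
      ultimately have "degree (\<Prod>i\<in>UNIV. ?M $ i $ p i) < k" using k by linarith
      hence "coeff (\<Prod>i\<in>UNIV. ?M $ i $ p i) k = 0" by (rule coeff_eq_0)
      moreover have "?t p = smult (of_int (sign p)) (\<Prod>i\<in>UNIV. ?M $ i $ p i)"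
        by (simp add: of_int_poly)
      ultimately show ?thesis by simp
    qed
    thus ?thesis by (auto simp: coeff_sum intro!: sum.neutral)
  qed
  have D: "degree ?D = ?N" "lead_coeff ?D = 1" "coeff ?D (?N - 1) = - trace A"
    using monic_prod_linear[of "UNIV::'n set" "\<lambda>i. A $ i $ i"] by (auto simp: trace_def)
  have N0: "coeff (char_polynomial A) k = coeff ?D k" if "?N - 1 \<le> k" for k
    using deg[OF that] by (simp add: split)
  have "coeff (char_polynomial A) k = 0" if "k > ?N" for k
    using N0[of k] that D(1) by (simp add: coeff_eq_0)
  hence "degree (char_polynomial A) \<le> ?N" by (intro degree_le) auto
  moreover have "coeff (char_polynomial A) ?N = 1" using N0[of ?N] D by auto
  ultimately show dg: "degree (char_polynomial A) = ?N"
    using le_degree[of "char_polynomial A" ?N] by (intro antisym) auto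
  show "lead_coeff (char_polynomial A) = 1"
    using \<open>coeff (char_polynomial A) ?N = 1\<close> dg by simp
  show "coeff (char_polynomial A) (?N - 1) = - trace A"
    using N0[of "?N - 1"] D by simp
qed

definition matpoly :: "'a::comm_ring_1^'n^'n \<Rightarrow> 'a poly \<Rightarrow> 'a^'n^'n" where
  "matpoly A p = fold_coeffs (\<lambda>a M. mat a + A ** M) p 0"

lemma matpoly_0 [simp]: "matpoly A 0 = 0"
  by (simp add: matpoly_def)

lemma matpoly_pCons [simp]: "matpoly A (pCons a p) = mat a + A ** matpoly A p"
  by (cases "p = 0 \<and> a = 0") (auto simp: matpoly_def)

lemma matpoly_add: "matpoly A (p + q) = matpoly A p + matpoly A q"
proof (induction p q rule: poly_induct2)
  case (pCons a p b q)
  have "mat (a + b) = mat a + (mat b :: 'a^'b^'b)" by (simp add: vec_eq_iff mat_def)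
  thus ?case using pCons by (simp add: matrix_add_ldistrib)
qed simp

lemma matpoly_smult: "matpoly A (smult c p) = mat c ** matpoly A p"
proof (induction p)
  case (pCons a p)
  have "mat c ** (A ** matpoly A p) = A ** (mat c ** matpoly A p)"
    by (simp only: matrix_mul_assoc mat_commute[of c A])
  thus ?case using pCons by (simp add: matrix_add_ldistrib mat_mult_mat)
qed simp

lemma matpoly_linear_mult: "matpoly A ([:- m, 1:] * q) = (A - mat m) ** matpoly A q"
proof -
  have "[:- m, 1:] * q = pCons 0 q + smult (- m) q" by simp
  moreover have "mat (- m) = - (mat m :: 'a^'b^'b)" by (simp add: vec_eq_iff mat_def)
  ultimately show ?thesis
    by (simp only: matpoly_add matpoly_pCons matpoly_smult) (simp add: matrix_sub_rdistrib matrix_minus_left)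
qed

lemma matpoly_monom: "matpoly A (monom 1 k) = mpow A k"
  by (induction k) (auto simp: monom_0 monom_Suc)

text \<open>
  Spectral mapping on the level of determinants: \<open>p\<close> splits into linear factors, and \<open>det (A - m)\<close> is the
  characteristic polynomial at \<open>m\<close> up to sign. This avoids triangularising \<open>A\<close>.
\<close>

lemma det_matpoly:
  fixes A :: "complex^'n^'n"
  assumes ch: "char_polynomial A = (\<Prod>x\<leftarrow>xs. [:- x, 1:])" and len: "length xs = CARD('n)"
    and "lead_coeff p = 1"
  shows "det (matpoly A p) = (\<Prod>x\<leftarrow>xs. poly p x)"
  using assms(3)
proof (induction "degree p" arbitrary: p)
  case 0
  hence "p = 1" by (metis degree_eq_zeroE lead_coeff_pCons(2) one_pCons pCons_0_0 coeff_pCons_0 degree_pCons_0)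
  moreover have "(\<Prod>a\<leftarrow>xs. 1::complex) = 1" by (induction xs) auto
  ultimately show ?case by (simp add: one_pCons)
next
  case (Suc d)
  then obtain m where "poly p m = 0"
    using fundamental_theorem_of_algebra[of p] constant_degree by (metis nat.distinct(1))
  then obtain q where q: "p = [:- m, 1:] * q" by (metis dvdE poly_eq_0_iff_dvd)
  have "q \<noteq> 0" using Suc q by auto
  hence "degree p = Suc (degree q)" unfolding q by (subst degree_mult_eq) auto
  moreover have "lead_coeff q = 1" using Suc.prems unfolding q lead_coeff_mult by simp
  ultimately have IH: "det (matpoly A q) = (\<Prod>x\<leftarrow>xs. poly q x)" using Suc by auto
  have "A - mat m = - (mat m - A)" by simp
  hence "det (A - mat m) = (-1) ^ CARD('n) * poly (char_polynomial A) m"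
    by (simp only: det_minus poly_char_polynomial)
  also have "\<dots> = (\<Prod>x\<leftarrow>xs. (x - m))"
    unfolding ch len[symmetric] by (induction xs) (auto simp: algebra_simps)
  finally have "det (matpoly A p) = (\<Prod>x\<leftarrow>xs. (x - m)) * (\<Prod>x\<leftarrow>xs. poly q x)"
    unfolding q matpoly_linear_mult det_mul IH by simp
  also have "\<dots> = (\<Prod>x\<leftarrow>xs. poly p x)"
    unfolding q by (induction xs) (auto simp: algebra_simps)
  finally show ?case .
qed

lemma prod_list_lessThan:
  fixes f :: "'b \<Rightarrow> 'c::comm_monoid_mult"
  shows "(\<Prod>x\<leftarrow>xs. f x) = (\<Prod>i<length xs. f (xs ! i))"
  by (induction xs) (simp_all add: prod.lessThan_Suc_shift del: prod.lessThan_Suc)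

text \<open>
  Spectral mapping for \<open>p = T\<^sup>k - z\<close>, with \<open>z\<close> varying, identifies the characteristic polynomial of \<open>A\<^sup>k\<close>;
  its second coefficient is minus the trace.
\<close>

lemma trace_mpow_eigenvalues:
  fixes A :: "complex^'n^'n"
  assumes ch: "char_polynomial A = (\<Prod>x\<leftarrow>xs. [:- x, 1:])" and len: "length xs = CARD('n)"
  shows "trace (mpow A k) = (\<Sum>x\<leftarrow>xs. x ^ k)"
proof (cases "k = 0")
  case True
  thus ?thesis by (simp add: trace_I len sum_list_triv)
next
  case False
  have "char_polynomial (mpow A k) = (\<Prod>x\<leftarrow>xs. [:- (x ^ k), 1:])"
  proof (rule poly_ext)
    fix z :: complex
    let ?p = "monom 1 k + [:- z:]"
    have dg: "degree [:- z:] < degree (monom (1::complex) k)"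
      using False by (simp add: degree_monom_eq)
    have "lead_coeff ?p = 1"
      using degree_add_eq_left[OF dg] False by (auto simp: degree_monom_eq coeff_pCons split: nat.splits)
    from det_matpoly[OF ch len this]
    have "det (mpow A k + mat (- z)) = (\<Prod>x\<leftarrow>xs. poly ?p x)"
      by (simp add: matpoly_add matpoly_monom)
    moreover have "mpow A k + mat (- z) = - (mat z - mpow A k)" by (simp add: vec_eq_iff mat_def)
    ultimately have "det (- (mat z - mpow A k)) = (\<Prod>x\<leftarrow>xs. x ^ k - z)"
      by (simp only:) (simp add: poly_monom)
    hence "(-1) ^ CARD('n) * det (mat z - mpow A k) = (\<Prod>x\<leftarrow>xs. x ^ k - z)"
      by (simp only: det_minus)
    hence "(-1) ^ CARD('n) * ((-1) ^ CARD('n) * det (mat z - mpow A k)) = (-1) ^ length xs * (\<Prod>x\<leftarrow>xs. x ^ k - z)"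
      by (simp add: len)
    also have "\<dots> = (\<Prod>x\<leftarrow>xs. z - x ^ k)"
      by (induction xs) (auto simp: algebra_simps)
    also have "(-1) ^ CARD('n) * ((-1) ^ CARD('n) * det (mat z - mpow A k)) = det (mat z - mpow A k)"
      by (simp add: mult.assoc[symmetric] power_add[symmetric])
    also have "(\<Prod>x\<leftarrow>xs. z - x ^ k) = poly (\<Prod>x\<leftarrow>xs. [:- (x ^ k), 1:]) z"
      by (induction xs) (auto simp: algebra_simps)
    finally show "poly (char_polynomial (mpow A k)) z = poly (\<Prod>x\<leftarrow>xs. [:- (x ^ k), 1:]) z"
      by (simp add: poly_char_polynomial)
  qed
  moreover have "(\<Prod>x\<leftarrow>xs. [:- (x ^ k), 1:]) = (\<Prod>i<length xs. [:- ((xs ! i) ^ k), 1:])"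
    by (rule prod_list_lessThan)
  moreover have "coeff (\<Prod>i<length xs. [:- ((xs ! i) ^ k), 1:]) (length xs - 1) = - (\<Sum>i<length xs. (xs ! i) ^ k)"
    using monic_prod_linear(3)[of "{..<length xs}" "\<lambda>i. (xs ! i) ^ k"] len by (auto simp: lessThan_empty_iff)
  ultimately have "- trace (mpow A k) = - (\<Sum>i<length xs. (xs ! i) ^ k)"
    using char_polynomial_top(3)[of "mpow A k"] len by simp
  thus ?thesis by (simp add: sum_list_sum_nth atLeast0LessThan)
qed


section \<open>The compact symplectic group\<close>

lemma matrix_add_rdistrib: "((A::'a::semiring_1^'n^'m) + N) ** K = A ** K + N ** K"
  by (vector matrix_matrix_mult_def sum.distrib[symmetric] distrib_right)

lemma matrix_vector_mult_scaleR_complex: "(A::complex^'n^'m) *v (c *\<^sub>R v) = c *\<^sub>R (A *v v)"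
  by (simp add: vec_eq_iff matrix_vector_mult_def scaleR_sum_right)

lemma sum_UNIV_Plus:
  "(\<Sum>i\<in>(UNIV::('a::finite + 'b::finite) set). f i) = (\<Sum>i\<in>UNIV. f (Inl i)) + (\<Sum>i\<in>UNIV. f (Inr i))"
  by (subst UNIV_Plus_UNIV[symmetric], subst sum.Plus) (auto simp: o_def)

lemma transpose_minus: "transpose (- A) = - transpose A"
  by (simp add: transpose_def vec_eq_iff)

lemma transpose_add: "transpose (A + N) = transpose A + transpose N"
  by (simp add: transpose_def vec_eq_iff)

lemma transpose_sub: "transpose (A - N) = transpose A - transpose N"
  by (simp add: transpose_def vec_eq_iff)

abbreviation JJ :: "complex^('g::finite + 'g)^('g + 'g)" where "JJ \<equiv> symplectic_J"

lemma J_squared: "JJ ** JJ = - (mat 1 :: complex^('g::finite + 'g)^('g + 'g))"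
proof -
  have "(JJ ** JJ) $ i $ j = (- mat 1 :: complex^('g + 'g)^('g + 'g)) $ i $ j" for i j :: "'g + 'g"
    by (cases i; cases j)
      (auto simp: matrix_matrix_mult_def sum_UNIV_Plus symplectic_J_def mat_def
        if_distrib if_distribR cong: if_cong)
  thus ?thesis by (simp add: vec_eq_iff)
qed

lemma transpose_J: "transpose JJ = - (JJ :: complex^('g::finite + 'g)^('g + 'g))"
proof -
  have "transpose JJ $ i $ j = (- JJ :: complex^('g + 'g)^('g + 'g)) $ i $ j" for i j :: "'g + 'g"
    by (cases i; cases j) (auto simp: transpose_def symplectic_J_def)
  thus ?thesis by (simp add: vec_eq_iff)
qed

lemma J_mult_J_mult: "JJ ** (JJ ** N) = - N"
  by (simp add: matrix_mul_assoc J_squared matrix_minus_left)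

lemma mult_J_mult_J: "N ** JJ ** JJ = - N"
  by (simp add: matrix_mul_assoc[symmetric] J_squared matrix_minus_right)

lemma mult_J_J_mult: "(M ** JJ) ** (JJ ** N) = - (M ** N)"
  by (simp add: matrix_mul_assoc mult_J_mult_J matrix_minus_left)

lemma det_J_conj:
  fixes N :: "complex^('g::finite + 'g)^('g + 'g)"
  shows "det (- (JJ ** N ** JJ)) = det N"
proof -
  have "det (- (JJ ** N ** JJ)) = det (- (JJ ** JJ) :: complex^('g + 'g)^('g + 'g)) * det N"
    by (simp only: det_mul matrix_minus_left[symmetric]) (simp add: det_mul det_minus)
  thus ?thesis by (simp add: J_squared)
qed

text \<open>
  The adjoint with respect to the symplectic form. It is an anti-automorphism that agrees with inversion on the
  group, but unlike inversion it is linear and defined on all matrices; the Lie algebra is where it equals \<open>-1\<close>.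
\<close>

definition sympl_adjoint :: "complex^('g::finite + 'g)^('g + 'g) \<Rightarrow> complex^('g + 'g)^('g + 'g)" where
  "sympl_adjoint A = - (JJ ** transpose A ** JJ)"

lemma sympl_adjoint_mult: "sympl_adjoint (A ** N) = sympl_adjoint N ** sympl_adjoint A"
proof -
  have "JJ ** transpose N ** JJ ** (JJ ** transpose A ** JJ) = - (JJ ** transpose N ** (transpose A ** JJ))"
    using mult_J_J_mult[of "JJ ** transpose N" "transpose A ** JJ"] by (simp add: matrix_mul_assoc)
  thus ?thesis
    by (simp add: sympl_adjoint_def matrix_minus_left matrix_minus_right matrix_transpose_mul matrix_mul_assoc)
qed

lemma sympl_adjoint_1 [simp]: "sympl_adjoint (mat 1) = mat 1"
  by (simp add: sympl_adjoint_def J_squared)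

lemma sympl_adjoint_mpow: "sympl_adjoint (mpow A k) = mpow (sympl_adjoint A) k"
proof (induction k)
  case (Suc k)
  have "sympl_adjoint (mpow A (Suc k)) = mpow (sympl_adjoint A) k ** sympl_adjoint A"
    by (simp add: sympl_adjoint_mult Suc)
  thus ?case by (simp only: mpow_Suc_right)
qed simp

lemma trace_sympl_adjoint: "trace (sympl_adjoint A) = trace A"
proof -
  have "trace (sympl_adjoint A) = - trace (JJ ** (transpose A ** JJ))"
    by (simp add: sympl_adjoint_def trace_def sum_negf matrix_mul_assoc)
  also have "\<dots> = - trace (transpose A ** JJ ** JJ)"
    by (subst trace_mul_sym) (simp add: matrix_mul_assoc)
  also have "\<dots> = trace (transpose A)"
    by (simp only: mult_J_mult_J) (simp add: trace_def sum_negf)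
  finally show ?thesis by (simp add: trace_def transpose_def)
qed

lemma USp_sympl_adjoint:
  assumes "A \<in> USp"
  shows "sympl_adjoint A ** A = mat 1" "A ** sympl_adjoint A = mat 1"
proof -
  have "JJ ** transpose A ** JJ ** A = JJ ** (transpose A ** JJ ** A)"
    by (simp add: matrix_mul_assoc)
  also have "\<dots> = - mat 1"
    using assms by (simp add: USp_def symplectic_matrix_def J_squared)
  finally show "sympl_adjoint A ** A = mat 1"
    by (simp add: sympl_adjoint_def matrix_minus_left)
  thus "A ** sympl_adjoint A = mat 1"
    by (simp add: matrix_left_right_inverse)
qed

lemma conj_transpose_mult: "conj_transpose (A ** N) = conj_transpose N ** conj_transpose A"
  by (simp add: vec_eq_iff conj_transpose_def transpose_def matrix_matrix_mult_def mult.commute)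

lemma USp_mult:
  assumes "A \<in> USp" "N \<in> USp"
  shows "A ** N \<in> USp"
proof -
  have a: "conj_transpose A ** A = mat 1" "A ** conj_transpose A = mat 1"
    "transpose A ** JJ ** A = JJ" "conj_transpose N ** N = mat 1" "N ** conj_transpose N = mat 1"
    "transpose N ** JJ ** N = JJ"
    using assms by (auto simp: USp_def unitary_matrix_def symplectic_matrix_def)
  have "conj_transpose (A ** N) ** (A ** N) = conj_transpose N ** (conj_transpose A ** A) ** N"
    by (simp add: conj_transpose_mult matrix_mul_assoc)
  moreover have "(A ** N) ** conj_transpose (A ** N) = A ** (N ** conj_transpose N) ** conj_transpose A"
    by (simp add: conj_transpose_mult matrix_mul_assoc)
  moreover have "transpose (A ** N) ** JJ ** (A ** N) = transpose N ** (transpose A ** JJ ** A) ** N"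
    by (simp add: matrix_transpose_mul matrix_mul_assoc)
  ultimately show ?thesis
    by (simp add: USp_def unitary_matrix_def symplectic_matrix_def a)
qed

section \<open>Symplectic unitary matrices have determinant one\<close>

text \<open>
  Both \<open>1 + A\<close> and \<open>1 + A\<^sup>-\<^sup>1\<close> have the same determinant, because \<open>A\<^sup>-\<^sup>1\<close> is conjugate to the transpose of \<open>A\<close>.
  As \<open>A (1 + A\<^sup>-\<^sup>1) = 1 + A\<close>, that common determinant can be cancelled unless it is zero.
\<close>

lemma det_USp_no_eigenvalue:
  assumes "A \<in> USp" and "det (mat 1 + A) \<noteq> 0"
  shows "det A = 1"
proof -
  have "- (JJ ** (mat 1 + transpose A) ** JJ) = mat 1 + sympl_adjoint A"
    by (simp add: sympl_adjoint_def matrix_add_ldistrib matrix_add_rdistrib J_squared)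
  hence "det (mat 1 + sympl_adjoint A) = det (mat 1 + transpose A)"
    using det_J_conj by metis
  also have "mat 1 + transpose A = transpose (mat 1 + A)" by (simp add: transpose_add)
  finally have "det (mat 1 + sympl_adjoint A) = det (mat 1 + A)" by simp
  moreover have "A ** (mat 1 + sympl_adjoint A) = mat 1 + A"
    using USp_sympl_adjoint[OF assms(1)] by (simp add: matrix_add_ldistrib add.commute)
  hence "det A * det (mat 1 + sympl_adjoint A) = det (mat 1 + A)" by (metis det_mul)
  ultimately show ?thesis using assms(2) by simp
qed

definition rank_one :: "complex^'n \<Rightarrow> complex^'n^'n" where
  "rank_one u = (\<chi> i j. u $ i * cnj (u $ j))"

text \<open>
  The antilinear map with square \<open>-1\<close> that turns the underlying space into a quaternionic one. The group consists of the
  unitary matrices that commute with it.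
\<close>

definition quaternion_map :: "complex^('g::finite + 'g) \<Rightarrow> complex^('g + 'g)" where
  "quaternion_map u = symplectic_J *v (\<chi> i. cnj (u $ i))"

lemma rank_one_mult:
  "(rank_one u ** rank_one v) $ i $ j = (\<Sum>k\<in>UNIV. cnj (u $ k) * v $ k) * u $ i * cnj (v $ j)"
  by (simp add: rank_one_def matrix_matrix_mult_def sum_distrib_right sum_distrib_left mult_ac)

lemma quaternion_map_simps [simp]: "quaternion_map u $ Inl a = cnj (u $ Inr a)" "quaternion_map u $ Inr a = - cnj (u $ Inl a)"
  by (auto simp: quaternion_map_def matrix_vector_mult_def sum_UNIV_Plus symplectic_J_def if_distrib if_distribR cong: if_cong)

lemma rank_one_quaternion_map: "rank_one (quaternion_map u) = - (JJ ** transpose (rank_one u) ** JJ)"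
proof -
  have "rank_one (quaternion_map u) $ i $ j = (- (JJ ** transpose (rank_one u) ** JJ)) $ i $ j" for i j
    by (cases i; cases j)
      (auto simp: rank_one_def transpose_def matrix_matrix_mult_def sum_UNIV_Plus symplectic_J_def
        if_distrib if_distribR cong: if_cong)
  thus ?thesis by (simp add: vec_eq_iff)
qed

lemma conj_transpose_rank_one: "conj_transpose (rank_one u) = rank_one u"
  by (simp add: conj_transpose_def rank_one_def transpose_def vec_eq_iff)

lemma USp_quaternion_map:
  assumes "A \<in> USp"
  shows "A *v quaternion_map u = quaternion_map (A *v u)"
proof -
  have a: "conj_transpose A ** A = mat 1" "A ** conj_transpose A = mat 1" "transpose A ** JJ ** A = JJ"
    using assms by (auto simp: USp_def unitary_matrix_def symplectic_matrix_def)
  have "A ** JJ = JJ ** map_matrix cnj A"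
  proof -
    have "map_matrix cnj (transpose A ** JJ ** A) = conj_transpose A ** JJ ** map_matrix cnj A"
    proof -
      have "map_matrix cnj JJ = (JJ :: complex^('a + 'a)^('a + 'a))"
        by (auto simp: vec_eq_iff symplectic_J_def split: sum.split)
      moreover have "map_matrix cnj (M ** N) = map_matrix cnj M ** map_matrix cnj N" for M N :: "complex^('a + 'a)^('a + 'a)"
        by (simp add: vec_eq_iff matrix_matrix_mult_def)
      ultimately show ?thesis by (simp add: conj_transpose_def)
    qed
    moreover have "map_matrix cnj JJ = (JJ :: complex^('a + 'a)^('a + 'a))"
      by (auto simp: vec_eq_iff symplectic_J_def split: sum.split)
    ultimately have "JJ = conj_transpose A ** JJ ** map_matrix cnj A" using a(3) by simp
    hence "A ** JJ = A ** conj_transpose A ** JJ ** map_matrix cnj A" by (metis matrix_mul_assoc)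
    thus ?thesis using a by simp
  qed
  moreover have "(map_matrix cnj A) *v (\<chi> i. cnj (u $ i)) = (\<chi> i. cnj ((A *v u) $ i))"
    by (simp add: vec_eq_iff matrix_vector_mult_def)
  ultimately show ?thesis
    unfolding quaternion_map_def by (metis matrix_vector_mul_assoc)
qed

lemma mult_rank_one: "(A ** rank_one u) $ i $ j = (A *v u) $ i * cnj (u $ j)"
  by (simp add: rank_one_def matrix_matrix_mult_def matrix_vector_mult_def sum_distrib_right sum_distrib_left mult_ac)

text \<open>
  The element that is \<open>-1\<close> on the quaternionic line spanned by \<open>u\<close> and \<open>1\<close> on its orthogonal complement. Its
  determinant is one because it is the square of a symplectic matrix, namely the one with eigenvalue \<open>\<i>\<close> on
  \<open>u\<close> and \<open>-\<i>\<close> on its quaternionic partner.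
\<close>

lemma quaternionic_reflection:
  fixes u :: "complex^('g::finite + 'g)"
  assumes u: "(\<Sum>k\<in>UNIV. cnj (u $ k) * u $ k) = 1"
  defines "P \<equiv> rank_one u + rank_one (quaternion_map u)"
  shows "mat 1 - (P + P) \<in> USp" "det (mat 1 - (P + P)) = 1" "P ** P = P" "conj_transpose P = P"
    "P *v u = u"
proof -
  let ?U = "rank_one u" and ?W = "rank_one (quaternion_map u)"
  \<comment> \<open>On the two lines, \<open>mat 1 + a - b\<close> acts as \<open>1 + (\<i> - 1) = \<i>\<close> and \<open>1 - (\<i> + 1) = -\<i>\<close>.\<close>
  define a b where "a = mat (\<i> - 1) ** ?U" and "b = mat (\<i> + 1) ** ?W"
  let ?S = "mat 1 + a - b"
  have ip: "(\<Sum>k\<in>UNIV. cnj (quaternion_map u $ k) * quaternion_map u $ k) = 1"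
    using u by (simp add: sum_UNIV_Plus add.commute mult.commute)
  have ip2: "(\<Sum>k\<in>UNIV. cnj (u $ k) * quaternion_map u $ k) = 0" "(\<Sum>k\<in>UNIV. cnj (quaternion_map u $ k) * u $ k) = 0"
    by (simp_all add: sum_UNIV_Plus sum_negf mult.commute)
  have UU: "?U ** ?U = ?U" "?W ** ?W = ?W" "?U ** ?W = 0" "?W ** ?U = 0"
    by (simp_all add: vec_eq_iff rank_one_mult u ip ip2 zero_vec_def) (simp_all add: rank_one_def)
  show PP: "P ** P = P"
    by (simp add: P_def matrix_add_ldistrib matrix_add_rdistrib UU)
  show ct: "conj_transpose P = P"
    using conj_transpose_rank_one[of u] conj_transpose_rank_one[of "quaternion_map u"]
    by (simp add: P_def conj_transpose_def transpose_def vec_eq_iff)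
  show "P *v u = u"
  proof -
    have "?U *v u = u" "?W *v u = 0"
    proof -
      have "(rank_one v *v w) $ i = v $ i * (\<Sum>k\<in>UNIV. cnj (v $ k) * w $ k)" for v w :: "complex^('g + 'g)" and i
        by (simp add: rank_one_def matrix_vector_mult_def sum_distrib_left mult_ac)
      thus "?U *v u = u" "?W *v u = 0" by (auto simp: vec_eq_iff u ip2)
    qed
    thus ?thesis by (simp add: P_def matrix_vector_mult_add_rdistrib)
  qed
  have comp: "(mat c ** M) ** (mat d ** N) = mat (c * d) ** (M ** N)" for c d and M N :: "complex^('g + 'g)^('g + 'g)"
  proof -
    have "(mat c ** M) ** (mat d ** N) = mat c ** (M ** mat d) ** N" by (simp add: matrix_mul_assoc)
    also have "\<dots> = mat c ** (mat d ** M) ** N" by (simp add: mat_commute)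
    finally show ?thesis by (simp add: matrix_mul_assoc mat_mult_mat)
  qed
  have ab: "a ** a = mat (- 2 * \<i>) ** ?U" "b ** b = mat (2 * \<i>) ** ?W" "a ** b = 0" "b ** a = 0"
    by (simp_all add: a_def b_def comp UU algebra_simps)
  have S2: "?S ** ?S = mat 1 - (P + P)"
  proof -
    have "?S ** ?S = mat 1 + a + a - b - b + a ** a + b ** b"
      by (simp add: matrix_add_ldistrib matrix_add_rdistrib matrix_sub_ldistrib matrix_sub_rdistrib ab)
    also have "\<dots> = mat 1 - (P + P)"
    proof -
      have "(mat 1 + a + a - b - b + a ** a + b ** b) $ i $ j = (mat 1 - (P + P)) $ i $ j" for i j
        unfolding ab
        by (simp only: vector_add_component vector_minus_component a_def b_def P_def mat_mult_component)
          (simp add: ring_distribs)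
      thus ?thesis by (simp only: vec_eq_iff) blast
    qed
    finally show ?thesis .
  qed
  have JW: "transpose ?U ** JJ = JJ ** ?W"
    by (simp add: rank_one_quaternion_map matrix_minus_right matrix_mul_assoc J_squared matrix_minus_left)
  have "transpose (JJ ** ?W) = transpose (transpose ?U ** JJ)" by (simp add: JW)
  hence WJ: "transpose ?W ** JJ = JJ ** ?U"
    by (simp add: matrix_transpose_mul transpose_J matrix_minus_left matrix_minus_right)
  have Ssym: "transpose ?S ** JJ ** ?S = JJ"
  proof -
    let ?a = "mat (\<i> - 1) ** ?W" and ?b = "mat (\<i> + 1) ** ?U"
    have t: "transpose (mat c ** N) = mat c ** transpose N" for c and N :: "complex^('g + 'g)^('g + 'g)"
      by (simp add: matrix_transpose_mul mat_commute)
    have c: "mat c ** N ** JJ = JJ ** (mat c ** M)" if "N ** JJ = JJ ** M" for c and M N :: "complex^('g + 'g)^('g + 'g)"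
      by (metis that mat_commute matrix_mul_assoc)
    have e1: "transpose ?S ** JJ = JJ ** (mat 1 + ?a - ?b)"
      by (simp add: transpose_add transpose_sub a_def b_def t matrix_add_rdistrib matrix_sub_rdistrib
          matrix_add_ldistrib matrix_sub_ldistrib c[OF JW] c[OF WJ])
    have e2: "(mat 1 + ?a - ?b) ** ?S = mat 1"
    proof -
      have "(mat 1 + ?a - ?b) ** ?S = mat 1 + a - b + ?a - ?b + (?a ** a - ?b ** a) - (?a ** b - ?b ** b)"
        by (simp add: matrix_add_ldistrib matrix_add_rdistrib matrix_sub_ldistrib matrix_sub_rdistrib)
      also have "\<dots> = mat 1"
        unfolding a_def b_def comp UU
        by (simp add: vec_eq_iff mat_mult_component algebra_simps)
      finally show ?thesis .
    qed
    have "transpose ?S ** JJ ** ?S = JJ ** ((mat 1 + ?a - ?b) ** ?S)"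
      by (simp only: e1 matrix_mul_assoc)
    thus ?thesis by (simp only: e2 matrix_mul_rid)
  qed
  have detJ: "det (JJ :: complex^('g + 'g)^('g + 'g)) \<noteq> 0"
  proof
    assume "det (JJ :: complex^('g + 'g)^('g + 'g)) = 0"
    hence "det (JJ ** JJ :: complex^('g + 'g)^('g + 'g)) = 0" by (simp add: det_mul)
    thus False by (simp add: J_squared det_minus)
  qed
  have "det (transpose ?S ** JJ ** ?S) = det ?S * det ?S * det (JJ :: complex^('g + 'g)^('g + 'g))" by (simp add: det_mul)
  hence "det ?S * det ?S = 1" using detJ by (simp add: Ssym)
  thus "det (mat 1 - (P + P)) = 1" unfolding S2[symmetric] by (simp add: det_mul)
  have Rsym: "transpose (mat 1 - (P + P)) ** JJ ** (mat 1 - (P + P)) = JJ"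
  proof -
    have "transpose (?S ** ?S) ** JJ ** (?S ** ?S) = transpose ?S ** (transpose ?S ** JJ ** ?S) ** ?S"
      by (simp only: matrix_transpose_mul matrix_mul_assoc)
    thus ?thesis by (simp only: S2 Ssym)
  qed
  have "conj_transpose (mat 1 - (P + P)) = mat 1 - (P + P)"
    using ct by (simp add: conj_transpose_def transpose_def vec_eq_iff mat_def)
  moreover have "(mat 1 - (P + P)) ** (mat 1 - (P + P)) = mat 1"
    by (simp only: matrix_add_ldistrib matrix_add_rdistrib matrix_sub_ldistrib matrix_sub_rdistrib PP
        matrix_mul_lid matrix_mul_rid) simp
  ultimately show "mat 1 - (P + P) \<in> USp"
    using Rsym by (simp add: USp_def unitary_matrix_def symplectic_matrix_def)
qed

text \<open>
  Induction on the dimension of the eigenspace for \<open>-1\<close>. If it contains \<open>u\<close>, multiplying by the quaternionic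
  reflection in \<open>u\<close> keeps the determinant and strictly shrinks the eigenspace.
\<close>

lemma det_USp:
  assumes "A \<in> USp"
  shows "det A = 1"
  using assms
proof (induction "dim {v. A *v v = - v}" arbitrary: A rule: less_induct)
  case (less A)
  show ?case
  proof (cases "det (mat 1 + A) = 0")
    case False
    thus ?thesis using det_USp_no_eigenvalue less.prems by blast
  next
    case True
    hence "\<exists>v. (mat 1 + A) *v v = 0 \<and> v \<noteq> 0"
      using matrix_left_invertible_ker[of "mat 1 + A"] invertible_det_nz[of "mat 1 + A"]
      by (auto simp: invertible_left_inverse)
    then obtain v where v: "v \<noteq> 0" "A *v v = - v"
      by (auto simp: matrix_vector_mult_add_rdistrib eq_neg_iff_add_eq_0 add.commute)
    define u where "u = (1 / norm v) *\<^sub>R v"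
    have Au: "A *v u = - u" using v by (simp add: u_def matrix_vector_mult_scaleR_complex)
    have "norm u = 1" using v by (simp add: u_def)
    hence "(\<Sum>k\<in>UNIV. (norm (u $ k))\<^sup>2) = 1" by (simp add: norm_vec_def L2_set_def)
    hence "complex_of_real (\<Sum>k\<in>UNIV. (norm (u $ k))\<^sup>2) = 1" by simp
    hence un: "(\<Sum>k\<in>UNIV. cnj (u $ k) * u $ k) = 1"
      by (simp add: complex_norm_square[symmetric] mult.commute)
    define P where "P = rank_one u + rank_one (quaternion_map u)"
    note R = quaternionic_reflection[OF un, folded P_def]
    let ?R = "mat 1 - (P + P)"
    have in_USp: "?R ** A \<in> USp" using R(1) less.prems by (rule USp_mult)
    have ctA: "conj_transpose A ** A = mat 1"
      using less.prems by (simp add: USp_def unitary_matrix_def)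
    have "A *v quaternion_map u = - quaternion_map u"
    proof -
      have "quaternion_map (- u) = - quaternion_map u"
        by (simp add: quaternion_map_def vec_eq_iff matrix_vector_mult_def sum_negf)
      thus ?thesis using USp_quaternion_map[OF less.prems, of u] Au by simp
    qed
    hence AP: "A ** P = - P"
      by (simp add: P_def matrix_add_ldistrib vec_eq_iff mult_rank_one Au) (simp add: rank_one_def)
    have PA: "P ** A = - P"
    proof -
      have "conj_transpose (A ** P) = P ** conj_transpose A" by (simp add: conj_transpose_mult R(4))
      moreover have "conj_transpose (- P) = - P"
        using R(4) by (simp add: conj_transpose_def transpose_def vec_eq_iff)
      ultimately have "P ** conj_transpose A = - P" using AP by simp
      hence "P ** (conj_transpose A ** A) = - (P ** A)" by (metis matrix_mul_assoc matrix_minus_left)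
      hence "P = - (P ** A)" using ctA by simp
      thus ?thesis using minus_equation_iff[of "P ** A" P] by simp
    qed
    have sub: "w \<in> {v. A *v v = - v}" if "w \<in> {v. (?R ** A) *v v = - v}" for w
    proof -
      have RA: "?R ** A = A + (P + P)"
        by (simp only: matrix_sub_rdistrib matrix_add_rdistrib PA matrix_mul_lid) simp
      have e: "A *v w + (P *v w + P *v w) = - w"
        using that unfolding RA by (simp only: matrix_vector_mult_add_rdistrib mem_Collect_eq)
      have "P *v (A *v w + (P *v w + P *v w)) = - (P *v w) + (P *v w + P *v w)"
      proof -
        have "(- P) *v w = - (P *v w)" by (simp add: vec_eq_iff matrix_vector_mult_def sum_negf)
        thus ?thesis by (simp only: matrix_vector_right_distrib matrix_vector_mul_assoc PA R(3))
      qed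
      moreover have "P *v (- w) = - (P *v w)"
        by (simp add: vec_eq_iff matrix_vector_mult_def sum_negf)
      ultimately have "P *v w = - (P *v w)" using e by simp
      hence "P *v w = 0" by (simp add: vec_eq_iff)
      thus ?thesis using e by simp
    qed
    have "u \<noteq> 0" using \<open>norm u = 1\<close> by auto
    hence ne: "u \<noteq> - u" by (auto simp: vec_eq_iff)
    have fixed: "(?R ** A) *v u = u"
    proof -
      have neg: "N *v (- u) = - (N *v u)" for N :: "complex^('a + 'a)^('a + 'a)"
        by (simp add: vec_eq_iff matrix_vector_mult_def sum_negf)
      have "?R *v u = u - (u + u)"
        by (simp only: matrix_vector_mult_diff_rdistrib matrix_vector_mult_add_rdistrib R(5) matrix_vector_mul_lid)
      thus ?thesis by (simp only: matrix_vector_mul_assoc[symmetric] Au neg) simp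
    qed
    have nin: "u \<notin> {v. (?R ** A) *v v = - v}"
      using ne unfolding mem_Collect_eq fixed .
    have subsp: "subspace {v. N *v v = - v}" for N :: "complex^('a + 'a)^('a + 'a)"
      by (auto simp: subspace_def matrix_vector_right_distrib matrix_vector_mult_scaleR_complex)
    have "{v. (?R ** A) *v v = - v} \<subset> {v. A *v v = - v}"
      using sub nin Au by blast
    hence "dim {v. (?R ** A) *v v = - v} < dim {v. A *v v = - v}"
      by (intro dim_psubset) (simp only: span_eq_iff[THEN iffD2, OF subsp])
    from less.hyps[OF this in_USp] have "det (?R ** A) = 1" .
    thus ?thesis by (simp only: det_mul R(2) mult_1)
  qed
qed

section \<open>Eigenvalue parameters\<close>

text \<open>
  \<open>A\<close> and \<open>A\<^sup>-\<^sup>1\<close> have the same characteristic polynomial. Without \<open>det A = 1\<close> the polynomial could also be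
  antipalindromic, and the eigenvalues \<open>1\<close> and \<open>-1\<close> would each have odd multiplicity.
\<close>

lemma reflect_char_polynomial_USp:
  assumes "A \<in> USp"
  shows "reflect_poly (char_polynomial A) = char_polynomial A"
proof -
  let ?p = "char_polynomial A"
  have eq: "poly (reflect_poly ?p) z = poly ?p z" if z: "z \<noteq> 0" for z
  proof -
    have "det (mat z - A) = det (mat z - sympl_adjoint A)"
    proof -
      have "- (JJ ** transpose (mat z - A) ** JJ) = - (mat z ** (JJ ** JJ)) - sympl_adjoint A"
        by (simp add: transpose_sub sympl_adjoint_def matrix_sub_ldistrib matrix_sub_rdistrib mat_commute[of z] matrix_mul_assoc)
      thus ?thesis by (metis det_J_conj det_transpose J_squared matrix_minus_right matrix_mul_rid minus_minus)
    qed
    also have "\<dots> = det (A ** (mat z - sympl_adjoint A))"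
      by (simp add: det_mul det_USp[OF assms])
    also have "A ** (mat z - sympl_adjoint A) = - (mat z ** (mat (inverse z) - A))"
      using z by (simp add: matrix_sub_ldistrib USp_sympl_adjoint[OF assms] mat_commute[of z A] mat_mult_mat)
    also have "det \<dots> = (-1) ^ CARD('a + 'a) * z ^ CARD('a + 'a) * det (mat (inverse z) - A)"
      by (simp add: det_minus det_mul det_mat)
    also have "(-1::complex) ^ CARD('a + 'a) = 1" by simp
    finally show ?thesis
      using z by (simp add: poly_reflect_poly_nz poly_char_polynomial char_polynomial_top)
  qed
  have "[:0, 1:] * reflect_poly ?p = [:0, 1:] * ?p"
    by (rule poly_ext) (use eq in auto)
  thus ?thesis by (metis mult_left_cancel pCons_eq_0_iff zero_neq_one)
qed

text \<open>
  A root \<open>l\<close> comes with the root \<open>1 / l\<close>. If the two coincide then the root is double: the quotient \<open>q\<close>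
  of \<open>p\<close> by \<open>T - l\<close> has odd degree and equals \<open>- l\<close> times its own reflection, so it vanishes at \<open>l\<close> again.
\<close>

lemma palindromic_poly_factorization:
  fixes p :: "complex poly"
  assumes "degree p = 2 * g" "lead_coeff p = 1" "reflect_poly p = p"
  shows "\<exists>xs. length xs = g \<and> p = (\<Prod>x\<leftarrow>xs. [:1, - x, 1:])"
  using assms
proof (induction g arbitrary: p)
  case 0
  then obtain c where "p = [:c:]" by (metis degree_eq_zeroE mult_0_right)
  with 0 show ?case by (auto simp: one_pCons)
next
  case (Suc g)
  obtain l where l: "poly p l = 0"
    using fundamental_theorem_of_algebra[of p] Suc.prems(1) constant_degree by (metis nat.distinct(1) mult_eq_0_iff zero_neq_numeral)
  have "poly p 0 = 1" using Suc.prems by (metis poly_reflect_poly_0)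
  hence l0: "l \<noteq> 0" using l by auto
  have p0: "p \<noteq> 0" using Suc.prems by auto
  obtain q where q: "p = [:- l, 1:] * q" using l by (metis dvdE poly_eq_0_iff_dvd)
  have q0: "q \<noteq> 0" using p0 q by auto
  have dq: "degree q = 2 * g + 1"
    using Suc.prems(1) degree_mult_eq[of "[:- l, 1:]" q] q q0 by simp
  have "poly q (inverse l) = 0"
  proof (cases "inverse l = l")
    case False
    have "poly p (inverse l) = 0"
      using Suc.prems(3) poly_reflect_poly_nz[of "inverse l" p] l l0 by simp
    thus ?thesis using False q by simp
  next
    case True
    hence ll: "l * l = 1" using l0 by (metis right_inverse)
    have "reflect_poly [:- l, 1:] = smult (- l) [:- l, 1:]"
      using l0 ll by (simp add: reflect_poly_def)
    hence "[:- l, 1:] * q = [:- l, 1:] * smult (- l) (reflect_poly q)"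
      using Suc.prems(3) unfolding q reflect_poly_mult by (simp only: mult_smult_left mult_smult_right)
    hence "q = smult (- l) (reflect_poly q)" by (metis mult_left_cancel pCons_eq_0_iff zero_neq_one)
    hence "poly q l = - l * poly (reflect_poly q) l" by (metis poly_smult)
    also have "\<dots> = - l * (l ^ (2 * g + 1) * poly q l)"
      using l0 True by (simp add: poly_reflect_poly_nz dq)
    also have "\<dots> = - ((l * l) * (l * l) ^ g * poly q l)"
      by (simp add: power_mult_distrib power_add mult_2)
    finally have "poly q l = - poly q l" by (simp add: ll)
    thus ?thesis using True by simp
  qed
  then obtain r where r: "q = [:- inverse l, 1:] * r" by (metis dvdE poly_eq_0_iff_dvd)
  define x where "x = l + inverse l"
  have "[:- l, 1:] * [:- inverse l, 1:] = [:1, - x, 1:]"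
    using l0 by (simp add: x_def)
  hence p: "p = [:1, - x, 1:] * r" unfolding q r by (metis mult.assoc)
  have r0: "r \<noteq> 0" using q0 r by auto
  have "degree r = 2 * g" using dq degree_mult_eq[of "[:- inverse l, 1:]" r] r r0 by simp
  moreover have "lead_coeff r = 1" using Suc.prems(2) unfolding p lead_coeff_mult by simp
  moreover have "reflect_poly r = r"
  proof -
    have "reflect_poly [:1, - x, 1:] = [:1, - x, 1:]"
      by (simp add: reflect_poly_def)
    hence "[:1, - x, 1:] * reflect_poly r = [:1, - x, 1:] * r"
      using Suc.prems(3) unfolding p reflect_poly_mult by simp
    thus ?thesis by (metis mult_left_cancel pCons_eq_0_iff zero_neq_one)
  qed
  ultimately obtain xs where "length xs = g" "r = (\<Prod>x\<leftarrow>xs. [:1, - x, 1:])"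
    using Suc.IH by blast
  thus ?case using p by (intro exI[of _ "x # xs"]) auto
qed

text \<open>
  Rescaled Chebyshev polynomials: \<open>2 cos (k \<theta>)\<close> as a polynomial in \<open>2 cos \<theta>\<close>.
\<close>

fun two_cos_multiple :: "nat \<Rightarrow> 'a::comm_ring_1 \<Rightarrow> 'a" where
  "two_cos_multiple 0 x = 2"
| "two_cos_multiple (Suc 0) x = x"
| "two_cos_multiple (Suc (Suc k)) x = x * two_cos_multiple (Suc k) x - two_cos_multiple k x"

lemma two_cos_multiple_inverse:
  fixes l :: complex
  assumes "l \<noteq> 0"
  shows "two_cos_multiple k (l + inverse l) = l ^ k + inverse l ^ k"
  using assms by (induction k "l + inverse l" rule: two_cos_multiple.induct) (auto simp: field_simps)

theorem USp_eigenvalues: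
  fixes A :: "complex^('g::finite + 'g)^('g + 'g)"
  assumes "A \<in> USp"
  obtains xs where "length xs = CARD('g)" "char_polynomial A = (\<Prod>x\<leftarrow>xs. [:1, - x, 1:])"
    "\<And>k. trace (mpow A k) = (\<Sum>x\<leftarrow>xs. two_cos_multiple k x)"
proof -
  obtain xs where xs: "length xs = CARD('g)" "char_polynomial A = (\<Prod>x\<leftarrow>xs. [:1, - x, 1:])"
    using palindromic_poly_factorization[of "char_polynomial A" "CARD('g)"]
      char_polynomial_top[of A] reflect_char_polynomial_USp[OF assms] by auto
  have "\<forall>x::complex. \<exists>l. l \<noteq> 0 \<and> l + inverse l = x"
  proof
    fix x :: complex
    obtain l where l: "poly [:1, - x, 1:] l = 0"
      using fundamental_theorem_of_algebra[of "[:1, - x, 1:]"] by (auto simp: constant_degree)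
    hence "l \<noteq> 0" by auto
    moreover from this have "l + inverse l = x" using l by (simp add: field_simps)
    ultimately show "\<exists>l. l \<noteq> 0 \<and> l + inverse l = x" by blast
  qed
  from choice[OF this] obtain L :: "complex \<Rightarrow> complex"
    where L0: "\<And>x. L x \<noteq> 0" and L: "\<And>x. L x + inverse (L x) = x" by blast
  let ?ls = "map L xs @ map (\<lambda>x. inverse (L x)) xs"
  have factor: "[:1, - x, 1:] = [:- L x, 1:] * [:- inverse (L x), 1:]" for x
  proof -
    have "[:- L x, 1:] * [:- inverse (L x), 1:] = [:1, - (L x + inverse (L x)), 1:]"
      using L0[of x] by simp
    thus ?thesis by (simp only: L)
  qed
  have "char_polynomial A = (\<Prod>x\<leftarrow>xs. [:- L x, 1:] * [:- inverse (L x), 1:])"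
    unfolding xs(2) by (simp only: factor)
  also have "\<dots> = (\<Prod>x\<leftarrow>?ls. [:- x, 1:])"
    by (induction xs) (simp_all add: mult_ac del: mult_pCons_left mult_pCons_right)
  finally have roots: "char_polynomial A = (\<Prod>x\<leftarrow>?ls. [:- x, 1:])" .
  have "trace (mpow A k) = (\<Sum>x\<leftarrow>xs. two_cos_multiple k x)" for k
  proof -
    have "trace (mpow A k) = (\<Sum>x\<leftarrow>?ls. x ^ k)"
      using roots by (rule trace_mpow_eigenvalues) (simp add: xs(1))
    also have "\<dots> = (\<Sum>x\<leftarrow>xs. L x ^ k + inverse (L x) ^ k)"
      by (induction xs) (simp_all add: add_ac)
    also have "(\<lambda>x. L x ^ k + inverse (L x) ^ k) = two_cos_multiple k"
      using two_cos_multiple_inverse[OF L0, of k] by (intro ext) (simp only: L)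
    finally show ?thesis .
  qed
  thus ?thesis using xs that by blast
qed


section \<open>Haar integrals\<close>

lemma bilinear_matrix_mult: "bilinear (\<lambda>(X::complex^'n^'m) (Y::complex^'p^'n). X ** Y)"
proof -
  have "(X::complex^'n^'m) ** (c *\<^sub>R Y) = c *\<^sub>R (X ** (Y::complex^'p^'n))" for c X Y
    by (simp add: vec_eq_iff matrix_matrix_mult_def scaleR_sum_right)
  moreover have "(c *\<^sub>R (X::complex^'n^'m)) ** Y = c *\<^sub>R (X ** (Y::complex^'p^'n))" for c X Y
    by (simp add: vec_eq_iff matrix_matrix_mult_def scaleR_sum_right)
  ultimately show ?thesis
    by (simp add: bilinear_def linear_iff matrix_add_ldistrib matrix_add_rdistrib)
qed

lemma bounded_bilinear_matrix_mult:
  "bounded_bilinear (\<lambda>(X::complex^'n^'m) (Y::complex^'p^'n). X ** Y)"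
  using bilinear_matrix_mult bilinear_conv_bounded_bilinear by blast

lemmas continuous_on_matrix_mult [continuous_intros] =
  bounded_bilinear.continuous_on[OF bounded_bilinear_matrix_mult]

lemma USp_norm_bound:
  "\<exists>R. \<forall>X\<in>(USp :: (complex^('g::finite + 'g)^('g + 'g)) set). norm X \<le> R"
proof -
  let ?N = "real CARD('g + 'g)"
  have "norm X \<le> ?N * ?N" if X: "X \<in> USp" for X :: "complex^('g + 'g)^('g + 'g)"
  proof -
    have entry: "norm (X $ i $ j) \<le> 1" for i j
    proof -
      have "(conj_transpose X ** X) $ j $ j = 1"
        using X by (simp add: USp_def unitary_matrix_def mat_def)
      moreover have "complex_of_real (\<Sum>k\<in>UNIV. (norm (X $ k $ j))\<^sup>2) = (\<Sum>k\<in>UNIV. X $ k $ j * cnj (X $ k $ j))"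
        by (simp only: of_real_sum complex_norm_square)
      ultimately have "complex_of_real (\<Sum>k\<in>UNIV. (norm (X $ k $ j))\<^sup>2) = 1"
        by (simp add: conj_transpose_def transpose_def matrix_matrix_mult_def mult.commute)
      hence "(\<Sum>k\<in>UNIV. (norm (X $ k $ j))\<^sup>2) = 1" by (metis of_real_eq_1_iff)
      moreover have "(norm (X $ i $ j))\<^sup>2 \<le> (\<Sum>k\<in>UNIV. (norm (X $ k $ j))\<^sup>2)"
        by (rule member_le_sum) auto
      ultimately show ?thesis by (metis abs_norm_cancel abs_square_le_1)
    qed
    have "norm X \<le> (\<Sum>i\<in>UNIV. norm (X $ i))"
      unfolding norm_vec_def by (rule L2_set_le_sum) auto
    also have "\<dots> \<le> (\<Sum>i\<in>(UNIV::('g + 'g) set). \<Sum>j\<in>(UNIV::('g + 'g) set). 1)"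
    proof (rule sum_mono)
      fix i :: "'g + 'g"
      have "norm (X $ i) \<le> (\<Sum>j\<in>UNIV. norm (X $ i $ j))"
        unfolding norm_vec_def by (rule L2_set_le_sum) auto
      also have "\<dots> \<le> (\<Sum>j\<in>(UNIV::('g + 'g) set). 1)"
        by (intro sum_mono entry)
      finally show "norm (X $ i) \<le> (\<Sum>j\<in>(UNIV::('g + 'g) set). 1)" .
    qed
    also have "\<dots> = ?N * ?N" by simp
    finally show ?thesis .
  qed
  thus ?thesis by blast
qed

lemma haar_space:
  assumes "normalized_haar_measure G M"
  shows "space M = G"
  using assms sets_eq_imp_space_eq[of M "restrict_space borel G"]
  by (simp add: normalized_haar_measure_def space_restrict_space)

lemma haar_measurable:
  fixes f :: "complex^'n^'n \<Rightarrow> complex"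
  assumes "normalized_haar_measure G M" "continuous_on UNIV f"
  shows "f \<in> borel_measurable M"
proof -
  have "f \<in> borel_measurable (restrict_space borel G)"
    using assms(2) by (intro measurable_restrict_space1 borel_measurable_continuous_onI)
  moreover have "borel_measurable M = (borel_measurable (restrict_space borel G) :: (complex^'n^'n \<Rightarrow> complex) set)"
    using assms(1) by (intro measurable_cong_sets) (auto simp: normalized_haar_measure_def)
  ultimately show ?thesis by simp
qed

lemma haar_integrable:
  fixes f :: "complex^('g::finite + 'g)^('g + 'g) \<Rightarrow> complex"
  assumes M: "normalized_haar_measure USp M" and f: "continuous_on UNIV f"
  shows "integrable M f"
proof -
  interpret prob_space M using M by (simp add: normalized_haar_measure_def)
  obtain R where R: "\<And>X. X \<in> (USp :: (complex^('g + 'g)^('g + 'g)) set) \<Longrightarrow> norm X \<le> R"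
    using USp_norm_bound by metis
  have "bounded (f ` cball 0 R)"
    by (intro compact_imp_bounded compact_continuous_image continuous_on_subset[OF f]) auto
  then obtain K where K: "\<And>X. X \<in> cball 0 R \<Longrightarrow> norm (f X) \<le> K"
    unfolding bounded_iff by (metis imageI)
  have "norm (f X) \<le> K" if "X \<in> space M" for X
    using that K R by (simp add: haar_space[OF M])
  thus ?thesis
    using haar_measurable[OF M f] by (intro integrable_const_bound[of _ K]) auto
qed

text \<open>
  Transfer of the defining invariance from sets to integrals of functions that are continuous on the whole matrix space.
\<close>

lemma haar_left_invariant:
  fixes f :: "complex^('g::finite + 'g)^('g + 'g) \<Rightarrow> complex"
  assumes M: "normalized_haar_measure USp M" and f: "continuous_on UNIV f" and Y: "Y \<in> USp"
  shows "(\<integral>X. f (Y ** X) \<partial>M) = (\<integral>X. f X \<partial>M)"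
proof -
  have "(\<lambda>X. Y ** X) \<in> measurable (restrict_space borel USp) (restrict_space borel USp)"
  proof (rule measurable_restrict_space3)
    show "(\<lambda>X. Y ** X) \<in> borel_measurable borel"
      by (intro borel_measurable_continuous_onI continuous_intros)
  qed (use USp_mult[OF Y] in auto)
  hence meas: "(\<lambda>X. Y ** X) \<in> measurable M M"
    using M measurable_cong_sets[of M "restrict_space borel USp" M "restrict_space borel USp"]
    by (simp add: normalized_haar_measure_def)
  have "(\<integral>X. f X \<partial>M) = (\<integral>X. f X \<partial>(distr M M (\<lambda>X. Y ** X)))"
    using M Y by (simp add: normalized_haar_measure_def)
  also have "\<dots> = (\<integral>X. f (Y ** X) \<partial>M)"
    by (rule integral_distr[OF meas haar_measurable[OF M f]])
  finally show ?thesis ..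
qed

section \<open>Cayley curves in the group\<close>

lemma skew_hermitian_Re_zero:
  fixes w :: "complex^'n^'n"
  assumes "conj_transpose w = - w"
  shows "inner v (w *v v) = 0"
proof -
  define s where "s = (\<Sum>i\<in>UNIV. \<Sum>j\<in>UNIV. cnj (v $ i) * (w $ i $ j * v $ j))"
  have w: "cnj (w $ i $ j) = - w $ j $ i" for i j
    using assms by (simp add: conj_transpose_def transpose_def vec_eq_iff)
  have "cnj s = (\<Sum>i\<in>UNIV. \<Sum>j\<in>UNIV. - (cnj (v $ j) * (w $ j $ i * v $ i)))"
    by (simp add: s_def w mult_ac)
  also have "\<dots> = - s"
    unfolding s_def by (subst sum.swap) (simp add: sum_negf)
  finally have "Re (cnj s) = Re (- s)" by simp
  hence "Re s = 0" by simp
  moreover have "inner v (w *v v) = Re s"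
    by (simp add: inner_vec_def s_def matrix_vector_mult_def inner_complex_def sum_distrib_left
        sum.distrib[symmetric] Re_sum Im_sum algebra_simps)
  ultimately show ?thesis by simp
qed

text \<open>
  Stated for an arbitrary anti-automorphism so that it serves both the unitary and the symplectic condition.
\<close>

lemma cayley_inverse:
  fixes w N :: "complex^'n^'n"
  assumes anti: "\<And>X Y. \<sigma> (X ** Y) = \<sigma> Y ** \<sigma> X"
    and s: "\<sigma> (mat 1 - w) = mat 1 + w" "\<sigma> (mat 1 + w) = mat 1 - w" "\<sigma> (mat 1) = mat 1"
    and N: "(mat 1 - w) ** N = mat 1" "N ** (mat 1 - w) = mat 1"
  shows "\<sigma> (N ** (mat 1 + w)) ** (N ** (mat 1 + w)) = mat 1"
proof -
  have "(mat 1 + w) ** (mat 1 - w) = (mat 1 - w) ** (mat 1 + w)"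
    by (simp add: matrix_add_ldistrib matrix_add_rdistrib matrix_sub_ldistrib matrix_sub_rdistrib)
  hence "N ** ((mat 1 + w) ** (mat 1 - w)) ** N = N ** ((mat 1 - w) ** (mat 1 + w)) ** N" by simp
  hence "N ** (mat 1 + w) ** ((mat 1 - w) ** N) = (N ** (mat 1 - w)) ** (mat 1 + w) ** N"
    by (simp only: matrix_mul_assoc)
  hence comm: "N ** (mat 1 + w) = (mat 1 + w) ** N" by (simp add: N)
  have "\<sigma> (N ** (mat 1 + w)) = \<sigma> N ** (mat 1 - w)" unfolding comm anti s ..
  hence "\<sigma> (N ** (mat 1 + w)) ** (N ** (mat 1 + w)) = \<sigma> N ** ((mat 1 - w) ** N) ** (mat 1 + w)"
    by (simp only: matrix_mul_assoc)
  also have "\<dots> = \<sigma> N ** \<sigma> (mat 1 - w)" by (simp add: N s)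
  also have "\<dots> = \<sigma> ((mat 1 - w) ** N)" by (rule anti[symmetric])
  finally show ?thesis by (simp add: N s)
qed

lemma conj_transpose_linear:
  "conj_transpose (X + Y) = conj_transpose X + conj_transpose Y"
  "conj_transpose (X - Y) = conj_transpose X - conj_transpose Y"
  "conj_transpose (- X) = - conj_transpose X"
  "conj_transpose (c *\<^sub>R X) = c *\<^sub>R conj_transpose X"
  "conj_transpose (mat z) = mat (cnj z)"
  by (simp_all add: conj_transpose_def transpose_def vec_eq_iff mat_def)

lemma scaleR_matrix_mult: "(c *\<^sub>R (X::complex^'n^'m)) ** Y = c *\<^sub>R (X ** Y)"
  by (simp add: vec_eq_iff matrix_matrix_mult_def scaleR_sum_right)

lemma matrix_mult_scaleR: "(X::complex^'n^'m) ** (c *\<^sub>R Y) = c *\<^sub>R (X ** Y)"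
  by (simp add: vec_eq_iff matrix_matrix_mult_def scaleR_sum_right)

lemma sympl_adjoint_linear:
  "sympl_adjoint (X + Y) = sympl_adjoint X + sympl_adjoint Y"
  "sympl_adjoint (X - Y) = sympl_adjoint X - sympl_adjoint Y"
  "sympl_adjoint (- X) = - sympl_adjoint X"
  "sympl_adjoint (c *\<^sub>R X) = c *\<^sub>R sympl_adjoint X"
  by (simp_all add: sympl_adjoint_def transpose_add transpose_sub transpose_minus transpose_scalar
      matrix_add_ldistrib matrix_add_rdistrib matrix_sub_ldistrib matrix_sub_rdistrib
      matrix_minus_left matrix_minus_right scaleR_matrix_mult matrix_mult_scaleR)

lemma USp_iff: "X \<in> USp \<longleftrightarrow> conj_transpose X ** X = mat 1 \<and> sympl_adjoint X ** X = mat 1"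
proof
  assume "X \<in> USp"
  thus "conj_transpose X ** X = mat 1 \<and> sympl_adjoint X ** X = mat 1"
    using USp_sympl_adjoint by (auto simp: USp_def unitary_matrix_def)
next
  assume a: "conj_transpose X ** X = mat 1 \<and> sympl_adjoint X ** X = mat 1"
  have "JJ ** (sympl_adjoint X ** X) = transpose X ** JJ ** X"
    unfolding sympl_adjoint_def matrix_minus_left matrix_minus_right
    using J_mult_J_mult[of "transpose X ** JJ ** X"] by (simp add: matrix_mul_assoc)
  hence "transpose X ** JJ ** X = JJ" using a by (metis matrix_mul_rid)
  moreover have "X ** conj_transpose X = mat 1" using a matrix_left_right_inverse by blast
  ultimately show "X \<in> USp"
    using a unfolding USp_def unitary_matrix_def symplectic_matrix_def by blast
qed

text \<open>
  The Cayley transform of \<open>t u\<close>. The fixed-point form of the conclusion is what differentiation at \<open>t = 0\<close> needs: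
  since the group is bounded it shows \<open>Y = 1 + O(t)\<close>, and then \<open>(Y - 1) / t\<close> tends to \<open>u\<close>.
\<close>

lemma cayley:
  fixes u :: "complex^('g::finite + 'g)^('g + 'g)"
  assumes u: "conj_transpose u = - u" "sympl_adjoint u = - u"
  obtains Y where "Y \<in> USp" "Y = mat 1 + (t / 2) *\<^sub>R (u ** (Y + mat 1))"
proof -
  define w where "w = (t / 2) *\<^sub>R u"
  have w: "conj_transpose w = - w" "sympl_adjoint w = - w"
    using u by (simp_all add: w_def conj_transpose_linear sympl_adjoint_linear)
  have "v = 0" if "(mat 1 - w) *v v = 0" for v
  proof -
    have "w *v v = v" using that by (simp add: matrix_vector_mult_diff_rdistrib)
    hence "inner v v = 0" using skew_hermitian_Re_zero[OF w(1), of v] by simp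
    thus ?thesis by simp
  qed
  then obtain N where "N ** (mat 1 - w) = mat 1"
    using matrix_left_invertible_ker[of "mat 1 - w"] by blast
  hence N: "(mat 1 - w) ** N = mat 1" "N ** (mat 1 - w) = mat 1"
    using matrix_left_right_inverse by blast+
  define Y where "Y = N ** (mat 1 + w)"
  have "conj_transpose Y ** Y = mat 1"
    unfolding Y_def
    by (rule cayley_inverse[OF conj_transpose_mult _ _ _ N]) (simp_all add: conj_transpose_linear w)
  moreover have "sympl_adjoint Y ** Y = mat 1"
    unfolding Y_def
    by (rule cayley_inverse[OF sympl_adjoint_mult _ _ _ N]) (simp_all add: sympl_adjoint_linear w)
  ultimately have "Y \<in> USp" by (simp add: USp_iff)
  moreover have "(mat 1 - w) ** Y = mat 1 + w"
    unfolding Y_def by (simp add: matrix_mul_assoc N)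
  hence "Y - w ** Y = mat 1 + w" by (simp add: matrix_sub_rdistrib)
  hence "Y = mat 1 + (w + w ** Y)" by (simp add: algebra_simps)
  hence "Y = mat 1 + w ** (Y + mat 1)" by (simp add: matrix_add_ldistrib add.commute)
  hence "Y = mat 1 + (t / 2) *\<^sub>R (u ** (Y + mat 1))" by (simp add: w_def scaleR_matrix_mult)
  ultimately show ?thesis using that by blast
qed

section \<open>Functions with a continuous complex-linear derivative\<close>

text \<open>
  Complex linearity of the derivative is required because directions in the complexified Lie algebra will be used,
  along which the group itself has no curves. Scalar multiplication of matrices is expressed by \<open>mat c ** V\<close>.
\<close>

definition C1_complex :: "(complex^'n^'n \<Rightarrow> complex) \<Rightarrow> (complex^'n^'n \<Rightarrow> complex^'n^'n \<Rightarrow> complex) \<Rightarrow> bool" where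
  "C1_complex f D \<longleftrightarrow> (\<forall>X. (f has_derivative D X) (at X)) \<and> (\<forall>V. continuous_on UNIV (\<lambda>X. D X V)) \<and>
     (\<forall>X c V. D X (mat c ** V) = c * D X V)"

lemma C1_complex_continuous: "C1_complex f D \<Longrightarrow> continuous_on UNIV f"
  by (auto simp: C1_complex_def continuous_on_eq_continuous_at intro: has_derivative_continuous)

lemma C1_complex_const: "C1_complex (\<lambda>X. c) (\<lambda>X V. 0)"
  by (simp add: C1_complex_def)

lemma C1_complex_add: "C1_complex f D \<Longrightarrow> C1_complex g E \<Longrightarrow> C1_complex (\<lambda>X. f X + g X) (\<lambda>X V. D X V + E X V)"
  by (auto simp: C1_complex_def ring_distribs intro!: continuous_intros has_derivative_add)

lemma C1_complex_mult:
  assumes "C1_complex f D" "C1_complex g E"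
  shows "C1_complex (\<lambda>X. f X * g X) (\<lambda>X V. f X * E X V + D X V * g X)"
proof -
  have "continuous_on UNIV f" "continuous_on UNIV g" using assms C1_complex_continuous by auto
  moreover have "((\<lambda>X. f X * g X) has_derivative (\<lambda>V. f X * E X V + D X V * g X)) (at X)" for X
    using assms by (intro has_derivative_mult) (auto simp: C1_complex_def)
  ultimately show ?thesis
    using assms by (auto simp: C1_complex_def algebra_simps intro!: continuous_intros)
qed

lemma C1_complex_power:
  assumes "C1_complex f D"
  shows "C1_complex (\<lambda>X. f X ^ n) (\<lambda>X V. of_nat n * f X ^ (n - 1) * D X V)"
proof (induction n)
  case 0
  show ?case using C1_complex_const[of 1] by simp
next
  case (Suc n)
  have "f X * (of_nat n * f X ^ (n - 1) * D X V) + D X V * f X ^ n = of_nat (Suc n) * f X ^ (Suc n - 1) * D X V" for X V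
    by (cases n) (auto simp: algebra_simps)
  thus ?case using C1_complex_mult[OF assms Suc] by simp
qed

lemma C1_complex_derivative_expand:
  assumes "C1_complex f D"
  shows "D X V = (\<Sum>b\<in>Basis. inner V b *\<^sub>R D X b)"
proof -
  have lin: "linear (D X)" using assms has_derivative_linear by (auto simp: C1_complex_def)
  have "D X V = D X (\<Sum>b\<in>Basis. inner V b *\<^sub>R b)" by (simp add: euclidean_representation)
  thus ?thesis by (simp add: linear_sum[OF lin] linear_scale[OF lin])
qed

lemma C1_complex_derivative_continuous:
  assumes "C1_complex f D" "continuous_on UNIV K"
  shows "continuous_on UNIV (\<lambda>X. D X (K X))"
  unfolding C1_complex_derivative_expand[OF assms(1), of _ "K _"]
  using assms by (intro continuous_intros) (auto simp: C1_complex_def)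

lemma C1_complex_lipschitz:
  fixes f :: "complex^'n^'n \<Rightarrow> complex"
  assumes "C1_complex f D"
  shows "\<exists>L\<ge>0. \<forall>X\<in>cball 0 R. \<forall>Y\<in>cball 0 R. norm (f X - f Y) \<le> L * norm (X - Y)"
proof -
  let ?s = "\<lambda>X. \<Sum>b\<in>Basis. norm (D X b)"
  have c: "continuous_on UNIV ?s"
    using assms by (intro continuous_intros) (auto simp: C1_complex_def)
  have "bounded (?s ` cball 0 R)"
    by (intro compact_imp_bounded compact_continuous_image continuous_on_subset[OF c]) auto
  then obtain L where L: "\<And>X. X \<in> cball 0 R \<Longrightarrow> norm (?s X) \<le> L"
    unfolding bounded_iff by (metis imageI)
  have on: "onorm (D X) \<le> \<bar>L\<bar>" if "X \<in> cball 0 R" for X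
  proof (rule onorm_bound)
    fix V
    have "norm (D X V) \<le> (\<Sum>b\<in>Basis. norm (inner V b *\<^sub>R D X b))"
      by (subst C1_complex_derivative_expand[OF assms]) (rule norm_sum)
    also have "\<dots> \<le> (\<Sum>b\<in>Basis. norm V * norm (D X b))"
      by (intro sum_mono) (auto intro!: mult_right_mono Basis_le_norm)
    also have "\<dots> = ?s X * norm V" by (simp add: sum_distrib_left mult.commute)
    also have "\<dots> \<le> \<bar>L\<bar> * norm V"
      using L[OF that] by (intro mult_right_mono) auto
    finally show "norm (D X V) \<le> \<bar>L\<bar> * norm V" .
  qed auto
  have "norm (f X - f Y) \<le> \<bar>L\<bar> * norm (X - Y)" if "X \<in> cball 0 R" "Y \<in> cball 0 R" for X Y
  proof (rule differentiable_bound[OF convex_cball _ on that])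
    show "(f has_derivative D Z) (at Z within cball 0 R)" for Z
      using assms by (auto simp: C1_complex_def intro: has_derivative_at_withinI)
  qed
  thus ?thesis by (intro exI[of _ "\<bar>L\<bar>"]) auto
qed

section \<open>Infinitesimal invariance of Haar measure\<close>

text \<open>
  Difference quotients along a sequence of directions that is only convergent, not constant, as it arises from a
  curve that is not a straight line.
\<close>

lemma has_derivative_sequence:
  fixes f :: "'a::euclidean_space \<Rightarrow> 'b::real_normed_vector"
  assumes f: "(f has_derivative D) (at x)" and t: "t \<longlonglongrightarrow> 0" "\<And>n. t n > 0" and h: "h \<longlonglongrightarrow> v"
  shows "(\<lambda>n. (f (x + t n *\<^sub>R h n) - f x) /\<^sub>R t n) \<longlonglongrightarrow> D v"
proof -
  have bl: "bounded_linear D" using f by (rule has_derivative_bounded_linear)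
  have Dh: "(\<lambda>n. D (h n)) \<longlonglongrightarrow> D v" using bounded_linear.tendsto[OF bl h] .
  obtain K where K: "K > 0" "\<And>n. norm (h n) \<le> K"
    using convergent_imp_Bseq[OF convergentI[OF h]] by (auto simp: Bseq_def)
  have th: "(\<lambda>n. t n *\<^sub>R h n) \<longlonglongrightarrow> 0"
    using tendsto_scaleR[OF t(1) h] by simp
  have "(\<lambda>n. (f (x + t n *\<^sub>R h n) - f x) /\<^sub>R t n - D (h n)) \<longlonglongrightarrow> 0"
  proof (rule LIMSEQ_I)
    fix r :: real assume r: "r > 0"
    have e: "r / (2 * K) > 0" using r K by simp
    then obtain d where d: "d > 0" "\<And>y. norm (y - x) < d \<Longrightarrow> norm (f y - f x - D (y - x)) \<le> r / (2 * K) * norm (y - x)"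
      using f unfolding has_derivative_at_alt by blast
    obtain N where N: "\<And>n. n \<ge> N \<Longrightarrow> norm (t n *\<^sub>R h n) < d"
      using LIMSEQ_D[OF th d(1)] by auto
    have "norm ((f (x + t n *\<^sub>R h n) - f x) /\<^sub>R t n - D (h n)) < r" if "n \<ge> N" for n
    proof -
      have lin: "D (t n *\<^sub>R h n) = t n *\<^sub>R D (h n)" using bl by (simp add: bounded_linear.linear linear_scale)
      have "norm (f (x + t n *\<^sub>R h n) - f x - t n *\<^sub>R D (h n)) \<le> r / (2 * K) * (t n * norm (h n))"
        using d(2)[of "x + t n *\<^sub>R h n"] N[OF that] lin t(2)[of n] by simp
      also have "\<dots> \<le> r / (2 * K) * (t n * K)"
        using K e t(2)[of n] by (intro mult_left_mono) auto
      also have "\<dots> = t n * (r / 2)" using K by simp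
      finally have le: "norm (f (x + t n *\<^sub>R h n) - f x - t n *\<^sub>R D (h n)) \<le> t n * (r / 2)" .
      have "(f (x + t n *\<^sub>R h n) - f x) /\<^sub>R t n - D (h n) = (f (x + t n *\<^sub>R h n) - f x - t n *\<^sub>R D (h n)) /\<^sub>R t n"
        using t(2)[of n] by (simp add: scaleR_diff_right)
      hence "norm ((f (x + t n *\<^sub>R h n) - f x) /\<^sub>R t n - D (h n)) = norm (f (x + t n *\<^sub>R h n) - f x - t n *\<^sub>R D (h n)) / t n"
        using t(2)[of n] by (simp add: divide_inverse mult.commute)
      also have "\<dots> \<le> r / 2" using le t(2)[of n] by (simp add: field_simps)
      finally show ?thesis using r by simp
    qed
    thus "\<exists>N. \<forall>n\<ge>N. norm ((f (x + t n *\<^sub>R h n) - f x) /\<^sub>R t n - D (h n) - 0) < r" by auto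
  qed
  from tendsto_add[OF this Dh] show ?thesis by simp
qed

text \<open>
  The difference quotients of \<open>f\<close> along the Cayley curve have integral zero by invariance. They converge to the derivative,
  and the Lipschitz bound for \<open>f\<close> on a ball containing the group dominates them.
\<close>

lemma haar_derivative_zero_real:
  fixes M :: "(complex^('g::finite + 'g)^('g + 'g)) measure"
  assumes M: "normalized_haar_measure USp M" and f: "C1_complex f D"
    and u: "conj_transpose u = - u" "sympl_adjoint u = - u"
  shows "(\<integral>X. D X (u ** X) \<partial>M) = 0"
proof -
  interpret prob_space M using M by (simp add: normalized_haar_measure_def)
  define t where "t = (\<lambda>n. inverse (real (Suc n)))"
  have t: "t \<longlonglongrightarrow> 0" "\<And>n. t n > 0"
    unfolding t_def by (rule LIMSEQ_inverse_real_of_nat) simp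
  have "\<exists>Y. Y \<in> USp \<and> Y = mat 1 + (t n / 2) *\<^sub>R (u ** (Y + mat 1))" for n
    using cayley[OF u, of "t n"] by metis
  then obtain Y where Y: "\<And>n. Y n \<in> USp" "\<And>n. Y n = mat 1 + (t n / 2) *\<^sub>R (u ** (Y n + mat 1))"
    by metis
  define h where "h = (\<lambda>n (X :: complex^('g + 'g)^('g + 'g)). (1 / 2) *\<^sub>R (u ** (Y n ** X + X)))"
  have YX: "Y n ** X = X + t n *\<^sub>R h n X" for n X
  proof -
    have "Y n ** X = (mat 1 + (t n / 2) *\<^sub>R (u ** (Y n + mat 1))) ** X" using Y(2)[of n] by simp
    thus ?thesis
      by (simp add: h_def matrix_add_rdistrib scaleR_matrix_mult matrix_mul_assoc[symmetric])
  qed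
  obtain R where R: "\<And>X. X \<in> (USp :: (complex^('g + 'g)^('g + 'g)) set) \<Longrightarrow> norm X \<le> R"
    using USp_norm_bound by metis
  obtain K where K: "K > 0" "\<And>X :: complex^('g + 'g)^('g + 'g). norm (u ** X) \<le> norm X * K"
    using bounded_linear.pos_bounded[OF bounded_bilinear.bounded_linear_right[OF bounded_bilinear_matrix_mult]]
    by blast
  have hb: "norm (h n X) \<le> R * K" if "X \<in> USp" for n X
  proof -
    have "norm (Y n ** X + X) \<le> R + R"
      using R[OF that] R[OF USp_mult[OF Y(1) that]] norm_triangle_le[of "Y n ** X" X] add_mono by blast
    hence "norm (Y n ** X + X) * K \<le> (R + R) * K" using K(1) by simp
    hence "norm (u ** (Y n ** X + X)) \<le> (R + R) * K" using K(2)[of "Y n ** X + X"] by linarith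
    thus ?thesis by (simp add: h_def)
  qed
  have hlim: "(\<lambda>n. h n X) \<longlonglongrightarrow> u ** X" if X: "X \<in> USp" for X
  proof -
    have "(\<lambda>n. t n *\<^sub>R h n X) \<longlonglongrightarrow> 0"
    proof (rule tendsto_norm_zero_cancel, rule tendsto_sandwich)
      show "\<forall>\<^sub>F n in sequentially. 0 \<le> norm (t n *\<^sub>R h n X)" by simp
      show "\<forall>\<^sub>F n in sequentially. norm (t n *\<^sub>R h n X) \<le> t n * (R * K)"
        using hb[OF X] t(2) by (intro always_eventually allI) (auto intro!: mult_left_mono simp: less_imp_le)
      show "(\<lambda>n. t n * (R * K)) \<longlonglongrightarrow> 0" using tendsto_mult_right[OF t(1), of "R * K"] by simp
    qed auto
    hence "(\<lambda>n. Y n ** X) \<longlonglongrightarrow> X" unfolding YX using tendsto_add[OF tendsto_const[of X]] by fastforce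
    hence "(\<lambda>n. u ** (Y n ** X + X)) \<longlonglongrightarrow> u ** (X + X)"
      by (intro bounded_linear.tendsto[OF bounded_bilinear.bounded_linear_right[OF bounded_bilinear_matrix_mult]]
          tendsto_add tendsto_const)
    hence "(\<lambda>n. h n X) \<longlonglongrightarrow> (1 / 2) *\<^sub>R (u ** (X + X))"
      unfolding h_def by (intro tendsto_scaleR tendsto_const)
    moreover have "(1 / 2) *\<^sub>R (u ** (X + X)) = u ** X"
      by (simp only: matrix_add_ldistrib scaleR_half_double)
    ultimately show ?thesis by simp
  qed
  define s where "s = (\<lambda>n X. (f (Y n ** X) - f X) /\<^sub>R t n)"
  have fc: "continuous_on UNIV f" using f by (rule C1_complex_continuous)
  have fYc: "continuous_on UNIV (\<lambda>X. f (Y n ** X))" for n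
    by (rule continuous_on_compose2[OF fc]) (auto intro!: continuous_intros)
  have sc: "continuous_on UNIV (s n)" for n
    unfolding s_def by (intro continuous_intros fc fYc)
  have s0: "(\<integral>X. s n X \<partial>M) = 0" for n
    unfolding s_def using haar_left_invariant[OF M fc Y(1)[of n]]
      haar_integrable[OF M fc] haar_integrable[OF M fYc[of n]] by simp
  obtain L where L: "L \<ge> 0" "\<And>X Z. X \<in> cball 0 R \<Longrightarrow> Z \<in> cball 0 R \<Longrightarrow> norm (f X - f Z) \<le> L * norm (X - Z)"
    using C1_complex_lipschitz[OF f, of R] by metis
  have "(\<lambda>n. \<integral>X. s n X \<partial>M) \<longlonglongrightarrow> (\<integral>X. D X (u ** X) \<partial>M)"
  proof (rule integral_dominated_convergence[where w = "\<lambda>_. L * (R * K)"])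
    show "(\<lambda>X. D X (u ** X)) \<in> borel_measurable M"
      by (intro haar_measurable[OF M] C1_complex_derivative_continuous[OF f] continuous_intros)
    show "s n \<in> borel_measurable M" for n by (rule haar_measurable[OF M sc])
    show "integrable M (\<lambda>_. L * (R * K))" by simp
    show "AE X in M. (\<lambda>n. s n X) \<longlonglongrightarrow> D X (u ** X)"
    proof (rule AE_I2)
      fix X assume "X \<in> space M"
      hence X: "X \<in> USp" by (simp add: haar_space[OF M])
      have "(f has_derivative D X) (at X)" using f by (simp add: C1_complex_def)
      from has_derivative_sequence[OF this t hlim[OF X]]
      show "(\<lambda>n. s n X) \<longlonglongrightarrow> D X (u ** X)" unfolding s_def YX .
    qed
    show "AE X in M. norm (s n X) \<le> L * (R * K)" for n
    proof (rule AE_I2)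
      fix X assume "X \<in> space M"
      hence X: "X \<in> USp" by (simp add: haar_space[OF M])
      have "norm (f (Y n ** X) - f X) \<le> L * norm (Y n ** X - X)"
        using R[OF X] R[OF USp_mult[OF Y(1) X]] by (intro L(2)) auto
      also have "norm (Y n ** X - X) = t n * norm (h n X)"
        using t(2)[of n] by (simp add: YX)
      also have "L * (t n * norm (h n X)) \<le> L * (t n * (R * K))"
        using L(1) hb[OF X] t(2)[of n] by (intro mult_left_mono) auto
      finally have "norm (f (Y n ** X) - f X) \<le> L * (t n * (R * K))" .
      hence "norm (f (Y n ** X) - f X) \<le> t n * (L * (R * K))" by (simp only: mult.left_commute)
      moreover have "norm (s n X) = norm (f (Y n ** X) - f X) / t n"
        using t(2)[of n] by (simp add: s_def divide_inverse mult.commute)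
      ultimately show "norm (s n X) \<le> L * (R * K)"
        using t(2)[of n] by (simp only: pos_divide_le_eq mult.commute[of "t n"])
    qed
  qed
  hence "(\<lambda>n. 0) \<longlonglongrightarrow> (\<integral>X. D X (u ** X) \<partial>M)" by (simp add: s0)
  thus ?thesis by (simp add: LIMSEQ_const_iff)
qed

lemma sympl_adjoint_mat_mult: "sympl_adjoint (mat c ** X) = mat c ** sympl_adjoint X"
proof -
  have "sympl_adjoint (mat c) = (mat c :: complex^('a + 'a)^('a + 'a))"
  proof -
    have "JJ ** mat c ** JJ = mat c ** (JJ ** JJ :: complex^('a + 'a)^('a + 'a))"
      by (simp only: mat_commute[symmetric] matrix_mul_assoc)
    thus ?thesis by (simp add: sympl_adjoint_def J_squared matrix_minus_right)
  qed
  thus ?thesis by (simp only: sympl_adjoint_mult mat_commute)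
qed

lemma sympl_adjoint_conj_transpose: "sympl_adjoint (conj_transpose X) = conj_transpose (sympl_adjoint X)"
proof -
  have J: "conj_transpose JJ = - (JJ :: complex^('a + 'a)^('a + 'a))"
  proof -
    have "conj_transpose JJ $ i $ j = (- JJ :: complex^('a + 'a)^('a + 'a)) $ i $ j" for i j :: "'a + 'a"
      by (cases i; cases j) (auto simp: conj_transpose_def transpose_def symplectic_J_def)
    thus ?thesis by (simp add: vec_eq_iff)
  qed
  have "conj_transpose (transpose X) = transpose (conj_transpose X)"
    by (simp add: conj_transpose_def transpose_def vec_eq_iff)
  thus ?thesis
    by (simp add: sympl_adjoint_def conj_transpose_linear conj_transpose_mult J matrix_minus_left matrix_minus_right matrix_mul_assoc)
qed

text \<open>
  The complexified Lie algebra is the direct sum of its skew-Hermitian and Hermitian parts, and the Hermitian part is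
  \<open>\<i>\<close> times the skew-Hermitian one.
\<close>

lemma haar_derivative_zero:
  fixes M :: "(complex^('g::finite + 'g)^('g + 'g)) measure"
  assumes M: "normalized_haar_measure USp M" and f: "C1_complex f D"
    and u: "sympl_adjoint u = - u"
  shows "(\<integral>X. D X (u ** X) \<partial>M) = 0"
proof -
  define a where "a = mat (1 / 2) ** (u - conj_transpose u)"
  define b where "b = mat (- \<i> / 2) ** (u + conj_transpose u)"
  have cc: "conj_transpose (conj_transpose u) = u"
    by (simp add: conj_transpose_def transpose_def vec_eq_iff)
  have a: "conj_transpose a = - a" "sympl_adjoint a = - a"
    by (simp_all add: a_def conj_transpose_mult conj_transpose_linear cc mat_commute[symmetric]
        matrix_sub_ldistrib sympl_adjoint_mat_mult sympl_adjoint_linear sympl_adjoint_conj_transpose u matrix_minus_right)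
  have b: "conj_transpose b = - b" "sympl_adjoint b = - b"
     apply (simp_all add: b_def conj_transpose_mult conj_transpose_linear cc mat_commute[symmetric]
        sympl_adjoint_mat_mult sympl_adjoint_linear sympl_adjoint_conj_transpose u)
     apply (simp_all add: vec_eq_iff mat_mult_component algebra_simps)
    done
  have ub: "u = a + mat \<i> ** b"
    unfolding a_def b_def by (simp add: vec_eq_iff mat_mult_component matrix_mul_assoc mat_mult_mat algebra_simps)
  have "D X (u ** X) = D X (a ** X) + \<i> * D X (b ** X)" for X
  proof -
    have lin: "linear (D X)" using f has_derivative_linear by (auto simp: C1_complex_def)
    have "u ** X = a ** X + mat \<i> ** (b ** X)" by (subst ub) (simp add: matrix_add_rdistrib matrix_mul_assoc)
    thus ?thesis using f by (simp add: linear_add[OF lin] C1_complex_def)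
  qed
  moreover have "integrable M (\<lambda>X. D X (v ** X))" for v
    by (intro haar_integrable[OF M] C1_complex_derivative_continuous[OF f] continuous_intros)
  ultimately show ?thesis
    by (simp add: haar_derivative_zero_real[OF M f a] haar_derivative_zero_real[OF M f b])
qed

section \<open>Loop equations for Haar measure\<close>

primrec mpow_deriv :: "complex^'n^'n \<Rightarrow> nat \<Rightarrow> complex^'n^'n \<Rightarrow> complex^'n^'n" where
  "mpow_deriv X 0 V = 0"
| "mpow_deriv X (Suc k) V = V ** mpow X k + X ** mpow_deriv X k V"

lemma mpow_has_derivative: "((\<lambda>X. mpow X k) has_derivative mpow_deriv X k) (at X)"
proof (induction k)
  case 0
  show ?case by (simp add: has_derivative_const)
next
  case (Suc k)
  from bounded_bilinear.FDERIV[OF bounded_bilinear_matrix_mult has_derivative_ident this]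
  have "((\<lambda>X. X ** mpow X k) has_derivative (\<lambda>V. X ** mpow_deriv X k V + V ** mpow X k)) (at X)" .
  moreover have "(\<lambda>V. X ** mpow_deriv X k V + V ** mpow X k) = mpow_deriv X (Suc k)"
    by (simp add: fun_eq_iff add.commute)
  ultimately show ?case by (simp only: mpow.simps)
qed

lemma continuous_mpow [continuous_intros]: "continuous_on S (\<lambda>X::complex^'n^'n. mpow X k)"
  by (induction k) (auto intro!: continuous_intros)

lemma continuous_mpow_deriv: "continuous_on S (\<lambda>X. mpow_deriv X k V)"
  by (induction k) (auto intro!: continuous_intros)

lemma mpow_deriv_mat_mult: "mpow_deriv X k (mat c ** V) = mat c ** mpow_deriv X k V"
proof (induction k)
  case (Suc k)
  have "X ** (mat c ** mpow_deriv X k V) = mat c ** (X ** mpow_deriv X k V)"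
    by (simp only: matrix_mul_assoc mat_commute[of c X])
  thus ?case using Suc by (simp add: matrix_add_ldistrib matrix_mul_assoc)
qed simp

lemma mpow_deriv_eq: "mpow_deriv X k V = (\<Sum>l<k. mpow X l ** V ** mpow X (k - Suc l))"
proof (induction k)
  case (Suc k)
  have "X ** (\<Sum>l<k. mpow X l ** V ** mpow X (k - Suc l)) = (\<Sum>l<k. X ** (mpow X l ** V ** mpow X (k - Suc l)))"
    using linear_sum[OF bounded_linear.linear[OF bounded_bilinear.bounded_linear_right[OF bounded_bilinear_matrix_mult]]] .
  thus ?case
    by (simp add: Suc sum.lessThan_Suc_shift matrix_mul_assoc del: sum.lessThan_Suc)
qed simp

lemma C1_complex_mpow_entry:
  fixes i j :: "'n::finite"
  shows "C1_complex (\<lambda>X. mpow X k $ i $ j) (\<lambda>X V. mpow_deriv X k V $ i $ j)"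
proof -
  have bl: "bounded_linear (\<lambda>X::complex^'n^'n. X $ i $ j)"
    by (rule bounded_linear_compose[OF bounded_linear_vec_nth bounded_linear_vec_nth])
  have "((\<lambda>X::complex^'n^'n. mpow X k $ i $ j) has_derivative (\<lambda>V. mpow_deriv X k V $ i $ j)) (at X)" for X
    by (rule bounded_linear.has_derivative[OF bl mpow_has_derivative])
  moreover have "continuous_on UNIV (\<lambda>X::complex^'n^'n. mpow_deriv X k V $ i $ j)" for V
    by (rule bounded_linear.continuous_on[OF bl continuous_mpow_deriv])
  ultimately show ?thesis
    by (auto simp: C1_complex_def mpow_deriv_mat_mult mat_mult_component)
qed

lemma C1_complex_sum:
  "finite I \<Longrightarrow> (\<And>i. i \<in> I \<Longrightarrow> C1_complex (f i) (D i)) \<Longrightarrow> C1_complex (\<lambda>X. \<Sum>i\<in>I. f i X) (\<lambda>X V. \<Sum>i\<in>I. D i X V)"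
proof (induction I rule: finite_induct)
  case empty
  show ?case using C1_complex_const[of 0] by simp
next
  case (insert i I)
  from C1_complex_add[of "f i" "D i" "\<lambda>X. \<Sum>i\<in>I. f i X" "\<lambda>X V. \<Sum>i\<in>I. D i X V"] insert
  show ?case by simp
qed

lemma C1_complex_trace_mpow: "C1_complex (\<lambda>X. trace (mpow X k)) (\<lambda>X V. trace (mpow_deriv X k V))"
  unfolding trace_def by (intro C1_complex_sum C1_complex_mpow_entry) auto

definition unit_matrix :: "'n \<Rightarrow> 'n \<Rightarrow> complex^'n^'n" where
  "unit_matrix i j = (\<chi> a b. if a = i \<and> b = j then 1 else 0)"

lemma mult_unit_mult: "(L ** unit_matrix i j ** N) $ a $ b = L $ a $ i * N $ j $ b"
proof -
  have "(L ** unit_matrix i j) $ a $ c = (if c = j then L $ a $ i else 0)" for c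
    by (simp add: matrix_matrix_mult_def unit_matrix_def if_distrib if_distribR cong: if_cong)
  hence "(L ** unit_matrix i j ** N) $ a $ b = (\<Sum>c\<in>UNIV. (if c = j then L $ a $ i else 0) * N $ c $ b)"
    by (simp only: matrix_matrix_mult_def[of "L ** unit_matrix i j"] vec_lambda_beta)
  also have "\<dots> = (\<Sum>c\<in>UNIV. if c = j then L $ a $ i * N $ j $ b else 0)"
    by (intro sum.cong) auto
  finally show ?thesis by simp
qed

lemma transpose_unit: "transpose (unit_matrix i j) = unit_matrix j i"
  by (auto simp: transpose_def unit_matrix_def vec_eq_iff)

lemma unit_matrix_expansion: "(\<Sum>i\<in>UNIV. \<Sum>j\<in>UNIV. mat (K $ i $ j) ** unit_matrix i j) = K"
proof -
  have "(\<Sum>j\<in>UNIV. K $ i $ j * (if a = i \<and> b = j then 1 else 0)) = (if a = i then K $ a $ b else 0)" for i a b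
    by (cases "a = i") (auto simp: if_distrib cong: if_cong)
  thus ?thesis
    by (simp add: vec_eq_iff mat_mult_component unit_matrix_def)
qed

text \<open>
  Twice the projections of the matrix units to the complexified Lie algebra. Indexing a linearly dependent family by all pairs
  \<open>i, j\<close> keeps the Casimir sums below free of a case distinction between long and short roots.
\<close>

definition sp_generator :: "'g + 'g \<Rightarrow> 'g + 'g \<Rightarrow> complex^('g::finite + 'g)^('g + 'g)" where
  "sp_generator i j = unit_matrix i j - sympl_adjoint (unit_matrix i j)"

lemma sympl_adjoint_sympl_adjoint: "sympl_adjoint (sympl_adjoint X) = X"
proof -
  have "JJ ** transpose (JJ ** transpose X ** JJ) ** JJ = (JJ ** JJ) ** X ** (JJ ** JJ)"
    by (simp add: matrix_transpose_mul transpose_J matrix_minus_left matrix_minus_right matrix_mul_assoc)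
  thus ?thesis
    by (simp add: sympl_adjoint_def transpose_minus matrix_minus_left matrix_minus_right J_squared)
qed

lemma sp_generator_in_sp: "sympl_adjoint (sp_generator i j) = - sp_generator i j"
  by (simp add: sp_generator_def sympl_adjoint_linear sympl_adjoint_sympl_adjoint)

text \<open>
  The Casimir element of the Lie algebra: the matrix units contribute a product of traces, their symplectic adjoints
  a single trace.
\<close>

lemma sum_sp_generator_trace:
  "(\<Sum>i\<in>UNIV. \<Sum>j\<in>UNIV. (L ** sp_generator i j ** N) $ i $ j) = trace L * trace N + trace (sympl_adjoint L ** N)"
proof -
  have "(L ** sp_generator i j ** N) $ i $ j = L $ i $ i * N $ j $ j + (L ** JJ) $ i $ j * (JJ ** N) $ i $ j" for i j
  proof -
    have "L ** sp_generator i j ** N = L ** unit_matrix i j ** N + (L ** JJ) ** unit_matrix j i ** (JJ ** N)"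
      by (simp add: sp_generator_def sympl_adjoint_def transpose_unit matrix_add_ldistrib matrix_add_rdistrib matrix_mul_assoc)
    thus ?thesis by (simp add: mult_unit_mult)
  qed
  moreover have "(\<Sum>i\<in>UNIV. \<Sum>j\<in>UNIV. (L ** JJ) $ i $ j * (JJ ** N) $ i $ j) = trace (sympl_adjoint L ** N)"
  proof -
    have "sympl_adjoint L ** N = transpose (L ** JJ) ** (JJ ** N)"
      by (simp add: sympl_adjoint_def matrix_transpose_mul transpose_J matrix_minus_left matrix_mul_assoc)
    moreover have "trace (transpose P ** Q) = (\<Sum>j\<in>UNIV. \<Sum>i\<in>UNIV. P $ i $ j * Q $ i $ j)"
      for P Q :: "complex^('a + 'a)^('a + 'a)"
      by (simp add: trace_def matrix_matrix_mult_def transpose_def)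
    ultimately have "trace (sympl_adjoint L ** N) = (\<Sum>j\<in>UNIV. \<Sum>i\<in>UNIV. (L ** JJ) $ i $ j * (JJ ** N) $ i $ j)"
      by simp
    thus ?thesis by (subst sum.swap) simp
  qed
  ultimately show ?thesis
    by (simp add: sum.distrib trace_def sum_product)
qed

lemma sum_sp_generator:
  "(\<Sum>i\<in>UNIV. \<Sum>j\<in>UNIV. mat (K $ i $ j) ** sp_generator i j) = K - sympl_adjoint K"
proof -
  have lin: "linear sympl_adjoint"
    by (simp add: linear_iff sympl_adjoint_linear)
  have "sympl_adjoint K = sympl_adjoint (\<Sum>i\<in>UNIV. \<Sum>j\<in>UNIV. mat (K $ i $ j) ** unit_matrix i j)"
    by (simp only: unit_matrix_expansion)
  also have "\<dots> = (\<Sum>i\<in>UNIV. \<Sum>j\<in>UNIV. mat (K $ i $ j) ** sympl_adjoint (unit_matrix i j))"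
    by (simp only: linear_sum[OF lin] sympl_adjoint_mat_mult)
  finally show ?thesis
    by (simp add: sp_generator_def matrix_sub_ldistrib sum_subtractf unit_matrix_expansion)
qed

text \<open>
  Integrate the divergence of \<open>f\<close> times the vector field \<open>X \<mapsto> (X\<^sup>k - X\<^sup>-\<^sup>k) X\<close>. Its coefficient along the generator with index
  \<open>i, j\<close> is the entry \<open>i, j\<close> of \<open>X\<^sup>k\<close>; differentiating these entries gives the sum over \<open>l\<close>, differentiating \<open>f\<close> the second term.
\<close>

theorem loop_equation:
  fixes M :: "(complex^('g::finite + 'g)^('g + 'g)) measure"
  assumes M: "normalized_haar_measure USp M" and f: "C1_complex f D"
  shows "(\<integral>X. (\<Sum>l<k. trace (mpow X l) * trace (mpow X (k - l)) +
            trace (mpow (sympl_adjoint X) l ** mpow X (k - l))) * f X +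
          D X ((mpow X k - mpow (sympl_adjoint X) k) ** X) \<partial>M) = 0"
proof -
  let ?E = "\<lambda>i j X V. mpow X k $ i $ j * D X V + mpow_deriv X k V $ i $ j * f X"
  have C1_complex: "C1_complex (\<lambda>X. mpow X k $ i $ j * f X) (?E i j)" for i j
    by (rule C1_complex_mult[OF C1_complex_mpow_entry f])
  have "(\<integral>X. (\<Sum>i\<in>UNIV. \<Sum>j\<in>UNIV. ?E i j X (sp_generator i j ** X)) \<partial>M)
      = (\<Sum>i\<in>UNIV. \<Sum>j\<in>UNIV. \<integral>X. ?E i j X (sp_generator i j ** X) \<partial>M)"
  proof -
    have "integrable M (\<lambda>X. ?E i j X (sp_generator i j ** X))" for i j
      by (intro haar_integrable[OF M] C1_complex_derivative_continuous[OF C1_complex] continuous_intros)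
    thus ?thesis by (subst Bochner_Integration.integral_sum; (intro Bochner_Integration.integrable_sum)?; simp)
  qed
  also have "\<dots> = 0"
    by (intro sum.neutral ballI haar_derivative_zero[OF M C1_complex] sp_generator_in_sp)
  also have "(\<lambda>X. \<Sum>i\<in>UNIV. \<Sum>j\<in>UNIV. ?E i j X (sp_generator i j ** X)) =
    (\<lambda>X. (\<Sum>l<k. trace (mpow X l) * trace (mpow X (k - l)) +
            trace (mpow (sympl_adjoint X) l ** mpow X (k - l))) * f X +
          D X ((mpow X k - mpow (sympl_adjoint X) k) ** X))"
  proof
    fix X
    have lin: "linear (D X)" using f has_derivative_linear by (auto simp: C1_complex_def)
    have "(\<Sum>i\<in>UNIV. \<Sum>j\<in>UNIV. mpow X k $ i $ j * D X (sp_generator i j ** X)) =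
      D X ((\<Sum>i\<in>UNIV. \<Sum>j\<in>UNIV. mat (mpow X k $ i $ j) ** sp_generator i j) ** X)"
    proof -
      have r: "linear (\<lambda>Y. Y ** X)"
        using bounded_linear.linear[OF bounded_bilinear.bounded_linear_left[OF bounded_bilinear_matrix_mult]] .
      show ?thesis
        using f by (simp add: linear_sum[OF r] linear_sum[OF lin] matrix_mul_assoc[symmetric] C1_complex_def)
    qed
    hence 1: "(\<Sum>i\<in>UNIV. \<Sum>j\<in>UNIV. mpow X k $ i $ j * D X (sp_generator i j ** X)) =
      D X ((mpow X k - mpow (sympl_adjoint X) k) ** X)"
      by (simp only: sum_sp_generator sympl_adjoint_mpow)
    have "mpow_deriv X k (V ** X) = (\<Sum>l<k. mpow X l ** V ** mpow X (k - l))" for V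
    proof -
      have "mpow X l ** (V ** X) ** mpow X (k - Suc l) = mpow X l ** V ** mpow X (k - l)" if "l < k" for l
        using that mpow.simps(2)[of X "k - Suc l"] by (simp add: matrix_mul_assoc[symmetric] Suc_diff_Suc)
      thus ?thesis by (simp add: mpow_deriv_eq)
    qed
    hence "(\<Sum>i\<in>UNIV. \<Sum>j\<in>UNIV. mpow_deriv X k (sp_generator i j ** X) $ i $ j) =
      (\<Sum>i\<in>UNIV. \<Sum>j\<in>UNIV. \<Sum>l<k. (mpow X l ** sp_generator i j ** mpow X (k - l)) $ i $ j)"
      by simp
    also have "\<dots> = (\<Sum>l<k. \<Sum>i\<in>UNIV. \<Sum>j\<in>UNIV. (mpow X l ** sp_generator i j ** mpow X (k - l)) $ i $ j)"
      by (simp only: sum.swap[of _ "{..<k}"])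
    also have "\<dots> = (\<Sum>l<k. trace (mpow X l) * trace (mpow X (k - l)) +
            trace (mpow (sympl_adjoint X) l ** mpow X (k - l)))"
      by (simp only: sum_sp_generator_trace sympl_adjoint_mpow)
    finally show "(\<Sum>i\<in>UNIV. \<Sum>j\<in>UNIV. ?E i j X (sp_generator i j ** X)) =
      (\<Sum>l<k. trace (mpow X l) * trace (mpow X (k - l)) +
            trace (mpow (sympl_adjoint X) l ** mpow X (k - l))) * f X +
          D X ((mpow X k - mpow (sympl_adjoint X) k) ** X)"
      using 1 by (simp add: sum.distrib sum_distrib_right[symmetric])
  qed
  finally show ?thesis .
qed


section \<open>The moment recurrences and their uniqueness\<close>

text \<open>
  In the three expressions \<open>f i j k\<close> stands for the moment of \<open>e\<^sub>1\<^sup>i e\<^sub>2\<^sup>j e\<^sub>3\<^sup>k\<close>. Expression number \<open>k\<close> encodes \<open>d F + V F\<close> for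
  \<open>F = e\<^sub>1\<^sup>a e\<^sub>2\<^sup>b e\<^sub>3\<^sup>c\<close>, where \<open>V\<close> is the derivation with \<open>V x\<^sub>j = (x\<^sub>j\<^sup>2 - 4) U(x\<^sub>j)\<close>, \<open>U\<close> is respectively \<open>1\<close>,
  \<open>x\<close>, \<open>x\<^sup>2 - 1\<close> (the Chebyshev polynomials of the second kind), and \<open>d\<close> is the divergence of \<open>V\<close>. The three bracketed
  factors are \<open>V e\<^sub>1\<close>, \<open>V e\<^sub>2\<close>, \<open>V e\<^sub>3\<close> as polynomials in the \<open>e\<^sub>i\<close>, as the lemmas on monomials below make explicit.
  The exponents \<open>a - 1\<close>, \<open>b - 1\<close>, \<open>c - 1\<close> are harmless for exponent zero because of the factor in front. For \<open>g = 2\<close> the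
  formulas are used with \<open>e\<^sub>3 = 0\<close>.
\<close>

definition loop1 :: "nat \<Rightarrow> (nat \<Rightarrow> nat \<Rightarrow> nat \<Rightarrow> 'a::comm_ring_1) \<Rightarrow> nat \<Rightarrow> nat \<Rightarrow> nat \<Rightarrow> 'a" where
  "loop1 g f a b c = of_nat (2*g+1) * f (a+1) b c
    + of_nat a * (f (a+1) b c - of_nat 2 * f (a-1) (b+1) c - of_nat (4*g) * f (a-1) b c)
    + of_nat b * (f (a+1) b c - of_nat 3 * f a (b-1) (c+1) - of_nat (4*(g-1)) * f (a+1) (b-1) c)
    + of_nat c * (f (a+1) b c - of_nat (4*(g-2)) * f a (b+1) (c-1))"

definition loop2 :: "nat \<Rightarrow> (nat \<Rightarrow> nat \<Rightarrow> nat \<Rightarrow> 'a::comm_ring_1) \<Rightarrow> nat \<Rightarrow> nat \<Rightarrow> nat \<Rightarrow> 'a" where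
  "loop2 g f a b c = of_nat (2*g+2) * f (a+2) b c - of_nat (4*g+2) * f a (b+1) c - of_nat (4*g*g) * f a b c
    + of_nat a * (f (a+2) b c - of_nat 3 * f a (b+1) c + of_nat 3 * f (a-1) b (c+1) - of_nat 4 * f a b c)
    + of_nat b * (f (a+2) b c - of_nat 2 * f a (b+1) c - f (a+1) (b-1) (c+1) - of_nat 8 * f a b c)
    + of_nat c * (f (a+2) b c - of_nat 2 * f a (b+1) c - of_nat 12 * f a b c)"

definition loop3 :: "nat \<Rightarrow> (nat \<Rightarrow> nat \<Rightarrow> nat \<Rightarrow> 'a::comm_ring_1) \<Rightarrow> nat \<Rightarrow> nat \<Rightarrow> nat \<Rightarrow> 'a" where
  "loop3 g f a b c = of_nat (2*g+3) * f (a+3) b c - of_nat (6*g+7) * f (a+1) (b+1) c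
    + of_nat (6*g+3) * f a b (c+1) - of_nat (10*g+1) * f (a+1) b c
    + of_nat a * (f (a+3) b c - of_nat 4 * f (a+1) (b+1) c + of_nat 2 * f (a-1) (b+2) c
        + of_nat 4 * f a b (c+1) - of_nat 5 * f (a+1) b c + of_nat 10 * f (a-1) (b+1) c
        + of_nat (4*g) * f (a-1) b c)
    + of_nat b * (f (a+3) b c - of_nat 3 * f (a+1) (b+1) c + of_nat 5 * f a b (c+1)
        - f (a+2) (b-1) (c+1) - of_nat 5 * f (a+1) b c + of_nat 15 * f a (b-1) (c+1)
        + of_nat (4*(g-1)) * f (a+1) (b-1) c)
    + of_nat c * (f (a+3) b c - of_nat 3 * f (a+1) (b+1) c + of_nat 3 * f a b (c+1)
        - of_nat 5 * f (a+1) b c + of_nat (4*(g-2)) * f a (b+1) (c-1))"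

definition loop_moments :: "nat \<Rightarrow> (nat \<Rightarrow> nat \<Rightarrow> nat \<Rightarrow> complex) \<Rightarrow> bool" where
  "loop_moments g m \<longleftrightarrow> (\<forall>a b c. loop1 g m a b c = 0 \<and> loop2 g m a b c = 0 \<and> loop3 g m a b c = 0)"

lemma loop_moments_diff:
  assumes "loop_moments g m" "loop_moments g m'"
  shows "loop_moments g (\<lambda>a b c. m a b c - m' a b c)"
proof -
  have "loop1 g (\<lambda>a b c. m a b c - m' a b c) a b c = loop1 g m a b c - loop1 g m' a b c"
    "loop2 g (\<lambda>a b c. m a b c - m' a b c) a b c = loop2 g m a b c - loop2 g m' a b c"
    "loop3 g (\<lambda>a b c. m a b c - m' a b c) a b c = loop3 g m a b c - loop3 g m' a b c" for a b c
    unfolding loop1_def loop2_def loop3_def by (simp_all only: ring_distribs) (simp_all add: algebra_simps)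
  thus ?thesis using assms by (simp add: loop_moments_def)
qed

text \<open>
  Up to sign the Casimir operator is the sum over \<open>i\<close> of the divergence of \<open>(\<partial>F / \<partial>e\<^sub>i) \<nabla>e\<^sub>i\<close>, where \<open>\<nabla>\<close> has the
  components \<open>(x\<^sub>j\<^sup>2 - 4) \<partial>\<^sub>j\<close>. In terms of the three fields the gradients are \<open>\<nabla>e\<^sub>1 = V\<^sub>1\<close>, \<open>\<nabla>e\<^sub>2 = e\<^sub>1 V\<^sub>1 - V\<^sub>2\<close>, \<open>\<nabla>e\<^sub>3 = (e\<^sub>2 + 1) V\<^sub>1 - e\<^sub>1 V\<^sub>2 + V\<^sub>3\<close>. So each \<open>e\<^sub>i\<close> contributes one
  combination of recurrences, and all of these are triangular for the following order: compare the degree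
  \<open>a + 2 b + 3 c\<close> first, then \<open>a + b + c\<close>, then \<open>b\<close>. The second entry decreases in \<open>e\<^sub>1\<^sup>2 \<rightarrow> e\<^sub>2\<close> and \<open>e\<^sub>1 e\<^sub>2 \<rightarrow> e\<^sub>3\<close>,
  the third in \<open>e\<^sub>2\<^sup>2 \<rightarrow> e\<^sub>1 e\<^sub>3\<close>. The total diagonal coefficient is the Casimir eigenvalue of the highest weight
  \<open>(a + b + c, b + c, c)\<close>.
\<close>

lemma loop_moments_zero:
  assumes g: "g \<ge> 2" and d: "loop_moments g d" and d0: "d 0 0 0 = 0"
  shows "d a b c = 0"
proof (induction "(a, b, c)" arbitrary: a b c rule: wf_induct_rule[OF wf_measures[of
      "[\<lambda>(a, b, c). a + 2 * b + 3 * c, \<lambda>(a, b, c). a + b + c, \<lambda>(a, b, c). b]"]])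
  case 1
  have low: "d i j k = 0" if "i + 2*j + 3*k < a + 2*b + 3*c \<or>
      i + 2*j + 3*k = a + 2*b + 3*c \<and> (i + j + k < a + b + c \<or> i + j + k = a + b + c \<and> j < b)" for i j k
    using that by (intro 1) auto
  \<comment> \<open>Below the substitution removes the truncated differences \<open>g - 1\<close> and \<open>g - 2\<close> from the coefficients.\<close>
  obtain h where h: "g = h + 2" using g by (metis le_add_diff_inverse2)
  \<comment> \<open>Contribution of \<open>(\<partial>F / \<partial>e\<^sub>1) \<nabla>e\<^sub>1\<close>; the next two facts treat \<open>e\<^sub>2\<close> and \<open>e\<^sub>3\<close> alike.\<close>
  have A: "of_nat a * (of_nat (2*g + a + b + c) * d a b c) = 0"
  proof (cases a)
    case (Suc a')
    have z1: "of_nat a' * d (a' - 1) (b+1) c = 0" "of_nat a' * d (a' - 1) b c = 0"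
      by (cases a'; auto intro!: low simp: Suc)+
    have z2: "of_nat b * d a' (b-1) (c+1) = 0" "of_nat b * d (a'+1) (b-1) c = 0"
      by (cases b; auto intro!: low simp: Suc)+
    have z3: "of_nat c * d a' (b+1) (c-1) = 0"
      by (cases c; auto intro!: low simp: Suc)
    have l: "loop1 g d a' b c = 0" using d by (simp add: loop_moments_def)
    have "of_nat (2*g + a + b + c) * d a b c = loop1 g d a' b c
        + 2 * (of_nat a' * d (a' - 1) (b+1) c) + of_nat (4*g) * (of_nat a' * d (a' - 1) b c)
        + 3 * (of_nat b * d a' (b-1) (c+1)) + of_nat (4*(g-1)) * (of_nat b * d (a'+1) (b-1) c)
        + of_nat (4*(g-2)) * (of_nat c * d a' (b+1) (c-1))"
      unfolding loop1_def Suc by (simp add: algebra_simps)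
    thus ?thesis by (simp only: l z1 z2 z3) simp
  qed simp
  have B: "of_nat b * (of_nat (4*h + 6 + a + 2*b + 2*c) * d a b c) = 0"
  proof (cases b)
    case (Suc b')
    have z: "of_nat b' * d (a+1) (b'-1) (c+1) = 0" "of_nat b' * d (a+2) (b'-1) c = 0"
      by (cases b'; auto intro!: low simp: Suc)+
    have z2: "of_nat a * d (a-1) b' (c+1) = 0"
      by (cases a; auto intro!: low simp: Suc)
    have z3: "of_nat c * d (a+1) (b'+1) (c-1) = 0"
      by (cases c; auto intro!: low simp: Suc)
    have z4: "d a b' c = 0" by (intro low) (simp add: Suc)
    have l: "loop1 g d (a+1) b' c = 0" "loop2 g d a b' c = 0" using d by (auto simp: loop_moments_def)
    have "of_nat (4*h + 6 + a + 2*b + 2*c) * d a b c =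
        loop1 g d (a+1) b' c - loop2 g d a b' c
        + 2 * (of_nat b' * d (a+1) (b'-1) (c+1)) + of_nat (4*(h+1)) * (of_nat b' * d (a+2) (b'-1) c)
        + 3 * (of_nat a * d (a-1) b' (c+1)) + of_nat (4*h) * (of_nat c * d (a+1) (b'+1) (c-1))
        + d a b' c * (of_nat (4*g) * of_nat (a+1) - of_nat (4*g*g) - of_nat (4*a+8*b'+12*c))"
      unfolding loop1_def loop2_def h Suc
      by (simp add: algebra_simps)
    thus ?thesis by (simp only: l z z2 z3 z4) simp
  qed simp
  have Cc: "of_nat c * (of_nat (6*h + 6 + a + 2*b + 3*c) * d a b c) = 0"
  proof (cases c)
    case (Suc c')
    have z1: "of_nat a * d (a-1) (b+1) c' = 0"
      by (cases a; auto intro!: low simp: Suc)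
    have z2: "of_nat b * d a (b-1) (c'+1) = 0"
      by (cases b; auto intro!: low simp: Suc)
    have z3: "of_nat c' * d a (b+2) (c'-1) = 0"
      by (cases c'; auto intro!: low simp: Suc)
    have z4: "d (a+1) b c' = 0" by (intro low) (simp add: Suc)
    have l: "loop1 g d a (b+1) c' = 0" "loop1 g d a b c' = 0" "loop2 g d (a+1) b c' = 0" "loop3 g d a b c' = 0"
      using d by (auto simp: loop_moments_def)
    have s3: "Suc (Suc (Suc a)) = a + 3" by simp
    have "of_nat (6*h + 6 + a + 2*b + 3*c) * d a b c =
        loop1 g d a (b+1) c' + loop1 g d a b c' - loop2 g d (a+1) b c' + loop3 g d a b c'
        + 4 * of_nat h * (of_nat a * d (a-1) (b+1) c') - 12 * (of_nat b * d a (b-1) (c'+1))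
        + 4 * of_nat h * (of_nat c' * d a (b+2) (c'-1))
        + (4 * of_nat (h+1) * of_nat (b+1) - 4 * of_nat (g*g) + 8 * of_nat g - 4 - 4 * of_nat b - 8 * of_nat c') * d (a+1) b c'"
      unfolding loop1_def loop2_def loop3_def h Suc
      by (simp add: algebra_simps s3)
    thus ?thesis by (simp only: l z1 z2 z3 z4) simp
  qed simp
  show ?case
  proof (cases "a = 0 \<and> b = 0 \<and> c = 0")
    case False
    have "of_nat (a*(2*g + a + b + c) + b*(4*h + 6 + a + 2*b + 2*c) + c*(6*h + 6 + a + 2*b + 3*c)) * d a b c = 0"
      using A B Cc by (simp only: of_nat_add of_nat_mult ring_distribs mult.assoc) simp
    moreover have "a*(2*g + a + b + c) + b*(4*h + 6 + a + 2*b + 2*c) + c*(6*h + 6 + a + 2*b + 3*c) \<noteq> 0"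
      using False g by auto
    ultimately show ?thesis by (simp only: mult_eq_0_iff of_nat_eq_0_iff) blast
  qed (simp add: d0)
qed

theorem loop_moments_unique:
  assumes "g \<ge> 2" "loop_moments g m" "loop_moments g m'" "m 0 0 0 = m' 0 0 0"
  shows "m a b c = m' a b c"
  using loop_moments_zero[OF assms(1) loop_moments_diff[OF assms(2,3)], of a b c] assms(4) by simp

lemma loop1_monomial:
  fixes p q r :: "'a::comm_ring_1"
  defines "F \<equiv> \<lambda>i j k. p ^ i * q ^ j * r ^ k"
  shows "loop1 g F a b c = of_nat (2 * g+1) * p * F a b c
    + of_nat a * F (a-1) b c * (p\<^sup>2 - 2 * q - of_nat (4 * g))
    + of_nat b * F a (b-1) c * (p * q - 3 * r - of_nat (4 * (g-1)) * p)
    + of_nat c * F a b (c-1) * (p * r - of_nat (4 * (g-2)) * q)"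
  unfolding loop1_def F_def
  by (cases a; cases b; cases c) (simp_all add: algebra_simps power2_eq_square)

lemma loop2_monomial:
  fixes p q r :: "'a::comm_ring_1"
  defines "F \<equiv> \<lambda>i j k. p ^ i * q ^ j * r ^ k"
  shows "loop2 g F a b c = (of_nat (2 * g+2) * p\<^sup>2 - of_nat (4 * g+2) * q - of_nat (4 * g * g)) * F a b c
    + of_nat a * F (a-1) b c * (p^3 - 3 * p * q + 3 * r - 4 * p)
    + of_nat b * F a (b-1) c * (p\<^sup>2 * q - 2 * q\<^sup>2 - p * r - 8 * q)
    + of_nat c * F a b (c-1) * (r * p\<^sup>2 - 2 * r * q - 12 * r)"
  unfolding loop2_def F_def
  by (cases a; cases b; cases c) (simp_all add: algebra_simps power2_eq_square power3_eq_cube)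

lemma loop3_monomial:
  fixes p q r :: "'a::comm_ring_1"
  defines "F \<equiv> \<lambda>i j k. p ^ i * q ^ j * r ^ k"
  shows "loop3 g F a b c = (of_nat (2 * g+3) * p^3 - of_nat (6 * g+7) * p * q + of_nat (6 * g+3) * r
      - of_nat (10 * g+1) * p) * F a b c
    + of_nat a * F (a-1) b c * (p^4 - 4 * p\<^sup>2 * q + 2 * q\<^sup>2 + 4 * p * r - 5 * p\<^sup>2 + 10 * q + of_nat (4 * g))
    + of_nat b * F a (b-1) c * (p^3 * q - 3 * p * q\<^sup>2 + 5 * q * r - p\<^sup>2 * r - 5 * p * q + 15 * r + of_nat (4 * (g-1)) * p)
    + of_nat c * F a b (c-1) * (p^3 * r - 3 * p * q * r + 3 * r\<^sup>2 - 5 * p * r + of_nat (4 * (g-2)) * q)"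
  unfolding loop3_def F_def
  by (cases a; cases b; cases c) (simp_all add: algebra_simps power2_eq_square power3_eq_cube power4_eq_xxxx power_add)

section \<open>The semicircle functional\<close>

lemma C_odd: "odd n \<Longrightarrow> C n = 0"
  by (simp add: C_def B_def)

lemma C_even: "C (2 * n) = int (2 * n choose n) - int (2 * n choose Suc n)"
proof -
  have "B 0 (2 * n) = int (2 * n choose n)" by (simp add: B_def)
  moreover have "B 2 (2 * n) = int (2 * n choose Suc n)"
  proof -
    have "(int (2 * n) + 2) div 2 = int (Suc n)" by simp
    hence "B 2 (2 * n) = (if int (Suc n) \<in> {0..int (2 * n)} then int (2 * n choose nat (int (Suc n))) else 0)"
      unfolding B_def by (simp only:) simp
    also have "\<dots> = int (2 * n choose Suc n)"
      by (cases n) (simp_all only: nat_int, auto)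
    finally show ?thesis .
  qed
  ultimately show ?thesis by (simp add: C_def)
qed

lemma C_even_Suc: "int (n + 2) * C (2 * Suc n) = int (4 * n + 2) * C (2 * n)"
proof -
  have cat: "int (n + 1) * C (2 * n) = int (2 * n choose n)" for n
  proof -
    have "Suc n * (2 * n choose Suc n) = n * (2 * n choose n)"
    proof (cases n)
      case (Suc m)
      have "Suc n * (Suc (n + m) choose Suc n) = Suc m * (Suc (n + m) choose n)"
        by (rule Suc_times_binomial_add)
      moreover have "Suc (n + m) = 2 * n" "Suc m = n" using Suc by simp_all
      ultimately show ?thesis by (simp only:)
    qed simp
    hence "int (Suc n) * int (2 * n choose Suc n) = int n * int (2 * n choose n)"
      by (metis of_nat_mult)
    thus ?thesis unfolding C_even by (simp add: algebra_simps)
  qed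
  have central: "int (n + 1) * int (2 * Suc n choose Suc n) = int (4 * n + 2) * int (2 * n choose n)"
  proof -
    have "Suc n * (2 * Suc n choose Suc n) = 2 * (2 * n + 1) * (2 * n choose n)"
    proof -
      have "Suc n * (2 * Suc n choose Suc n) = (2 * Suc n) * (2 * n + 1 choose n)"
        using Suc_times_binomial_eq[of "2 * n + 1" n] by (simp add: mult.commute)
      moreover have "Suc n * (2 * n + 1 choose n) = (2 * n + 1) * (2 * n choose n)"
        using binomial_absorb_comp[of "2 * n + 1" n] by simp
      ultimately have "Suc n * (Suc n * (2 * Suc n choose Suc n)) = Suc n * (2 * (2 * n + 1) * (2 * n choose n))"
        by (metis (no_types, lifting) mult.assoc mult.left_commute)
      thus ?thesis by (metis mult_cancel1 nat.distinct(2))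
    qed
    thus ?thesis by (metis (no_types, opaque_lifting) Suc_eq_plus1 mult_2 mult_2_right mult.assoc numeral_Bit0 of_nat_mult add_mult_distrib2 one_add_one nat_mult_1_right)
  qed
  have "int (n + 1) * (int (n + 2) * C (2 * Suc n)) = int (n + 1) * int (2 * Suc n choose Suc n)"
    using cat[of "Suc n"] by (simp only: add_Suc add_Suc_right Suc_eq_plus1 add.assoc one_add_one)
  also have "\<dots> = int (4 * n + 2) * (int (n + 1) * C (2 * n))"
    by (simp only: central cat)
  also have "\<dots> = int (n + 1) * (int (4 * n + 2) * C (2 * n))" by (rule mult.left_commute)
  finally show ?thesis by simp
qed

text \<open>
  The recurrence of the Catalan numbers in one line for even and odd \<open>k\<close>; for \<open>k = 0\<close> both sides vanish.
\<close>

lemma C_recurrence: "int (k + 3) * C (k + 1) = int (4 * k) * C (k - 1)"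
proof (cases "even k")
  case True
  thus ?thesis by (cases k) (auto simp: C_odd)
next
  case False
  then obtain n where k: "k = 2 * n + 1" by (metis oddE)
  have e: "k + 1 = 2 * Suc n" "k - 1 = 2 * n" "int (k + 3) = 2 * int (n + 2)" "int (4 * k) = 2 * int (4 * n + 2)"
    using k by simp_all
  show ?thesis by (simp only: e mult.assoc C_even_Suc)
qed

text \<open>
  Integration against the semicircle law on \<open>[-2, 2]\<close>, whose \<open>i\<close>-th moment is \<open>C i\<close>. Working over any coefficient ring allows the
  functional to be iterated: applied to a polynomial over a polynomial ring it integrates out the outermost variable.
\<close>

definition semicircle :: "'a::comm_ring_1 poly \<Rightarrow> 'a" where
  "semicircle p = (\<Sum>i\<le>degree p. coeff p i * of_int (C i))"

lemma semicircle_altdef: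
  assumes "degree p \<le> n"
  shows "semicircle p = (\<Sum>i\<le>n. coeff p i * of_int (C i))"
  unfolding semicircle_def using assms
  by (intro sum.mono_neutral_left) (auto simp: coeff_eq_0)

lemma semicircle_add: "semicircle (p + q) = semicircle p + semicircle q"
  using semicircle_altdef[of p "max (degree p) (degree q)"] semicircle_altdef[of q "max (degree p) (degree q)"]
    semicircle_altdef[of "p + q" "max (degree p) (degree q)"] degree_add_le_max[of p q]
  by (simp add: ring_distribs sum.distrib)

lemma semicircle_smult: "semicircle (smult c p) = c * semicircle p"
  using semicircle_altdef[of "smult c p" "degree p"]
  by (simp add: semicircle_def sum_distrib_left mult.assoc degree_smult_le)

lemma semicircle_const_mult: "semicircle ([:c:] * p) = c * semicircle p"
  by (simp add: semicircle_smult)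

lemma semicircle_monom: "semicircle (monom a k) = a * of_int (C k)"
proof -
  have "semicircle (monom a k) = (\<Sum>i\<le>k. coeff (monom a k) i * of_int (C i))"
    by (rule semicircle_altdef) (simp add: degree_monom_le)
  also have "\<dots> = (\<Sum>i\<le>k. if i = k then a * of_int (C k) else 0)"
    by (intro sum.cong) auto
  finally show ?thesis by simp
qed

lemma poly_additive_induct:
  assumes "\<And>a k. Q (monom a k)" "\<And>p q. Q p \<Longrightarrow> Q q \<Longrightarrow> Q (p + q)"
  shows "Q (p :: 'a::comm_monoid_add poly)"
proof -
  have "Q (\<Sum>i\<le>n. monom (coeff p i) i)" for n
    by (induction n) (auto intro: assms)
  from this[of "degree p"] show ?thesis by (simp add: poly_as_sum_of_monoms)
qed

section \<open>Integration by parts in several variables\<close>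

definition additive_fun :: "('a::ab_group_add \<Rightarrow> 'b::ab_group_add) \<Rightarrow> bool" where
  "additive_fun f \<longleftrightarrow> (\<forall>a b. f (a + b) = f a + f b)"

definition derivation :: "('a::comm_ring_1 \<Rightarrow> 'a) \<Rightarrow> bool" where
  "derivation D \<longleftrightarrow> additive_fun D \<and> (\<forall>a b. D (a * b) = a * D b + D a * b)"

text \<open>
  The density is proportional to \<open>sqrt (4 - x\<^sup>2)\<close>, and \<open>(4 - x\<^sup>2) F' - 3 x F\<close> times that density is the derivative of
  \<open>(4 - x\<^sup>2) powr (3 / 2) * F\<close>. Here \<open>D\<close> is the partial derivative in the variable \<open>x\<close>.
\<close>

definition semicircle_ibp :: "('a::comm_ring_1 \<Rightarrow> 'b::comm_ring_1) \<Rightarrow> ('a \<Rightarrow> 'a) \<Rightarrow> 'a \<Rightarrow> bool" where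
  "semicircle_ibp \<phi> D x \<longleftrightarrow> (\<forall>F. \<phi> ((4 - x\<^sup>2) * D F - 3 * x * F) = 0)"

lemma additive_fun_0: "additive_fun f \<Longrightarrow> f 0 = 0"
  unfolding additive_fun_def by (metis add_cancel_right_left)

lemma additive_fun_minus: "additive_fun f \<Longrightarrow> f (- a) = - f a"
  using additive_fun_0[of f] unfolding additive_fun_def by (metis add.right_inverse minus_unique)

lemma additive_fun_diff: "additive_fun f \<Longrightarrow> f (a - b) = f a - f b"
  using additive_fun_minus[of f b] unfolding additive_fun_def by (metis diff_conv_add_uminus)

lemma additive_fun_of_nat:
  fixes f :: "'a::comm_ring_1 \<Rightarrow> 'b::comm_ring_1"
  assumes "additive_fun f"
  shows "f (of_nat n * a) = of_nat n * f a"
  using assms by (induction n) (simp_all add: additive_fun_0 ring_distribs additive_fun_def)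

lemma additive_fun_of_int:
  fixes f :: "'a::comm_ring_1 \<Rightarrow> 'b::comm_ring_1"
  assumes "additive_fun f"
  shows "f (a * of_int n) = f a * of_int n"
proof (cases n)
  case (nonneg k)
  thus ?thesis using additive_fun_of_nat[OF assms, of k a] by (simp add: mult.commute)
next
  case (neg k)
  have n: "(of_int n :: 'a) = - of_nat (Suc k)" "(of_int n :: 'b) = - of_nat (Suc k)"
    by (simp_all only: neg of_int_minus of_int_of_nat_eq)
  have "f (a * of_int n) = f (- (of_nat (Suc k) * a))"
    by (simp only: n mult_minus_right mult.commute)
  also have "\<dots> = - (of_nat (Suc k) * f a)"
    by (simp only: additive_fun_minus[OF assms] additive_fun_of_nat[OF assms])
  also have "\<dots> = f a * of_int n"
    by (simp only: n mult_minus_right mult.commute)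
  finally show ?thesis .
qed

lemma additive_fun_sum:
  assumes "additive_fun f"
  shows "f (sum h I) = (\<Sum>i\<in>I. f (h i))"
  using assms by (induction I rule: infinite_finite_induct) (simp_all add: additive_fun_0 additive_fun_def)

text \<open>
  On monomials this is the Catalan recurrence.
\<close>

lemma semicircle_ibp_pderiv: "semicircle_ibp semicircle pderiv [:0, 1::'a::idom:]"
  unfolding semicircle_ibp_def
proof
  fix F :: "'a poly"
  show "semicircle ((4 - [:0, 1:]\<^sup>2) * pderiv F - 3 * [:0, 1:] * F) = 0"
  proof (induction F rule: poly_additive_induct)
    case (1 a k)
    have x: "[:0, 1::'a:] = monom 1 1" by (simp add: monom_altdef)
    have num: "(4::'a poly) = monom 4 0" "(3::'a poly) = monom 3 0"
      by (simp_all add: numeral_poly monom_0)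
    have e: "(4 - [:0, 1:]\<^sup>2) * pderiv (monom a k) - 3 * [:0, 1:] * monom a k =
      monom (of_nat (4 * k) * a) (k - 1) - monom (of_nat (k + 3) * a) (k + 1)"
    proof (cases k)
      case 0
      show ?thesis unfolding x num 0 by (simp add: mult_monom pderiv_monom)
    next
      case (Suc n)
      have "(4 - [:0, 1:]\<^sup>2) * pderiv (monom a k) - 3 * [:0, 1:] * monom a k =
        monom (4 * (of_nat (Suc n) * a)) n - (monom (of_nat (Suc n) * a) (n + 2) + monom (3 * a) (n + 2))"
        unfolding x num Suc power2_eq_square pderiv_monom left_diff_distrib mult_monom by simp
      also have "\<dots> = monom (4 * (of_nat (Suc n) * a)) n - monom (of_nat (Suc n) * a + 3 * a) (n + 2)"
        by (simp only: add_monom)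
      also have "\<dots> = monom (of_nat (4 * k) * a) (k - 1) - monom (of_nat (k + 3) * a) (k + 1)"
        by (simp add: Suc algebra_simps)
      finally show ?thesis .
    qed
    have diff: "semicircle (p - q) = semicircle p - semicircle q" for p q :: "'a poly"
      by (rule additive_fun_diff) (simp add: additive_fun_def semicircle_add)
    have "semicircle ((4 - [:0, 1:]\<^sup>2) * pderiv (monom a k) - 3 * [:0, 1:] * monom a k) =
        a * (of_int (int (4 * k) * C (k - 1)) - of_int (int (k + 3) * C (k + 1)))"
      unfolding e diff semicircle_monom by (simp add: algebra_simps)
    also have "\<dots> = 0" using C_recurrence[of k] by simp
    finally show ?case .
  next
    case (2 p q)
    have "(4 - [:0, 1:]\<^sup>2) * pderiv (p + q) - 3 * [:0, 1:] * (p + q) =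
      ((4 - [:0, 1:]\<^sup>2) * pderiv p - 3 * [:0, 1:] * p) + ((4 - [:0, 1:]\<^sup>2) * pderiv q - 3 * [:0, 1:] * q)"
      by (simp only: pderiv_add ring_distribs) (simp only: diff_conv_add_uminus minus_add_distrib add_ac)
    thus ?case using 2 by (simp only: semicircle_add) simp
  qed
qed

lemma additive_semicircle: "additive_fun semicircle"
  by (simp add: additive_fun_def semicircle_add)

lemma semicircle_map_poly:
  fixes f :: "'a::comm_ring_1 \<Rightarrow> 'b::comm_ring_1"
  assumes "additive_fun f"
  shows "semicircle (map_poly f p) = f (semicircle p)"
proof -
  have "semicircle (map_poly f p) = (\<Sum>i\<le>degree p. f (coeff p i) * of_int (C i))"
    using semicircle_altdef[OF map_poly_degree_leq[of f p]] additive_fun_0[OF assms]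
    by (simp add: coeff_map_poly)
  thus ?thesis
    by (simp add: semicircle_def additive_fun_sum[OF assms] additive_fun_of_int[OF assms])
qed

text \<open>
  Integrating out a new outermost variable commutes with derivatives in the inner ones, so integration by parts in an inner
  variable survives.
\<close>

lemma semicircle_ibp_map_poly:
  assumes "semicircle_ibp \<phi> D x" "additive_fun D"
  shows "semicircle_ibp (\<lambda>F. \<phi> (semicircle F)) (map_poly D) [:x:]"
  unfolding semicircle_ibp_def
proof
  fix F
  have "(4 - [:x:]\<^sup>2) * map_poly D F - 3 * [:x:] * F = [:4 - x\<^sup>2:] * map_poly D F - [:3 * x:] * F"
    by (simp add: power2_eq_square numeral_poly mult.commute)
  hence "semicircle ((4 - [:x:]\<^sup>2) * map_poly D F - 3 * [:x:] * F) =
      (4 - x\<^sup>2) * D (semicircle F) - 3 * x * semicircle F"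
    by (simp only: additive_fun_diff[OF additive_semicircle] semicircle_const_mult semicircle_map_poly[OF assms(2)])
  thus "\<phi> (semicircle ((4 - [:x:]\<^sup>2) * map_poly D F - 3 * [:x:] * F)) = 0"
    using assms(1) by (simp add: semicircle_ibp_def)
qed

lemma derivation_pderiv: "derivation (pderiv :: 'a::idom poly \<Rightarrow> 'a poly)"
  by (simp add: derivation_def additive_fun_def pderiv_add pderiv_mult mult.commute)

lemma derivation_map_poly:
  assumes "derivation D"
  shows "derivation (map_poly D)"
proof -
  have add: "additive_fun D" and mult: "\<And>a b. D (a * b) = a * D b + D a * b"
    using assms by (auto simp: derivation_def)
  have D0: "D 0 = 0" by (rule additive_fun_0[OF add])
  have "map_poly D (p + q) = map_poly D p + map_poly D q" for p q
    using add D0 by (intro poly_eqI) (simp add: coeff_map_poly additive_fun_def)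
  moreover have "map_poly D (p * q) = p * map_poly D q + map_poly D p * q" for p q
    by (intro poly_eqI) (simp add: coeff_map_poly D0 coeff_mult additive_fun_sum[OF add] mult sum.distrib)
  ultimately show ?thesis by (simp add: derivation_def additive_fun_def)
qed

lemma derivation_power:
  assumes "derivation D"
  shows "D (a ^ n) = of_nat n * a ^ (n - 1) * D a"
proof (induction n)
  case 0
  have "D (1 * 1) = 1 * D 1 + D 1 * 1" using assms unfolding derivation_def by blast
  thus ?case by simp
next
  case (Suc n)
  have "D (a * a ^ n) = a * D (a ^ n) + D a * a ^ n" using assms unfolding derivation_def by blast
  thus ?case using Suc by (cases n) (simp_all add: algebra_simps)
qed


section \<open>The recurrences for the Weyl functional\<close>

lemma loop_scale:
  "loop1 g (\<lambda>i j k. s * f i j k) a b c = s * loop1 g f a b c"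
  "loop2 g (\<lambda>i j k. s * f i j k) a b c = s * loop2 g f a b c"
  "loop3 g (\<lambda>i j k. s * f i j k) a b c = s * loop3 g f a b c"
  unfolding loop1_def loop2_def loop3_def
  by (simp_all only: distrib_left right_diff_distrib mult.left_commute[of s])

lemma loop_additive:
  assumes "additive_fun \<phi>"
  shows "\<phi> (loop1 g f a b c) = loop1 g (\<lambda>i j k. \<phi> (f i j k)) a b c"
    "\<phi> (loop2 g f a b c) = loop2 g (\<lambda>i j k. \<phi> (f i j k)) a b c"
    "\<phi> (loop3 g f a b c) = loop3 g (\<lambda>i j k. \<phi> (f i j k)) a b c"
proof -
  have "\<phi> (x + y) = \<phi> x + \<phi> y" for x y using assms by (simp add: additive_fun_def)
  thus "\<phi> (loop1 g f a b c) = loop1 g (\<lambda>i j k. \<phi> (f i j k)) a b c"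
    "\<phi> (loop2 g f a b c) = loop2 g (\<lambda>i j k. \<phi> (f i j k)) a b c"
    "\<phi> (loop3 g f a b c) = loop3 g (\<lambda>i j k. \<phi> (f i j k)) a b c"
    unfolding loop1_def loop2_def loop3_def
    by (simp_all only: additive_fun_diff[OF assms] additive_fun_of_nat[OF assms])
qed

text \<open>
  Integration by parts of \<open>U\<^sub>i \<Delta>\<^sup>2 F\<close> in the variable \<open>x\<^sub>i\<close>, summed over \<open>i\<close>. The four hypotheses on sums collect the factors of
  \<open>F\<close> and of its derivatives with respect to \<open>p, q, r\<close>. In the first of them one factor \<open>\<Delta>\<close> has been split off,
  which keeps the identities to be checked for concrete \<open>\<Delta>\<close> of low degree.
\<close>

lemma weyl_divergence:
  fixes \<phi> :: "'r::comm_ring_1 \<Rightarrow> complex"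
  assumes \<phi>: "additive_fun \<phi>"
    and D: "\<And>i. i \<in> I \<Longrightarrow> derivation (D i)"
    and ibp: "\<And>i. i \<in> I \<Longrightarrow> semicircle_ibp \<phi> (D i) (x i)"
    and S0: "(\<Sum>i\<in>I. (4 - (x i)\<^sup>2) * (D i (U i) * \<Delta> + 2 * U i * D i \<Delta>) - 3 * x i * U i * \<Delta>) = - (\<Delta> * d)"
    and Sp: "(\<Sum>i\<in>I. (4 - (x i)\<^sup>2) * U i * D i p) = - Vp"
    and Sq: "(\<Sum>i\<in>I. (4 - (x i)\<^sup>2) * U i * D i q) = - Vq"
    and Sr: "(\<Sum>i\<in>I. (4 - (x i)\<^sup>2) * U i * D i r) = - Vr"
  defines "F \<equiv> \<lambda>i j k. p ^ i * q ^ j * r ^ k"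
  shows "\<phi> (\<Delta>\<^sup>2 * (d * F a b c + of_nat a * F (a-1) b c * Vp + of_nat b * F a (b-1) c * Vq
      + of_nat c * F a b (c-1) * Vr)) = 0"
proof -
  let ?F = "F a b c" and ?Fp = "of_nat a * F (a-1) b c" and ?Fq = "of_nat b * F a (b-1) c"
    and ?Fr = "of_nat c * F a b (c-1)"
  let ?T = "\<lambda>i. (4 - (x i)\<^sup>2) * D i (U i * (\<Delta>\<^sup>2 * ?F)) - 3 * x i * (U i * (\<Delta>\<^sup>2 * ?F))"
  have T: "?T i = \<Delta> * ?F * ((4 - (x i)\<^sup>2) * (D i (U i) * \<Delta> + 2 * U i * D i \<Delta>) - 3 * x i * U i * \<Delta>)
      + \<Delta>\<^sup>2 * (?Fp * ((4 - (x i)\<^sup>2) * U i * D i p) + ?Fq * ((4 - (x i)\<^sup>2) * U i * D i q)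
        + ?Fr * ((4 - (x i)\<^sup>2) * U i * D i r))" if "i \<in> I" for i
  proof -
    have m: "D i (y * z) = y * D i z + D i y * z" for y z using D[OF that] by (simp add: derivation_def)
    have DF: "D i ?F = ?Fp * D i p + ?Fq * D i q + ?Fr * D i r"
      unfolding F_def m derivation_power[OF D[OF that]] by (simp add: algebra_simps)
    show ?thesis
      unfolding power2_eq_square[of \<Delta>] m DF by (simp add: algebra_simps)
  qed
  have "(\<Sum>i\<in>I. ?T i) = \<Delta> * ?F * - (\<Delta> * d) + \<Delta>\<^sup>2 * (?Fp * - Vp + ?Fq * - Vq + ?Fr * - Vr)"
    unfolding S0[symmetric] Sp[symmetric] Sq[symmetric] Sr[symmetric]
    by (simp only: T cong: sum.cong) (simp only: sum_distrib_left distrib_left sum.distrib)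
  note total = this
  have e: "\<Delta>\<^sup>2 * (d * ?F + ?Fp * Vp + ?Fq * Vq + ?Fr * Vr) = - (\<Sum>i\<in>I. ?T i)"
    unfolding total by (simp add: algebra_simps power2_eq_square)
  have "\<phi> (\<Sum>i\<in>I. ?T i) = 0"
    unfolding additive_fun_sum[OF \<phi>]
    using ibp by (intro sum.neutral ballI) (simp add: semicircle_ibp_def)
  thus ?thesis unfolding e by (simp add: additive_fun_minus[OF \<phi>])
qed

lemma derivation_simps:
  assumes "derivation D"
  shows "D (a + b) = D a + D b" "D (a - b) = D a - D b" "D (a * b) = a * D b + D a * b" "D 1 = 0" "D 0 = 0"
proof -
  have add: "additive_fun D" using assms by (simp add: derivation_def)
  show "D (a + b) = D a + D b" "D (a * b) = a * D b + D a * b"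
    using assms by (auto simp: derivation_def additive_fun_def)
  show "D (a - b) = D a - D b" "D 0 = 0" by (rule additive_fun_diff[OF add], rule additive_fun_0[OF add])
  show "D 1 = 0" using derivation_power[OF assms, of 1 0] by simp
qed

text \<open>
  Formulated for any ring with three dual derivations, so that the identities are checked for ring elements
  \<open>x, y, z\<close> and never meet the nested polynomials in which they are later instantiated.
\<close>

lemma weyl_loop_moments_3:
  fixes \<phi> :: "'r::comm_ring_1 \<Rightarrow> complex" and x y z :: 'r
  assumes \<phi>: "additive_fun \<phi>"
    and D: "derivation Dx" "derivation Dy" "derivation Dz"
    and ibp: "semicircle_ibp \<phi> Dx x" "semicircle_ibp \<phi> Dy y" "semicircle_ibp \<phi> Dz z"
    and dual: "Dx x = 1" "Dx y = 0" "Dx z = 0" "Dy x = 0" "Dy y = 1" "Dy z = 0" "Dz x = 0" "Dz y = 0" "Dz z = 1"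
  defines "\<Delta> \<equiv> (x - y) * (x - z) * (y - z)"
  defines "F \<equiv> \<lambda>i j k. (x + y + z) ^ i * (x * y + x * z + y * z) ^ j * (x * y * z) ^ k"
  shows "loop_moments 3 (\<lambda>a b c. \<phi> (\<Delta>\<^sup>2 * F a b c))"
proof -
  define X where "X = (\<lambda>i::nat. if i = 0 then x else if i = 1 then y else z)"
  define D' where "D' = (\<lambda>i::nat. if i = 0 then Dx else if i = 1 then Dy else Dz)"
  note ds = derivation_simps[OF D(1)] derivation_simps[OF D(2)] derivation_simps[OF D(3)] dual
  have sum3: "(\<Sum>i\<in>{0,1,2::nat}. f i) = f 0 + f 1 + f 2" for f :: "nat \<Rightarrow> 'r" by simp
  have XD: "X 0 = x" "X 1 = y" "X 2 = z" "D' 0 = Dx" "D' 1 = Dy" "D' 2 = Dz"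
    by (simp_all add: X_def D'_def)
  have D': "\<And>i. i \<in> {0,1,2} \<Longrightarrow> derivation (D' i)"
    and ibp': "\<And>i. i \<in> {0,1,2} \<Longrightarrow> semicircle_ibp \<phi> (D' i) (X i)"
    using D ibp by (auto simp: X_def D'_def)
  have div1: "\<phi> (\<Delta>\<^sup>2 * loop1 3 F a b c) = 0" for a b c
    unfolding F_def loop1_monomial
    by (rule weyl_divergence[OF \<phi> D' ibp', where I = "{0,1,2}" and U = "\<lambda>_. 1"])
      (assumption+, simp_all only: sum3 XD \<Delta>_def ds, simp_all add: algebra_simps power2_eq_square)
  have div2: "\<phi> (\<Delta>\<^sup>2 * loop2 3 F a b c) = 0" for a b c
    unfolding F_def loop2_monomial
    by (rule weyl_divergence[OF \<phi> D' ibp', where I = "{0,1,2}" and U = "X"])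
      (assumption+, simp_all only: sum3 XD \<Delta>_def ds, simp_all add: algebra_simps power2_eq_square power3_eq_cube)
  have div3: "\<phi> (\<Delta>\<^sup>2 * loop3 3 F a b c) = 0" for a b c
    unfolding F_def loop3_monomial
    by (rule weyl_divergence[OF \<phi> D' ibp', where I = "{0,1,2}" and U = "\<lambda>i. X i * X i - 1"])
      (assumption+, simp_all only: sum3 XD \<Delta>_def ds, simp_all add: algebra_simps power2_eq_square power3_eq_cube power4_eq_xxxx)
  show ?thesis
    unfolding loop_moments_def using div1 div2 div3
    by (simp only: loop_additive[OF \<phi>, symmetric] loop_scale)
      simp
qed

lemma weyl_loop_moments_2:
  fixes \<phi> :: "'r::comm_ring_1 \<Rightarrow> complex" and x y :: 'r
  assumes \<phi>: "additive_fun \<phi>"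
    and D: "derivation Dx" "derivation Dy"
    and ibp: "semicircle_ibp \<phi> Dx x" "semicircle_ibp \<phi> Dy y"
    and dual: "Dx x = 1" "Dx y = 0" "Dy x = 0" "Dy y = 1"
  defines "\<Delta> \<equiv> x - y"
  defines "F \<equiv> \<lambda>i j k. (x + y) ^ i * (x * y) ^ j * 0 ^ k"
  shows "loop_moments 2 (\<lambda>a b c. \<phi> (\<Delta>\<^sup>2 * F a b c))"
proof -
  define X where "X = (\<lambda>i::nat. if i = 0 then x else y)"
  define D' where "D' = (\<lambda>i::nat. if i = 0 then Dx else Dy)"
  note ds = derivation_simps[OF D(1)] derivation_simps[OF D(2)] dual
  have sum2: "(\<Sum>i\<in>{0,1::nat}. f i) = f 0 + f 1" for f :: "nat \<Rightarrow> 'r" by simp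
  have XD: "X 0 = x" "X 1 = y" "D' 0 = Dx" "D' 1 = Dy"
    by (simp_all add: X_def D'_def)
  have D': "\<And>i. i \<in> {0,1} \<Longrightarrow> derivation (D' i)"
    and ibp': "\<And>i. i \<in> {0,1} \<Longrightarrow> semicircle_ibp \<phi> (D' i) (X i)"
    using D ibp by (auto simp: X_def D'_def)
  have div1: "\<phi> (\<Delta>\<^sup>2 * loop1 2 F a b c) = 0" for a b c
    unfolding F_def loop1_monomial
    by (rule weyl_divergence[OF \<phi> D' ibp', where I = "{0,1}" and U = "\<lambda>_. 1"])
      (assumption+, simp_all only: sum2 XD \<Delta>_def ds, simp_all add: algebra_simps power2_eq_square)
  have div2: "\<phi> (\<Delta>\<^sup>2 * loop2 2 F a b c) = 0" for a b c
    unfolding F_def loop2_monomial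
    by (rule weyl_divergence[OF \<phi> D' ibp', where I = "{0,1}" and U = "X"])
      (assumption+, simp_all only: sum2 XD \<Delta>_def ds, simp_all add: algebra_simps power2_eq_square power3_eq_cube)
  have div3: "\<phi> (\<Delta>\<^sup>2 * loop3 2 F a b c) = 0" for a b c
    unfolding F_def loop3_monomial
    by (rule weyl_divergence[OF \<phi> D' ibp', where I = "{0,1}" and U = "\<lambda>i. X i * X i - 1"])
      (assumption+, simp_all only: sum2 XD \<Delta>_def ds, simp_all add: algebra_simps power2_eq_square power3_eq_cube power4_eq_xxxx)
  show ?thesis
    unfolding loop_moments_def using div1 div2 div3
    by (simp only: loop_additive[OF \<phi>, symmetric] loop_scale)
      simp
qed

section \<open>Two and three independent semicircle variables\<close>

text \<open>
  Joint moments of two and three independent semicircle variables. A polynomial in several variables is a nested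
  univariate polynomial, and its partial derivatives are \<open>pderiv\<close> mapped over the outer levels.
\<close>

definition semicircle2 :: "complex poly poly \<Rightarrow> complex" where
  "semicircle2 F = semicircle (semicircle F)"

definition semicircle3 :: "complex poly poly poly \<Rightarrow> complex" where
  "semicircle3 F = semicircle (semicircle (semicircle F))"

lemma additive_semicircle2: "additive_fun semicircle2"
  by (simp add: semicircle2_def additive_fun_def semicircle_add)

lemma additive_semicircle3: "additive_fun semicircle3"
  by (simp add: semicircle3_def additive_fun_def semicircle_add)

lemma semicircle_ibp_comp:
  assumes "semicircle_ibp f D x" "h 0 = 0"
  shows "semicircle_ibp (\<lambda>F. h (f F)) D x"
  using assms by (simp add: semicircle_ibp_def)

lemma semicircle_0 [simp]: "semicircle 0 = 0"
  by (simp add: semicircle_def)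

lemma const_poly_power: "[:a:] ^ n = [:a ^ n:]"
  by (induction n) (auto simp: one_pCons mult.commute)

lemma semicircle_const_mult_X: "semicircle ([:a:] * [:0, 1:] ^ k) = a * of_int (C k)"
proof -
  have "[:a:] * [:0, 1:] ^ k = monom a k" by (simp add: monom_altdef)
  thus ?thesis by (simp add: semicircle_monom)
qed

lemma semicircle3_monomial: "semicircle3 ([:[:[:0, 1:]:]:] ^ i * [:[:0, 1:]:] ^ j * [:0, 1:] ^ k) = of_int (C i * C j * C k)"
proof -
  have 1: "[:[:[:0, 1::complex:]:]:] ^ i * [:[:0, 1:]:] ^ j = [:[:[:0, 1:] ^ i:] * [:0, 1:] ^ j:]"
    by (simp add: const_poly_power)
  have "semicircle ([:0, 1:] ^ i :: complex poly) = of_int (C i)"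
    using semicircle_const_mult_X[of "1::complex" i] by simp
  thus ?thesis
    unfolding semicircle3_def 1 by (simp only: semicircle_const_mult_X additive_fun_of_int[OF additive_semicircle] of_int_mult)
qed

lemma semicircle2_monomial: "semicircle2 ([:[:0, 1:]:] ^ i * [:0, 1:] ^ j) = of_int (C i * C j)"
proof -
  have "semicircle ([:0, 1:] ^ i :: complex poly) = of_int (C i)"
    using semicircle_const_mult_X[of "1::complex" i] by simp
  thus ?thesis
    unfolding semicircle2_def const_poly_power
    by (simp only: semicircle_const_mult_X additive_fun_of_int[OF additive_semicircle] of_int_mult)
qed

abbreviation "v3x \<equiv> ([:[:[:0, 1:]:]:] :: complex poly poly poly)"
abbreviation "v3y \<equiv> ([:[:0, 1:]:] :: complex poly poly poly)"
abbreviation "v3z \<equiv> ([:0, 1:] :: complex poly poly poly)"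
abbreviation "v2x \<equiv> ([:[:0, 1:]:] :: complex poly poly)"
abbreviation "v2y \<equiv> ([:0, 1:] :: complex poly poly)"

lemma semicircle3_loop_moments:
  "loop_moments 3 (\<lambda>a b c. semicircle3 (((v3x - v3y) * (v3x - v3z) * (v3y - v3z))\<^sup>2 *
     ((v3x + v3y + v3z) ^ a * (v3x * v3y + v3x * v3z + v3y * v3z) ^ b * (v3x * v3y * v3z) ^ c)))"
proof (rule weyl_loop_moments_3[OF additive_semicircle3])
  have p: "additive_fun (pderiv :: complex poly \<Rightarrow> complex poly)"
    "additive_fun (pderiv :: complex poly poly \<Rightarrow> complex poly poly)"
    using derivation_pderiv by (auto simp: derivation_def)
  show "derivation (map_poly (map_poly pderiv) :: complex poly poly poly \<Rightarrow> _)"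
    "derivation (map_poly pderiv :: complex poly poly poly \<Rightarrow> _)"
    "derivation (pderiv :: complex poly poly poly \<Rightarrow> _)"
    by (intro derivation_map_poly derivation_pderiv)+
  have m: "additive_fun (map_poly pderiv :: complex poly poly \<Rightarrow> _)"
    using derivation_map_poly[OF derivation_pderiv] by (auto simp: derivation_def)
  show "semicircle_ibp semicircle3 pderiv v3z"
    unfolding semicircle3_def by (rule semicircle_ibp_comp[OF semicircle_ibp_pderiv, where h = "\<lambda>F. semicircle (semicircle F)"]) simp
  show "semicircle_ibp semicircle3 (map_poly pderiv) v3y"
    unfolding semicircle3_def
    by (rule semicircle_ibp_map_poly[OF semicircle_ibp_comp[OF semicircle_ibp_pderiv, where h = semicircle] p(2)]) simp
  show "semicircle_ibp semicircle3 (map_poly (map_poly pderiv)) v3x"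
    unfolding semicircle3_def
    by (rule semicircle_ibp_map_poly[OF semicircle_ibp_map_poly[OF semicircle_ibp_pderiv p(1)] m])
qed (simp_all add: map_poly_pCons pderiv_pCons pCons_one derivation_simps(4)[OF derivation_map_poly[OF derivation_pderiv]]
    derivation_simps(4)[OF derivation_map_poly[OF derivation_map_poly[OF derivation_pderiv]]])

lemma semicircle2_loop_moments:
  "loop_moments 2 (\<lambda>a b c. semicircle2 ((v2x - v2y)\<^sup>2 * ((v2x + v2y) ^ a * (v2x * v2y) ^ b * 0 ^ c)))"
proof (rule weyl_loop_moments_2[OF additive_semicircle2])
  have p: "additive_fun (pderiv :: complex poly \<Rightarrow> complex poly)"
    using derivation_pderiv by (auto simp: derivation_def)
  show "derivation (map_poly pderiv :: complex poly poly \<Rightarrow> _)"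
    "derivation (pderiv :: complex poly poly \<Rightarrow> _)"
    by (intro derivation_map_poly derivation_pderiv)+
  show "semicircle_ibp semicircle2 pderiv v2y"
    unfolding semicircle2_def by (rule semicircle_ibp_comp[OF semicircle_ibp_pderiv, where h = semicircle]) simp
  show "semicircle_ibp semicircle2 (map_poly pderiv) v2x"
    unfolding semicircle2_def by (rule semicircle_ibp_map_poly[OF semicircle_ibp_pderiv p])
qed (simp_all add: map_poly_pCons pderiv_pCons pCons_one derivation_simps(4)[OF derivation_map_poly[OF derivation_pderiv]])

section \<open>Multinomial expansions\<close>

text \<open>
  Splits off the first part of a composition of \<open>n\<close>; iterating the binomial theorem along this splitting gives the
  multinomial theorem in the tuple form that is needed.
\<close>

lemma sum_compositions:
  fixes s :: "'t \<Rightarrow> nat"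
  assumes "\<And>m. finite {t. s t = m}"
  shows "finite {(i, t). i + s t = n}"
    "(\<Sum>(i, t)\<in>{(i, t). i + s t = n}. h i t) = (\<Sum>i\<le>n. \<Sum>t\<in>{t. s t = n - i}. h i t)"
proof -
  have e: "{(i, t). i + s t = n} = Sigma {..n} (\<lambda>i. {t. s t = n - i})" by auto
  show "finite {(i, t). i + s t = n}" unfolding e using assms by auto
  show "(\<Sum>(i, t)\<in>{(i, t). i + s t = n}. h i t) = (\<Sum>i\<le>n. \<Sum>t\<in>{t. s t = n - i}. h i t)"
    unfolding e using assms by (subst sum.Sigma) auto
qed

lemma multinomial_Cons:
  assumes "i \<le> n" "prod_list (map fact ks) dvd (fact (n - i) :: nat)"
  shows "multinomial n (i # ks) = (n choose i) * multinomial (n - i) ks"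
    "prod_list (map fact (i # ks)) dvd (fact n :: nat)"
proof -
  obtain q where q: "(fact (n - i) :: nat) = prod_list (map fact ks) * q" using assms(2) unfolding dvd_def by blast
  have pos: "prod_list (map fact ks) > (0::nat)" by (induction ks) simp_all
  have f: "(fact n :: nat) = (fact i * prod_list (map fact ks)) * ((n choose i) * q)"
    using binomial_fact_lemma[OF assms(1)] unfolding q by (simp add: mult_ac)
  show "prod_list (map fact (i # ks)) dvd (fact n :: nat)" unfolding f by simp
  have "multinomial n (i # ks) = (n choose i) * q"
    unfolding multinomial_def f using pos by simp
  moreover have "multinomial (n - i) ks = q"
    unfolding multinomial_def q using pos by simp
  ultimately show "multinomial n (i # ks) = (n choose i) * multinomial (n - i) ks" by simp
qed

lemma multinomial_1: "multinomial n [n] = 1" "prod_list (map fact [n]) dvd (fact n :: nat)"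
  by (simp_all add: multinomial_def)

lemma multinomial_2:
  assumes "i + j = n"
  shows "multinomial n [i, j] = n choose i" "prod_list (map fact [i, j]) dvd (fact n :: nat)"
  using multinomial_Cons[of i n "[j]"] multinomial_1[of j] assms by auto

lemma multinomial_3:
  assumes "i + j + k = n"
  shows "multinomial n [i, j, k] = (n choose i) * multinomial (n - i) [j, k]"
    "prod_list (map fact [i, j, k]) dvd (fact n :: nat)"
  using multinomial_Cons[of i n "[j, k]"] multinomial_2[of j k "n - i"] assms by auto

lemma multinomial_4:
  assumes "i + j + k + l = n"
  shows "multinomial n [i, j, k, l] = (n choose i) * multinomial (n - i) [j, k, l]"
  using multinomial_Cons[of i n "[j, k, l]"] multinomial_3[of j k l "n - i"] assms by auto

lemma finite_compositions_2: "finite {(j, k). j + k = (m::nat)}"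
proof -
  have "finite {k::nat. k = m}" for m by simp
  from sum_compositions(1)[of "\<lambda>k. k", OF this] show ?thesis .
qed

lemma binomial_pairs:
  fixes a b :: "'a::comm_ring_1"
  shows "(a + b) ^ n = (\<Sum>(j, k)\<in>{(j, k). j + k = n}. of_nat (multinomial n [j, k]) * (a ^ j * b ^ k))"
proof -
  have "(\<Sum>(j, k)\<in>{(j, k). j + k = n}. of_nat (multinomial n [j, k]) * (a ^ j * b ^ k)) =
    (\<Sum>j\<le>n. \<Sum>k\<in>{k. k = n - j}. of_nat (multinomial n [j, k]) * (a ^ j * b ^ k))"
    by (rule sum_compositions(2)) simp
  also have "\<dots> = (\<Sum>j\<le>n. of_nat (n choose j) * a ^ j * b ^ (n - j))"
    by (intro sum.cong refl) (simp add: multinomial_2 mult.assoc)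
  finally show ?thesis by (simp add: binomial_ring)
qed

lemma finite_compositions_3: "finite {(i, j, k). i + j + k = (m::nat)}"
proof -
  have "finite {t. (\<lambda>(j, k). j + k) t = (m::nat)}" for m
    using finite_compositions_2[of m] by (simp add: case_prod_unfold)
  from sum_compositions(1)[where s = "\<lambda>(j, k). j + k" and n = m, OF this] show ?thesis
    by (rule rev_finite_subset) auto
qed

lemma trinomial:
  fixes a b c :: "'a::comm_ring_1"
  shows "(a + b + c) ^ n = (\<Sum>(i, j, k)\<in>{(i, j, k). i + j + k = n}.
    of_nat (multinomial n [i, j, k]) * (a ^ i * b ^ j * c ^ k))"
proof -
  have fin: "finite {t. (\<lambda>(j, k). j + k) t = (m::nat)}" for m
    using finite_compositions_2[of m] by (simp add: case_prod_unfold)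
  have "{(i, j, k). i + j + k = n} = {(i, t). i + (\<lambda>(j, k). j + k) t = n}" by auto
  hence "(\<Sum>(i, j, k)\<in>{(i, j, k). i + j + k = n}. of_nat (multinomial n [i, j, k]) * (a ^ i * b ^ j * c ^ k)) =
    (\<Sum>(i, t)\<in>{(i, t). i + (\<lambda>(j, k). j + k) t = n}. (\<lambda>i (j, k). of_nat (multinomial n [i, j, k]) * (a ^ i * b ^ j * c ^ k)) i t)"
    by (simp add: case_prod_unfold)
  also have "\<dots> = (\<Sum>i\<le>n. \<Sum>t\<in>{t. (\<lambda>(j, k). j + k) t = n - i}.
      (\<lambda>i (j, k). of_nat (multinomial n [i, j, k]) * (a ^ i * b ^ j * c ^ k)) i t)"
    by (rule sum_compositions(2)[OF fin])
  also have "\<dots> = (\<Sum>i\<le>n. of_nat (n choose i) * a ^ i * (\<Sum>(j, k)\<in>{(j, k). j + k = n - i}.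
      of_nat (multinomial (n - i) [j, k]) * (b ^ j * c ^ k)))"
    by (intro sum.cong refl) (auto simp: sum_distrib_left multinomial_3 case_prod_unfold mult_ac intro!: sum.cong)
  also have "\<dots> = (a + (b + c)) ^ n"
    by (simp only: binomial_pairs[symmetric] binomial_ring)
  finally show ?thesis by (simp add: add.assoc)
qed

lemma finite_compositions_4: "finite {(i, j, k, l). i + j + k + l = (m::nat)}"
proof -
  have "finite {t. (\<lambda>(j, k, l). j + k + l) t = (m::nat)}" for m
    using finite_compositions_3[of m] by (simp add: case_prod_unfold)
  from sum_compositions(1)[where s = "\<lambda>(j, k, l). j + k + l" and n = m, OF this] show ?thesis
    by (rule rev_finite_subset) auto
qed

lemma quadrinomial:
  fixes a b c d :: "'a::comm_ring_1"
  shows "(a + b + c + d) ^ n = (\<Sum>(i, j, k, l)\<in>{(i, j, k, l). i + j + k + l = n}.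
    of_nat (multinomial n [i, j, k, l]) * (a ^ i * b ^ j * c ^ k * d ^ l))"
proof -
  have fin: "finite {t. (\<lambda>(j, k, l). j + k + l) t = (m::nat)}" for m
    using finite_compositions_3[of m] by (simp add: case_prod_unfold)
  have "{(i, j, k, l). i + j + k + l = n} = {(i, t). i + (\<lambda>(j, k, l). j + k + l) t = n}" by auto
  hence "(\<Sum>(i, j, k, l)\<in>{(i, j, k, l). i + j + k + l = n}. of_nat (multinomial n [i, j, k, l]) * (a ^ i * b ^ j * c ^ k * d ^ l)) =
    (\<Sum>(i, t)\<in>{(i, t). i + (\<lambda>(j, k, l). j + k + l) t = n}. (\<lambda>i (j, k, l). of_nat (multinomial n [i, j, k, l]) * (a ^ i * b ^ j * c ^ k * d ^ l)) i t)"
    by (simp add: case_prod_unfold)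
  also have "\<dots> = (\<Sum>i\<le>n. \<Sum>t\<in>{t. (\<lambda>(j, k, l). j + k + l) t = n - i}.
      (\<lambda>i (j, k, l). of_nat (multinomial n [i, j, k, l]) * (a ^ i * b ^ j * c ^ k * d ^ l)) i t)"
    by (rule sum_compositions(2)[OF fin])
  also have "\<dots> = (\<Sum>i\<le>n. of_nat (n choose i) * a ^ i * (\<Sum>(j, k, l)\<in>{(j, k, l). j + k + l = n - i}.
      of_nat (multinomial (n - i) [j, k, l]) * (b ^ j * c ^ k * d ^ l)))"
    by (intro sum.cong refl) (auto simp: sum_distrib_left multinomial_4 case_prod_unfold mult_ac intro!: sum.cong)
  also have "\<dots> = (a + (b + c + d)) ^ n"
    by (simp only: trinomial[symmetric] binomial_ring)
  finally show ?thesis by (simp add: add.assoc)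
qed


section \<open>Class functions on the symplectic groups\<close>

text \<open>
  The elementary symmetric polynomials of the eigenvalue parameters, expressed by Newton's identities through traces of powers so
  that they are polynomials on the whole matrix space. The power sums of the \<open>x\<^sub>j\<close> are \<open>tr X\<close>, \<open>tr X\<^sup>2 + 2 g\<close> and
  \<open>tr X\<^sup>3 + 3 tr X\<close>.
\<close>

definition elem1 :: "complex^'n^'n \<Rightarrow> complex" where
  "elem1 X = trace (mpow X 1)"

definition elem2 :: "nat \<Rightarrow> complex^'n^'n \<Rightarrow> complex" where
  "elem2 g X = ((trace (mpow X 1))\<^sup>2 - trace (mpow X 2) - 2 * of_nat g) / 2"

definition elem3 :: "nat \<Rightarrow> complex^'n^'n \<Rightarrow> complex" where
  "elem3 g X = ((trace (mpow X 1))^3 - 3 * trace (mpow X 1) * (trace (mpow X 2) + 2 * of_nat g)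
     + 2 * trace (mpow X 3) + 6 * trace (mpow X 1)) / 6"

definition delem1 :: "complex^'n^'n \<Rightarrow> complex^'n^'n \<Rightarrow> complex" where
  "delem1 X V = trace (mpow_deriv X 1 V)"

definition delem2 :: "complex^'n^'n \<Rightarrow> complex^'n^'n \<Rightarrow> complex" where
  "delem2 X V = (2 * trace (mpow X 1) * trace (mpow_deriv X 1 V) - trace (mpow_deriv X 2 V)) / 2"

definition delem3 :: "nat \<Rightarrow> complex^'n^'n \<Rightarrow> complex^'n^'n \<Rightarrow> complex" where
  "delem3 g X V = (3 * (trace (mpow X 1))\<^sup>2 * trace (mpow_deriv X 1 V)
     - 3 * trace (mpow_deriv X 1 V) * (trace (mpow X 2) + 2 * of_nat g) - 3 * trace (mpow X 1) * trace (mpow_deriv X 2 V)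
     + 2 * trace (mpow_deriv X 3 V) + 6 * trace (mpow_deriv X 1 V)) / 6"

lemma C1_complex_elem1: "C1_complex elem1 delem1"
  unfolding elem1_def[abs_def] delem1_def[abs_def] by (rule C1_complex_trace_mpow)

lemma C1_complex_elem2: "C1_complex (elem2 g) delem2"
  using C1_complex_trace_mpow[of 1, unfolded C1_complex_def] C1_complex_trace_mpow[of 2, unfolded C1_complex_def]
    C1_complex_continuous[OF C1_complex_trace_mpow[of 1]] C1_complex_continuous[OF C1_complex_trace_mpow[of 2]]
  unfolding C1_complex_def elem2_def[abs_def] delem2_def[abs_def]
  by (auto intro!: derivative_eq_intros continuous_intros simp del: mpow.simps mpow_deriv.simps One_nat_def
      simp: algebra_simps diff_divide_distrib)

lemma C1_complex_elem3: "C1_complex (elem3 g) (delem3 g)"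
  using C1_complex_trace_mpow[of 1, unfolded C1_complex_def] C1_complex_trace_mpow[of 2, unfolded C1_complex_def]
    C1_complex_trace_mpow[of 3, unfolded C1_complex_def]
    C1_complex_continuous[OF C1_complex_trace_mpow[of 1]] C1_complex_continuous[OF C1_complex_trace_mpow[of 2]]
    C1_complex_continuous[OF C1_complex_trace_mpow[of 3]]
  unfolding C1_complex_def elem3_def[abs_def] delem3_def[abs_def]
  by (auto intro!: derivative_eq_intros continuous_intros simp del: mpow.simps mpow_deriv.simps One_nat_def
      simp: algebra_simps add_divide_distrib diff_divide_distrib)

lemma C1_complex_monomial:
  "C1_complex (\<lambda>X. elem1 X ^ a * elem2 g X ^ b * elem3 g X ^ c)
    (\<lambda>X V. of_nat a * (elem1 X ^ (a-1) * elem2 g X ^ b * elem3 g X ^ c) * delem1 X V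
      + of_nat b * (elem1 X ^ a * elem2 g X ^ (b-1) * elem3 g X ^ c) * delem2 X V
      + of_nat c * (elem1 X ^ a * elem2 g X ^ b * elem3 g X ^ (c-1)) * delem3 g X V)"
  using C1_complex_mult[OF C1_complex_mult[OF C1_complex_power[OF C1_complex_elem1, of a] C1_complex_power[OF C1_complex_elem2, of g b]]
      C1_complex_power[OF C1_complex_elem3, of g c]]
  by (simp add: algebra_simps)

lemma sympl_mpow_mult:
  assumes "X \<in> USp"
  shows "mpow (sympl_adjoint X) l ** mpow X k =
    (if l \<le> k then mpow X (k - l) else mpow (sympl_adjoint X) (l - k))"
proof (induction k arbitrary: l)
  case (Suc k)
  show ?case
  proof (cases l)
    case (Suc l')
    have "mpow (sympl_adjoint X) l ** mpow X (Suc k) =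
        mpow (sympl_adjoint X) l' ** (sympl_adjoint X ** X) ** mpow X k"
      unfolding Suc mpow_Suc_right[of "sympl_adjoint X"] by (simp add: matrix_mul_assoc)
    thus ?thesis using Suc.IH[of l'] USp_sympl_adjoint[OF assms] by (simp add: Suc)
  qed simp
qed simp

lemma trace_sympl_mpow_mult:
  assumes "X \<in> USp"
  shows "trace (mpow (sympl_adjoint X) l ** mpow X k) =
    trace (mpow X (if l \<le> k then k - l else l - k))"
  using sympl_mpow_mult[OF assms, of l k]
  by (auto simp: sympl_adjoint_mpow[symmetric] trace_sympl_adjoint)

text \<open>
  All terms of the product rule have the same trace because the direction commutes with \<open>X\<close>.
\<close>

lemma trace_mpow_deriv:
  assumes "X \<in> USp"
  shows "trace (mpow_deriv X m ((mpow X k - mpow (sympl_adjoint X) k) ** X)) =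
    of_nat m * (trace (mpow X (m + k)) - trace (mpow X (if k \<le> m then m - k else k - m)))"
proof -
  let ?V = "mpow X k - mpow (sympl_adjoint X) k"
  have "trace (mpow X l ** (?V ** X) ** mpow X (m - Suc l)) =
      trace (mpow X (m + k)) - trace (mpow X (if k \<le> m then m - k else k - m))" if "l < m" for l
  proof -
    have "trace (mpow X l ** (?V ** X) ** mpow X (m - Suc l)) = trace (?V ** (X ** mpow X (m - Suc l) ** mpow X l))"
      by (subst trace_mul_sym) (metis matrix_mul_assoc trace_mul_sym)
    also have "X ** mpow X (m - Suc l) ** mpow X l = mpow X m"
      using that mpow_add[of X "Suc (m - Suc l)" l] by simp
    also have "trace (?V ** mpow X m) = trace (mpow X (k + m)) - trace (mpow (sympl_adjoint X) k ** mpow X m)"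
      by (simp only: matrix_sub_rdistrib trace_sub mpow_add)
    finally show ?thesis by (simp only: trace_sympl_mpow_mult[OF assms] add.commute)
  qed
  moreover have "trace (mpow_deriv X m (?V ** X)) = (\<Sum>l<m. trace (mpow X l ** (?V ** X) ** mpow X (m - Suc l)))"
    unfolding mpow_deriv_eq trace_def by (simp add: sum.swap[of _ UNIV])
  ultimately show ?thesis by simp
qed

text \<open>
  Traces of powers as power sums of at most three eigenvalue parameters. For \<open>g = 2\<close> the third parameter is zero; the occurrences
  of \<open>g\<close>, coming from the constant terms of the Chebyshev polynomials, account for the true number of parameters.
  Powers up to six occur, because the third vector field is applied to \<open>tr X\<^sup>3\<close>.
\<close>

definition spectral_data :: "nat \<Rightarrow> complex^'n^'n \<Rightarrow> complex \<Rightarrow> complex \<Rightarrow> complex \<Rightarrow> bool" where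
  "spectral_data g X x y z \<longleftrightarrow>
     trace (mpow X 0) = 2 * of_nat g \<and>
     trace (mpow X 1) = x + y + z \<and>
     trace (mpow X 2) = x^2 + y^2 + z^2 - 2 * of_nat g \<and>
     trace (mpow X 3) = x^3 + y^3 + z^3 - 3 * (x + y + z) \<and>
     trace (mpow X 4) = x^4 + y^4 + z^4 - 4 * (x^2 + y^2 + z^2) + 2 * of_nat g \<and>
     trace (mpow X 5) = x^5 + y^5 + z^5 - 5 * (x^3 + y^3 + z^3) + 5 * (x + y + z) \<and>
     trace (mpow X 6) = x^6 + y^6 + z^6 - 6 * (x^4 + y^4 + z^4) + 9 * (x^2 + y^2 + z^2) - 2 * of_nat g"

lemma two_cos_multiple_values:
  "two_cos_multiple 1 x = x"
  "two_cos_multiple 2 x = x^2 - 2"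
  "two_cos_multiple 3 x = x^3 - 3 * x"
  "two_cos_multiple 4 x = x^4 - 4 * x^2 + 2"
  "two_cos_multiple 5 x = x^5 - 5 * x^3 + 5 * x"
  "two_cos_multiple 6 x = x^6 - 6 * x^4 + 9 * x^2 - 2"
  for x :: complex
  by (simp_all add: eval_nat_numeral algebra_simps)

lemma USp_spectral_data_2:
  assumes "X \<in> (USp :: (complex^(2 + 2)^(2 + 2)) set)"
  obtains x y where "spectral_data 2 X x y 0" "coeff (char_polynomial X) 2 = x * y + 2"
proof -
  obtain xs where xs: "length xs = CARD(2)" "char_polynomial X = (\<Prod>x\<leftarrow>xs. [:1, - x, 1:])"
    "\<And>k. trace (mpow X k) = (\<Sum>x\<leftarrow>xs. two_cos_multiple k x)"
    using USp_eigenvalues[OF assms] by blast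
  then obtain x y where "xs = [x, y]" by (auto simp: length_Suc_conv numeral_2_eq_2)
  hence "spectral_data 2 X x y 0" "coeff (char_polynomial X) 2 = x * y + 2"
    unfolding spectral_data_def xs(2,3)
    by (simp_all only: list.map sum_list.Cons sum_list.Nil prod_list.Cons prod_list.Nil two_cos_multiple_values)
      (simp_all add: numeral_2_eq_2)
  thus ?thesis using that by blast
qed

lemma USp_spectral_data_3:
  assumes "X \<in> (USp :: (complex^(3 + 3)^(3 + 3)) set)"
  obtains x y z where "spectral_data 3 X x y z" "coeff (char_polynomial X) 2 = x * y + x * z + y * z + 3"
    "coeff (char_polynomial X) 3 = - (x * y * z + 2 * (x + y + z))"
proof -
  obtain xs where xs: "length xs = CARD(3)" "char_polynomial X = (\<Prod>x\<leftarrow>xs. [:1, - x, 1:])"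
    "\<And>k. trace (mpow X k) = (\<Sum>x\<leftarrow>xs. two_cos_multiple k x)"
    using USp_eigenvalues[OF assms] by blast
  then obtain x y z where "xs = [x, y, z]" by (auto simp: length_Suc_conv numeral_3_eq_3)
  hence "spectral_data 3 X x y z" "coeff (char_polynomial X) 2 = x * y + x * z + y * z + 3"
    "coeff (char_polynomial X) 3 = - (x * y * z + 2 * (x + y + z))"
    unfolding spectral_data_def xs(2,3)
    by (simp_all only: list.map sum_list.Cons sum_list.Nil prod_list.Cons prod_list.Nil two_cos_multiple_values)
      (simp_all add: numeral_2_eq_2 numeral_3_eq_3 algebra_simps)
  thus ?thesis using that by blast
qed

lemma spectral_data_traces:
  assumes "spectral_data g X x y z"
  shows "trace (mpow X 0) = 2 * of_nat g"
    "trace (mpow X 1) = x + y + z"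
    "trace (mpow X 2) = x^2 + y^2 + z^2 - 2 * of_nat g"
    "trace (mpow X 3) = x^3 + y^3 + z^3 - 3 * (x + y + z)"
    "trace (mpow X 4) = x^4 + y^4 + z^4 - 4 * (x^2 + y^2 + z^2) + 2 * of_nat g"
    "trace (mpow X 5) = x^5 + y^5 + z^5 - 5 * (x^3 + y^3 + z^3) + 5 * (x + y + z)"
    "trace (mpow X 6) = x^6 + y^6 + z^6 - 6 * (x^4 + y^4 + z^4) + 9 * (x^2 + y^2 + z^2) - 2 * of_nat g"
  using assms unfolding spectral_data_def by blast+

lemma spectral_data_elem:
  assumes "spectral_data g X x y z"
  shows "elem1 X = x + y + z" "elem2 g X = x * y + x * z + y * z" "elem3 g X = x * y * z"
proof -
  have P: "trace (mpow X 1) = x + y + z" "trace (mpow X 2) = x^2 + y^2 + z^2 - 2 * of_nat g"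
    "trace (mpow X 3) = x^3 + y^3 + z^3 - 3 * (x + y + z)"
    using assms unfolding spectral_data_def by blast+
  show "elem1 X = x + y + z" "elem2 g X = x * y + x * z + y * z" "elem3 g X = x * y * z"
    unfolding elem1_def elem2_def elem3_def P
    by (simp_all add: field_simps power2_eq_square power3_eq_cube)
qed

text \<open>
  The three lemmas on integrands compute the divergence of the field with index \<open>k\<close> and its action on \<open>e\<^sub>1, e\<^sub>2, e\<^sub>3\<close>; all become
  polynomial identities in the eigenvalue parameters.
\<close>

lemma loop_integrand_1:
  assumes X: "X \<in> USp" and s: "spectral_data g X x y z" and g: "g \<ge> 2"
  defines "V \<equiv> (mpow X 1 - mpow (sympl_adjoint X) 1) ** X"
  shows "(\<Sum>l<1. trace (mpow X l) * trace (mpow X (1 - l)) + trace (mpow (sympl_adjoint X) l ** mpow X (1 - l)))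
      = of_nat (2 * g + 1) * elem1 X"
    "delem1 X V = (elem1 X)\<^sup>2 - 2 * elem2 g X - of_nat (4 * g)"
    "delem2 X V = elem1 X * elem2 g X - 3 * elem3 g X - of_nat (4 * (g - 1)) * elem1 X"
    "delem3 g X V = elem1 X * elem3 g X - of_nat (4 * (g - 2)) * elem2 g X"
proof -
  obtain h where h: "g = h + 2" using g by (metis le_add_diff_inverse2)
  note P = spectral_data_traces[OF s]
  have d: "trace (mpow_deriv X 1 V) = trace (mpow X 2) - trace (mpow X 0)"
    "trace (mpow_deriv X 2 V) = 2 * (trace (mpow X 3) - trace (mpow X 1))"
    "trace (mpow_deriv X 3 V) = 3 * (trace (mpow X 4) - trace (mpow X 2))"
    using trace_mpow_deriv[OF X, of 1 1] trace_mpow_deriv[OF X, of 2 1] trace_mpow_deriv[OF X, of 3 1]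
    by (simp_all add: V_def numeral_eq_Suc del: mpow.simps mpow_deriv.simps)
  show "(\<Sum>l<1. trace (mpow X l) * trace (mpow X (1 - l)) + trace (mpow (sympl_adjoint X) l ** mpow X (1 - l)))
      = of_nat (2 * g + 1) * elem1 X"
    unfolding spectral_data_elem[OF s] using P(1,2)
    by (simp add: trace_sympl_mpow_mult[OF X] algebra_simps)
  show "delem1 X V = (elem1 X)\<^sup>2 - 2 * elem2 g X - of_nat (4 * g)"
    "delem2 X V = elem1 X * elem2 g X - 3 * elem3 g X - of_nat (4 * (g - 1)) * elem1 X"
    "delem3 g X V = elem1 X * elem3 g X - of_nat (4 * (g - 2)) * elem2 g X"
    unfolding spectral_data_elem[OF s] delem1_def delem2_def delem3_def d P
    unfolding h
    by (simp_all add: field_simps power2_eq_square power3_eq_cube power4_eq_xxxx)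
qed

lemma loop_integrand_2:
  assumes X: "X \<in> USp" and s: "spectral_data g X x y z" and g: "g \<ge> 2"
  defines "V \<equiv> (mpow X 2 - mpow (sympl_adjoint X) 2) ** X"
  shows "(\<Sum>l<2. trace (mpow X l) * trace (mpow X (2 - l)) + trace (mpow (sympl_adjoint X) l ** mpow X (2 - l)))
      = of_nat (2*g+2) * (elem1 X)\<^sup>2 - of_nat (4*g+2) * elem2 g X - of_nat (4*g*g)"
    "delem1 X V = elem1 X ^ 3 - 3 * elem1 X * elem2 g X + 3 * elem3 g X - 4 * elem1 X"
    "delem2 X V = (elem1 X)\<^sup>2 * elem2 g X - 2 * (elem2 g X)\<^sup>2 - elem1 X * elem3 g X - 8 * elem2 g X"
    "delem3 g X V = elem3 g X * (elem1 X)\<^sup>2 - 2 * elem3 g X * elem2 g X - 12 * elem3 g X"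
proof -
  obtain h where h: "g = h + 2" using g by (metis le_add_diff_inverse2)
  note P = spectral_data_traces[OF s]
  have d: "trace (mpow_deriv X 1 V) = trace (mpow X 3) - trace (mpow X 1)"
    "trace (mpow_deriv X 2 V) = 2 * (trace (mpow X 4) - trace (mpow X 0))"
    "trace (mpow_deriv X 3 V) = 3 * (trace (mpow X 5) - trace (mpow X 1))"
    using trace_mpow_deriv[OF X, of 1 2] trace_mpow_deriv[OF X, of 2 2] trace_mpow_deriv[OF X, of 3 2]
    by (simp_all add: V_def numeral_eq_Suc del: mpow.simps mpow_deriv.simps)
  have "(\<Sum>l<2. trace (mpow X l) * trace (mpow X (2 - l)) + trace (mpow (sympl_adjoint X) l ** mpow X (2 - l)))
    = trace (mpow X 0) * trace (mpow X 2) + trace (mpow X 2) + (trace (mpow X 1) * trace (mpow X 1) + trace (mpow X 0))"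
    by (simp add: trace_sympl_mpow_mult[OF X] numeral_eq_Suc del: mpow.simps)
  thus "(\<Sum>l<2. trace (mpow X l) * trace (mpow X (2 - l)) + trace (mpow (sympl_adjoint X) l ** mpow X (2 - l)))
      = of_nat (2*g+2) * (elem1 X)\<^sup>2 - of_nat (4*g+2) * elem2 g X - of_nat (4*g*g)"
    unfolding spectral_data_elem[OF s] P
    by (simp add: algebra_simps power2_eq_square)
  show "delem1 X V = elem1 X ^ 3 - 3 * elem1 X * elem2 g X + 3 * elem3 g X - 4 * elem1 X"
    "delem2 X V = (elem1 X)\<^sup>2 * elem2 g X - 2 * (elem2 g X)\<^sup>2 - elem1 X * elem3 g X - 8 * elem2 g X"
    "delem3 g X V = elem3 g X * (elem1 X)\<^sup>2 - 2 * elem3 g X * elem2 g X - 12 * elem3 g X"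
    unfolding spectral_data_elem[OF s] delem1_def delem2_def delem3_def d P
    by (simp_all add: field_simps eval_nat_numeral)
qed

lemma loop_integrand_3:
  assumes X: "X \<in> USp" and s: "spectral_data g X x y z" and g: "g \<ge> 2"
  defines "V \<equiv> (mpow X 3 - mpow (sympl_adjoint X) 3) ** X"
  shows "(\<Sum>l<3. trace (mpow X l) * trace (mpow X (3 - l)) + trace (mpow (sympl_adjoint X) l ** mpow X (3 - l)))
      = of_nat (2*g+3) * elem1 X ^ 3 - of_nat (6*g+7) * elem1 X * elem2 g X + of_nat (6*g+3) * elem3 g X - of_nat (10*g+1) * elem1 X"
    "delem1 X V = elem1 X ^ 4 - 4 * (elem1 X)\<^sup>2 * elem2 g X + 2 * (elem2 g X)\<^sup>2 + 4 * elem1 X * elem3 g X - 5 * (elem1 X)\<^sup>2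
      + 10 * elem2 g X + of_nat (4*g)"
    "delem2 X V = elem1 X ^ 3 * elem2 g X - 3 * elem1 X * (elem2 g X)\<^sup>2 + 5 * elem2 g X * elem3 g X - (elem1 X)\<^sup>2 * elem3 g X
      - 5 * elem1 X * elem2 g X + 15 * elem3 g X + of_nat (4*(g-1)) * elem1 X"
    "delem3 g X V = elem1 X ^ 3 * elem3 g X - 3 * elem1 X * elem2 g X * elem3 g X + 3 * (elem3 g X)\<^sup>2 - 5 * elem1 X * elem3 g X
      + of_nat (4*(g-2)) * elem2 g X"
proof -
  obtain h where h: "g = h + 2" using g by (metis le_add_diff_inverse2)
  note P = spectral_data_traces[OF s]
  have d: "trace (mpow_deriv X 1 V) = trace (mpow X 4) - trace (mpow X 2)"
    "trace (mpow_deriv X 2 V) = 2 * (trace (mpow X 5) - trace (mpow X 1))"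
    "trace (mpow_deriv X 3 V) = 3 * (trace (mpow X 6) - trace (mpow X 0))"
    using trace_mpow_deriv[OF X, of 1 3] trace_mpow_deriv[OF X, of 2 3] trace_mpow_deriv[OF X, of 3 3]
    by (simp_all add: V_def numeral_eq_Suc del: mpow.simps mpow_deriv.simps)
  have "(\<Sum>l<3. trace (mpow X l) * trace (mpow X (3 - l)) + trace (mpow (sympl_adjoint X) l ** mpow X (3 - l)))
    = trace (mpow X 0) * trace (mpow X 3) + trace (mpow X 3) + (trace (mpow X 1) * trace (mpow X 2) + trace (mpow X 1))
      + (trace (mpow X 2) * trace (mpow X 1) + trace (mpow X 1))"
    by (simp add: trace_sympl_mpow_mult[OF X] numeral_eq_Suc del: mpow.simps)
  thus "(\<Sum>l<3. trace (mpow X l) * trace (mpow X (3 - l)) + trace (mpow (sympl_adjoint X) l ** mpow X (3 - l)))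
      = of_nat (2*g+3) * elem1 X ^ 3 - of_nat (6*g+7) * elem1 X * elem2 g X + of_nat (6*g+3) * elem3 g X - of_nat (10*g+1) * elem1 X"
    unfolding spectral_data_elem[OF s] P
    by (simp add: algebra_simps power2_eq_square power3_eq_cube)
  show "delem1 X V = elem1 X ^ 4 - 4 * (elem1 X)\<^sup>2 * elem2 g X + 2 * (elem2 g X)\<^sup>2 + 4 * elem1 X * elem3 g X - 5 * (elem1 X)\<^sup>2
      + 10 * elem2 g X + of_nat (4*g)"
    "delem2 X V = elem1 X ^ 3 * elem2 g X - 3 * elem1 X * (elem2 g X)\<^sup>2 + 5 * elem2 g X * elem3 g X - (elem1 X)\<^sup>2 * elem3 g X
      - 5 * elem1 X * elem2 g X + 15 * elem3 g X + of_nat (4*(g-1)) * elem1 X"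
    "delem3 g X V = elem1 X ^ 3 * elem3 g X - 3 * elem1 X * elem2 g X * elem3 g X + 3 * (elem3 g X)\<^sup>2 - 5 * elem1 X * elem3 g X
      + of_nat (4*(g-2)) * elem2 g X"
    unfolding spectral_data_elem[OF s] delem1_def delem2_def delem3_def d P
    unfolding h
    by (simp_all add: field_simps eval_nat_numeral)
qed

lemma integral_loop:
  fixes f :: "'b \<Rightarrow> nat \<Rightarrow> nat \<Rightarrow> nat \<Rightarrow> complex"
  assumes [simp]: "\<And>i j k. integrable M (\<lambda>X. f X i j k)"
  shows "loop1 g (\<lambda>a b c. \<integral>X. f X a b c \<partial>M) a b c = (\<integral>X. loop1 g (f X) a b c \<partial>M)"
    "loop2 g (\<lambda>a b c. \<integral>X. f X a b c \<partial>M) a b c = (\<integral>X. loop2 g (f X) a b c \<partial>M)"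
    "loop3 g (\<lambda>a b c. \<integral>X. f X a b c \<partial>M) a b c = (\<integral>X. loop3 g (f X) a b c \<partial>M)"
  unfolding loop1_def loop2_def loop3_def by simp_all

lemma haar_loop_monomial:
  fixes M :: "(complex^('g::finite + 'g)^('g + 'g)) measure"
  assumes M: "normalized_haar_measure USp M"
    and eq: "\<And>X. X \<in> USp \<Longrightarrow> L X =
      (\<Sum>l<k. trace (mpow X l) * trace (mpow X (k - l)) +
          trace (mpow (sympl_adjoint X) l ** mpow X (k - l))) * (elem1 X ^ a * elem2 g X ^ b * elem3 g X ^ c) +
        (of_nat a * (elem1 X ^ (a-1) * elem2 g X ^ b * elem3 g X ^ c) *
            delem1 X ((mpow X k - mpow (sympl_adjoint X) k) ** X)
          + of_nat b * (elem1 X ^ a * elem2 g X ^ (b-1) * elem3 g X ^ c) *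
            delem2 X ((mpow X k - mpow (sympl_adjoint X) k) ** X)
          + of_nat c * (elem1 X ^ a * elem2 g X ^ b * elem3 g X ^ (c-1)) *
            delem3 g X ((mpow X k - mpow (sympl_adjoint X) k) ** X))"
  shows "(\<integral>X. L X \<partial>M) = 0"
  using loop_equation[OF M C1_complex_monomial, of k a g b c]
  by (subst Bochner_Integration.integral_cong[OF refl eq]) (simp_all only: haar_space[OF M])

theorem haar_loop_moments:
  fixes M :: "(complex^('g::finite + 'g)^('g + 'g)) measure"
  assumes M: "normalized_haar_measure USp M" and g: "g \<ge> 2"
    and sd: "\<And>X. X \<in> (USp :: (complex^('g + 'g)^('g + 'g)) set) \<Longrightarrow> \<exists>x y z. spectral_data g X x y z"
  shows "loop_moments g (\<lambda>a b c. \<integral>X. elem1 X ^ a * elem2 g X ^ b * elem3 g X ^ c \<partial>M)"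
proof -
  let ?F = "\<lambda>X a b c. elem1 X ^ a * elem2 g X ^ b * elem3 g X ^ c"
  have int: "integrable M (\<lambda>X. ?F X a b c)" for a b c
    by (rule haar_integrable[OF M C1_complex_continuous[OF C1_complex_monomial]])
  note pull = integral_loop[where f = ?F, OF int]
  have "(\<integral>X. loop1 g (?F X) a b c \<partial>M) = 0" for a b c
  proof (rule haar_loop_monomial[OF M, where k = 1])
    fix X :: "complex^('g + 'g)^('g + 'g)" assume X: "X \<in> USp"
    then obtain x y z where s: "spectral_data g X x y z" using sd by blast
    show "loop1 g (?F X) a b c =
      (\<Sum>l<1. trace (mpow X l) * trace (mpow X (1 - l)) +
          trace (mpow (sympl_adjoint X) l ** mpow X (1 - l))) * ?F X a b c +
        (of_nat a * ?F X (a-1) b c * delem1 X ((mpow X 1 - mpow (sympl_adjoint X) 1) ** X)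
          + of_nat b * ?F X a (b-1) c * delem2 X ((mpow X 1 - mpow (sympl_adjoint X) 1) ** X)
          + of_nat c * ?F X a b (c-1) * delem3 g X ((mpow X 1 - mpow (sympl_adjoint X) 1) ** X))"
      unfolding loop1_monomial loop_integrand_1[OF X s g] by (simp only: add.assoc)
  qed
  moreover have "(\<integral>X. loop2 g (?F X) a b c \<partial>M) = 0" for a b c
  proof (rule haar_loop_monomial[OF M, where k = 2])
    fix X :: "complex^('g + 'g)^('g + 'g)" assume X: "X \<in> USp"
    then obtain x y z where s: "spectral_data g X x y z" using sd by blast
    show "loop2 g (?F X) a b c =
      (\<Sum>l<2. trace (mpow X l) * trace (mpow X (2 - l)) +
          trace (mpow (sympl_adjoint X) l ** mpow X (2 - l))) * ?F X a b c +
        (of_nat a * ?F X (a-1) b c * delem1 X ((mpow X 2 - mpow (sympl_adjoint X) 2) ** X)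
          + of_nat b * ?F X a (b-1) c * delem2 X ((mpow X 2 - mpow (sympl_adjoint X) 2) ** X)
          + of_nat c * ?F X a b (c-1) * delem3 g X ((mpow X 2 - mpow (sympl_adjoint X) 2) ** X))"
      unfolding loop2_monomial loop_integrand_2[OF X s g] by (simp only: add.assoc)
  qed
  moreover have "(\<integral>X. loop3 g (?F X) a b c \<partial>M) = 0" for a b c
  proof (rule haar_loop_monomial[OF M, where k = 3])
    fix X :: "complex^('g + 'g)^('g + 'g)" assume X: "X \<in> USp"
    then obtain x y z where s: "spectral_data g X x y z" using sd by blast
    show "loop3 g (?F X) a b c =
      (\<Sum>l<3. trace (mpow X l) * trace (mpow X (3 - l)) +
          trace (mpow (sympl_adjoint X) l ** mpow X (3 - l))) * ?F X a b c +
        (of_nat a * ?F X (a-1) b c * delem1 X ((mpow X 3 - mpow (sympl_adjoint X) 3) ** X)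
          + of_nat b * ?F X a (b-1) c * delem2 X ((mpow X 3 - mpow (sympl_adjoint X) 3) ** X)
          + of_nat c * ?F X a b (c-1) * delem3 g X ((mpow X 3 - mpow (sympl_adjoint X) 3) ** X))"
      unfolding loop3_monomial loop_integrand_3[OF X s g] by (simp only: add.assoc)
  qed
  ultimately show ?thesis by (simp only: loop_moments_def pull) simp
qed

section \<open>Moments of the characteristic polynomial\<close>

lemma loop_moments_scale:
  assumes "loop_moments g m"
  shows "loop_moments g (\<lambda>a b c. s * m a b c)"
  using assms by (simp add: loop_moments_def loop_scale)

lemma haar_moment_0:
  assumes "normalized_haar_measure USp M"
  shows "(\<integral>X. (1::complex) \<partial>M) = 1"
proof -
  interpret prob_space M using assms by (simp add: normalized_haar_measure_def)
  show ?thesis by (simp add: prob_space)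
qed

lemma C_values: "C 0 = 1" "C 1 = 0" "C 2 = 1" "C 3 = 0" "C 4 = 2"
proof -
  show "C 1 = 0" "C 3 = 0" by (rule C_odd, simp)+
  show "C 0 = 1" "C 2 = 1" "C 4 = 2"
    using C_even[of 0] C_even[of 1] C_even[of 2] by (simp_all add: binomial_eq_0 numeral_eq_Suc)
qed

lemma difference_squared_mult:
  fixes x y :: "'a::comm_ring_1"
  shows "(x - y)\<^sup>2 * ((x + y) ^ 0 * (x * y) ^ n * 0 ^ 0) =
    x ^ (n + 2) * y ^ n - of_nat 2 * (x ^ (n + 1) * y ^ (n + 1)) + x ^ n * y ^ (n + 2)"
  by (simp add: power2_eq_square power_mult_distrib algebra_simps)

text \<open>
  Weyl's integration formula for symmetric polynomials on \<open>USp(4)\<close>. The factor \<open>0 ^ c\<close> stands for the power of the third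
  elementary symmetric polynomial, which vanishes for two variables.
\<close>

lemma haar_moments_2:
  fixes M :: "(complex^(2 + 2)^(2 + 2)) measure"
  assumes M: "normalized_haar_measure USp M"
  shows "(\<integral>X. elem1 X ^ a * elem2 2 X ^ b * elem3 2 X ^ c \<partial>M) =
    1 / 2 * semicircle2 ((v2x - v2y)\<^sup>2 * ((v2x + v2y) ^ a * (v2x * v2y) ^ b * 0 ^ c))"
proof (rule loop_moments_unique[of 2])
  show "loop_moments 2 (\<lambda>a b c. \<integral>X. elem1 X ^ a * elem2 2 X ^ b * elem3 2 X ^ c \<partial>M)"
    by (rule haar_loop_moments[OF M]) (use USp_spectral_data_2 in \<open>auto, metis\<close>)
  show "loop_moments 2 (\<lambda>a b c. 1 / 2 * semicircle2 ((v2x - v2y)\<^sup>2 * ((v2x + v2y) ^ a * (v2x * v2y) ^ b * 0 ^ c)))"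
    by (rule loop_moments_scale[OF semicircle2_loop_moments])
  have "semicircle2 ((v2x - v2y)\<^sup>2 * ((v2x + v2y) ^ 0 * (v2x * v2y) ^ 0 * 0 ^ 0)) =
      of_int (C (0 + 2) * C 0) - of_nat 2 * of_int (C (0 + 1) * C (0 + 1)) + of_int (C 0 * C (0 + 2))"
    using additive_semicircle2
    by (simp only: difference_squared_mult additive_fun_def additive_fun_diff[OF additive_semicircle2]
        additive_fun_of_nat[OF additive_semicircle2] semicircle2_monomial)
  thus "(\<integral>X. elem1 X ^ 0 * elem2 2 X ^ 0 * elem3 2 X ^ 0 \<partial>M) =
    1 / 2 * semicircle2 ((v2x - v2y)\<^sup>2 * ((v2x + v2y) ^ 0 * (v2x * v2y) ^ 0 * 0 ^ 0))"
    using haar_moment_0[OF M] by (simp only: add_0 C_values power_0 mult_1_right) simp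
qed simp

lemma moments_USp4:
  fixes M :: "(complex^(2 + 2)^(2 + 2)) measure"
  assumes M: "normalized_haar_measure USp M"
  shows "(\<integral>A. (coeff (char_polynomial A) 2 - 2) ^ n \<partial>M) = of_int (C n * C (n + 2) - (C (n + 1))\<^sup>2)"
proof -
  have "(\<integral>A. (coeff (char_polynomial A) 2 - 2) ^ n \<partial>M) = (\<integral>X. elem1 X ^ 0 * elem2 2 X ^ n * elem3 2 X ^ 0 \<partial>M)"
  proof (rule Bochner_Integration.integral_cong[OF refl])
    fix X assume "X \<in> space M"
    hence "X \<in> USp" by (simp add: haar_space[OF M])
    then obtain x y where s: "spectral_data 2 X x y 0" "coeff (char_polynomial X) 2 = x * y + 2"
      using USp_spectral_data_2 by blast
    show "(coeff (char_polynomial X) 2 - 2) ^ n = elem1 X ^ 0 * elem2 2 X ^ n * elem3 2 X ^ 0"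
      using spectral_data_elem(2)[OF s(1)] s(2) by simp
  qed
  also have "\<dots> = 1 / 2 * semicircle2 ((v2x - v2y)\<^sup>2 * ((v2x + v2y) ^ 0 * (v2x * v2y) ^ n * 0 ^ 0))"
    by (rule haar_moments_2[OF M])
  also have "(v2x - v2y)\<^sup>2 * ((v2x + v2y) ^ 0 * (v2x * v2y) ^ n * 0 ^ 0) =
      v2x ^ (n + 2) * v2y ^ n - of_nat 2 * (v2x ^ (n + 1) * v2y ^ (n + 1)) + v2x ^ n * v2y ^ (n + 2)"
    by (rule difference_squared_mult)
  also have "semicircle2 \<dots> = of_int (C (n + 2) * C n) - of_nat 2 * of_int (C (n + 1) * C (n + 1)) + of_int (C n * C (n + 2))"
    using additive_semicircle2
    by (simp only: additive_fun_def additive_fun_diff[OF additive_semicircle2] additive_fun_of_nat[OF additive_semicircle2] semicircle2_monomial)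
  also have "1 / 2 * \<dots> = of_int (C n * C (n + 2) - (C (n + 1))\<^sup>2)"
    by (simp add: power2_eq_square algebra_simps)
  finally show ?thesis .
qed

lemma vandermonde_squared:
  fixes x y z :: "'a::comm_ring_1"
  shows "((x - y) * (x - z) * (y - z))\<^sup>2 =
    (x^4 * y^2 * z^0 + x^4 * y^0 * z^2 + x^2 * y^4 * z^0 + x^2 * y^0 * z^4 + x^0 * y^4 * z^2 + x^0 * y^2 * z^4)
    - of_nat 2 * (x^4 * y^1 * z^1 + x^1 * y^4 * z^1 + x^1 * y^1 * z^4)
    - of_nat 2 * (x^3 * y^3 * z^0 + x^3 * y^0 * z^3 + x^0 * y^3 * z^3)
    + of_nat 2 * (x^3 * y^2 * z^1 + x^3 * y^1 * z^2 + x^2 * y^3 * z^1 + x^2 * y^1 * z^3 + x^1 * y^3 * z^2 + x^1 * y^2 * z^3)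
    - of_nat 6 * (x^2 * y^2 * z^2)"
  by (simp add: eval_nat_numeral algebra_simps)

text \<open>
  For a symmetric moment function the double sum over permutations in the squared Vandermonde determinant collapses: each
  of the six choices of one permutation contributes the same determinant in the other.
\<close>

lemma symmetric_discriminant:
  fixes \<phi> :: "'r::comm_ring_1 \<Rightarrow> complex"
  assumes \<phi>: "additive_fun \<phi>"
    and mon: "\<And>p q r. \<phi> (x ^ p * y ^ q * z ^ r * h) = G p q r"
    and sym: "\<And>p q r. G p q r = G q p r" "\<And>p q r. G p q r = G p r q"
  shows "\<phi> (((x - y) * (x - z) * (y - z))\<^sup>2 * h) =
    6 * (G 0 2 4 - G 1 1 4 - G 0 3 3 - G 2 2 2 + 2 * G 1 2 3)"
proof -
  have add: "\<phi> (u + v) = \<phi> u + \<phi> v" for u v using \<phi> by (simp add: additive_fun_def)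
  have n: "\<phi> (of_nat k * u * h) = of_nat k * \<phi> (u * h)" for k u
    using additive_fun_of_nat[OF \<phi>, of k "u * h"] by (simp only: mult.assoc)
  have s: "G 4 2 0 = G 0 2 4" "G 4 0 2 = G 0 2 4" "G 2 4 0 = G 0 2 4" "G 2 0 4 = G 0 2 4" "G 0 4 2 = G 0 2 4"
    "G 4 1 1 = G 1 1 4" "G 1 4 1 = G 1 1 4" "G 3 3 0 = G 0 3 3" "G 3 0 3 = G 0 3 3"
    "G 3 2 1 = G 1 2 3" "G 3 1 2 = G 1 2 3" "G 2 3 1 = G 1 2 3" "G 2 1 3 = G 1 2 3" "G 1 3 2 = G 1 2 3"
    by (metis sym)+
  show ?thesis
    unfolding vandermonde_squared
    by (simp only: left_diff_distrib distrib_right n add additive_fun_diff[OF \<phi>] mon s) simp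
qed

lemma det3_hankel:
  "det3 (\<lambda>i j. C (f j + i + j - 2)) =
    C (f 1 + 0) * C (f 2 + 2) * C (f 3 + 4) - C (f 1 + 1) * C (f 2 + 1) * C (f 3 + 4)
    - C (f 1 + 0) * C (f 2 + 3) * C (f 3 + 3) - C (f 1 + 2) * C (f 2 + 2) * C (f 3 + 2)
    + C (f 1 + 1) * C (f 2 + 3) * C (f 3 + 2) + C (f 1 + 2) * C (f 2 + 1) * C (f 3 + 3)"
proof -
  have e: "f 1 + 1 + 1 - 2 = f 1 + 0" "f 2 + 1 + 2 - 2 = f 2 + 1" "f 3 + 1 + 3 - 2 = f 3 + 2"
    "f 1 + 2 + 1 - 2 = f 1 + 1" "f 2 + 2 + 2 - 2 = f 2 + 2" "f 3 + 2 + 3 - 2 = f 3 + 3"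
    "f 1 + 3 + 1 - 2 = f 1 + 2" "f 2 + 3 + 2 - 2 = f 2 + 3" "f 3 + 3 + 3 - 2 = f 3 + 4"
    by simp_all
  show ?thesis
    unfolding det3_def det_3 vector_3 e by (simp only: mult_ac)
qed

text \<open>
  The polynomial is symmetric as a whole, witnessed by two bijections of the index set that exchange neighbouring variables. Its
  individual terms are not, so the symmetry of the moments only appears after summation.
\<close>

lemma weyl_determinant:
  fixes wt :: "'t \<Rightarrow> int" and k :: "'t \<Rightarrow> nat \<Rightarrow> nat"
  assumes fin: "finite T"
    and swap12: "bij_betw \<sigma> T T" "\<And>t. t \<in> T \<Longrightarrow> wt (\<sigma> t) = wt t"
      "\<And>t. t \<in> T \<Longrightarrow> k (\<sigma> t) 1 = k t 2 \<and> k (\<sigma> t) 2 = k t 1 \<and> k (\<sigma> t) 3 = k t 3"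
    and swap23: "bij_betw \<tau> T T" "\<And>t. t \<in> T \<Longrightarrow> wt (\<tau> t) = wt t"
      "\<And>t. t \<in> T \<Longrightarrow> k (\<tau> t) 1 = k t 1 \<and> k (\<tau> t) 2 = k t 3 \<and> k (\<tau> t) 3 = k t 2"
  shows "semicircle3 (((v3x - v3y) * (v3x - v3z) * (v3y - v3z))\<^sup>2 * (\<Sum>t\<in>T. v3x ^ k t 1 * v3y ^ k t 2 * v3z ^ k t 3 * of_int (wt t))) =
    6 * of_int (\<Sum>t\<in>T. wt t * det3 (\<lambda>i j. C (k t j + i + j - 2)))"
proof -
  define G where "G p q r = (\<Sum>t\<in>T. wt t * (C (k t 1 + p) * C (k t 2 + q) * C (k t 3 + r)))" for p q r
  have mon: "semicircle3 (v3x ^ p * v3y ^ q * v3z ^ r * (\<Sum>t\<in>T. v3x ^ k t 1 * v3y ^ k t 2 * v3z ^ k t 3 * of_int (wt t))) =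
      of_int (G p q r)" for p q r
  proof -
    have "v3x ^ p * v3y ^ q * v3z ^ r * (v3x ^ k t 1 * v3y ^ k t 2 * v3z ^ k t 3 * of_int (wt t)) =
        v3x ^ (k t 1 + p) * v3y ^ (k t 2 + q) * v3z ^ (k t 3 + r) * of_int (wt t)" for t
      by (simp only: power_add mult_ac)
    hence "semicircle3 (v3x ^ p * v3y ^ q * v3z ^ r * (v3x ^ k t 1 * v3y ^ k t 2 * v3z ^ k t 3 * of_int (wt t))) =
        of_int (C (k t 1 + p) * C (k t 2 + q) * C (k t 3 + r)) * of_int (wt t)" for t
      by (simp only: additive_fun_of_int[OF additive_semicircle3] semicircle3_monomial)
    thus ?thesis
      by (simp only: sum_distrib_left additive_fun_sum[OF additive_semicircle3] G_def of_int_sum)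
        (simp add: mult_ac)
  qed
  have sym12: "G p q r = G q p r" for p q r
  proof -
    have "G p q r = (\<Sum>t\<in>T. wt (\<sigma> t) * (C (k (\<sigma> t) 1 + p) * C (k (\<sigma> t) 2 + q) * C (k (\<sigma> t) 3 + r)))"
      unfolding G_def by (rule sum.reindex_bij_betw[OF swap12(1), symmetric])
    also have "\<dots> = G q p r"
      unfolding G_def using swap12(2,3) by (intro sum.cong) (auto simp: mult_ac)
    finally show ?thesis .
  qed
  have sym23: "G p q r = G p r q" for p q r
  proof -
    have "G p q r = (\<Sum>t\<in>T. wt (\<tau> t) * (C (k (\<tau> t) 1 + p) * C (k (\<tau> t) 2 + q) * C (k (\<tau> t) 3 + r)))"
      unfolding G_def by (rule sum.reindex_bij_betw[OF swap23(1), symmetric])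
    also have "\<dots> = G p r q"
      unfolding G_def using swap23(2,3) by (intro sum.cong) (auto simp: mult_ac)
    finally show ?thesis .
  qed
  have "semicircle3 (((v3x - v3y) * (v3x - v3z) * (v3y - v3z))\<^sup>2 * (\<Sum>t\<in>T. v3x ^ k t 1 * v3y ^ k t 2 * v3z ^ k t 3 * of_int (wt t))) =
    6 * (of_int (G 0 2 4) - of_int (G 1 1 4) - of_int (G 0 3 3) - of_int (G 2 2 2) + 2 * of_int (G 1 2 3))"
    by (rule symmetric_discriminant[OF additive_semicircle3 mon]) (simp_all only: sym12[of _ _] sym23[of _ _])
  also have "\<dots> = 6 * of_int (G 0 2 4 - G 1 1 4 - G 0 3 3 - G 2 2 2 + G 1 3 2 + G 2 1 3)"
    using sym12[of 2 1 3] sym23[of 1 3 2] by simp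
  also have "G 0 2 4 - G 1 1 4 - G 0 3 3 - G 2 2 2 + G 1 3 2 + G 2 1 3 =
      (\<Sum>t\<in>T. wt t * det3 (\<lambda>i j. C (k t j + i + j - 2)))"
    unfolding G_def det3_hankel
    by (simp only: right_diff_distrib distrib_left sum.distrib sum_subtractf)
  finally show ?thesis .
qed

text \<open>
  Weyl's integration formula for symmetric polynomials on \<open>USp(6)\<close>.
\<close>

lemma haar_moments_3:
  fixes M :: "(complex^(3 + 3)^(3 + 3)) measure"
  assumes M: "normalized_haar_measure USp M"
  shows "(\<integral>X. elem1 X ^ a * elem2 3 X ^ b * elem3 3 X ^ c \<partial>M) =
    1 / 6 * semicircle3 (((v3x - v3y) * (v3x - v3z) * (v3y - v3z))\<^sup>2 *
     ((v3x + v3y + v3z) ^ a * (v3x * v3y + v3x * v3z + v3y * v3z) ^ b * (v3x * v3y * v3z) ^ c))"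
proof (rule loop_moments_unique[of 3])
  show "loop_moments 3 (\<lambda>a b c. \<integral>X. elem1 X ^ a * elem2 3 X ^ b * elem3 3 X ^ c \<partial>M)"
    by (rule haar_loop_moments[OF M]) (use USp_spectral_data_3 in \<open>auto, metis\<close>)
  show "loop_moments 3 (\<lambda>a b c. 1 / 6 * semicircle3 (((v3x - v3y) * (v3x - v3z) * (v3y - v3z))\<^sup>2 *
     ((v3x + v3y + v3z) ^ a * (v3x * v3y + v3x * v3z + v3y * v3z) ^ b * (v3x * v3y * v3z) ^ c)))"
    by (rule loop_moments_scale[OF semicircle3_loop_moments])
  have "semicircle3 (((v3x - v3y) * (v3x - v3z) * (v3y - v3z))\<^sup>2 * 1) = 6 * (of_int (C 0 * C 2 * C 4) - of_int (C 1 * C 1 * C 4)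
      - of_int (C 0 * C 3 * C 3) - of_int (C 2 * C 2 * C 2) + 2 * of_int (C 1 * C 2 * C 3))"
    by (rule symmetric_discriminant[OF additive_semicircle3, where G = "\<lambda>p q r. of_int (C p * C q * C r)"])
      (simp_all only: mult_1_right semicircle3_monomial, simp_all only: mult_ac)
  thus "(\<integral>X. elem1 X ^ 0 * elem2 3 X ^ 0 * elem3 3 X ^ 0 \<partial>M) =
    1 / 6 * semicircle3 (((v3x - v3y) * (v3x - v3z) * (v3y - v3z))\<^sup>2 *
     ((v3x + v3y + v3z) ^ 0 * (v3x * v3y + v3x * v3z + v3y * v3z) ^ 0 * (v3x * v3y * v3z) ^ 0))"
    using haar_moment_0[OF M] by (simp only: power_0 mult_1_right C_values) simp
qed simp

lemma moments_a2_USp6: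
  fixes M :: "(complex^(3 + 3)^(3 + 3)) measure"
  assumes M: "normalized_haar_measure USp M"
  shows "(\<integral>A. (coeff (char_polynomial A) 2 - 3) ^ n \<partial>M) =
    of_int (\<Sum>(n1, n2, n3) \<in> {(n1, n2, n3). n1 + n2 + n3 = n}.
            int (multinomial n [n1, n2, n3]) *
            det3 (\<lambda>i j. C (n - [n1, n2, n3] ! (j - 1) + i + j - 2)))"
proof -
  let ?T = "{(n1, n2, n3). n1 + n2 + n3 = n}"
  define wt where "wt = (\<lambda>(n1, n2, n3). int (multinomial n [n1, n2, n3]))"
  define k where "k = (\<lambda>(n1, n2, n3) j. n - [n1, n2, n3] ! (j - 1))"
  have "(\<integral>A. (coeff (char_polynomial A) 2 - 3) ^ n \<partial>M) = (\<integral>X. elem1 X ^ 0 * elem2 3 X ^ n * elem3 3 X ^ 0 \<partial>M)"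
  proof (rule Bochner_Integration.integral_cong[OF refl])
    fix X assume "X \<in> space M"
    hence "X \<in> USp" by (simp add: haar_space[OF M])
    then obtain x y z where s: "spectral_data 3 X x y z" "coeff (char_polynomial X) 2 = x * y + x * z + y * z + 3"
      using USp_spectral_data_3 by blast
    show "(coeff (char_polynomial X) 2 - 3) ^ n = elem1 X ^ 0 * elem2 3 X ^ n * elem3 3 X ^ 0"
      using spectral_data_elem(2)[OF s(1)] s(2) by simp
  qed
  also have "\<dots> = 1 / 6 * semicircle3 (((v3x - v3y) * (v3x - v3z) * (v3y - v3z))\<^sup>2 *
     ((v3x + v3y + v3z) ^ 0 * (v3x * v3y + v3x * v3z + v3y * v3z) ^ n * (v3x * v3y * v3z) ^ 0))"
    by (rule haar_moments_3[OF M])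
  also have "(v3x + v3y + v3z) ^ 0 * (v3x * v3y + v3x * v3z + v3y * v3z) ^ n * (v3x * v3y * v3z) ^ 0 =
      (\<Sum>t\<in>?T. v3x ^ k t 1 * v3y ^ k t 2 * v3z ^ k t 3 * of_int (wt t))"
  proof -
    have "(v3x * v3y + v3x * v3z + v3y * v3z) ^ n = (v3y * v3z + v3x * v3z + v3x * v3y) ^ n"
      by (simp only: add_ac)
    also have "\<dots> = (\<Sum>(n1, n2, n3)\<in>?T. of_nat (multinomial n [n1, n2, n3]) *
        ((v3y * v3z) ^ n1 * (v3x * v3z) ^ n2 * (v3x * v3y) ^ n3))"
      by (rule trinomial)
    also have "\<dots> = (\<Sum>t\<in>?T. v3x ^ k t 1 * v3y ^ k t 2 * v3z ^ k t 3 * of_int (wt t))"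
    proof (rule sum.cong[OF refl], clarsimp simp del: mult_pCons_left mult_pCons_right)
      fix n1 n2 n3 assume "n = n1 + n2 + n3"
      hence e: "k (n1, n2, n3) (Suc 0) = n2 + n3" "k (n1, n2, n3) 2 = n1 + n3" "k (n1, n2, n3) 3 = n1 + n2"
        by (simp_all add: k_def)
      have w: "(of_int (wt (n1, n2, n3)) :: complex poly poly poly) = of_nat (multinomial (n1 + n2 + n3) [n1, n2, n3])"
        using \<open>n = n1 + n2 + n3\<close> by (simp add: wt_def)
      show "of_nat (multinomial (n1 + n2 + n3) [n1, n2, n3]) * ((v3y * v3z) ^ n1 * (v3x * v3z) ^ n2 * (v3x * v3y) ^ n3) =
        v3x ^ k (n1, n2, n3) (Suc 0) * v3y ^ k (n1, n2, n3) 2 * v3z ^ k (n1, n2, n3) 3 * of_int (wt (n1, n2, n3))"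
        unfolding e w by (simp only: power_add power_mult_distrib mult_ac)
    qed
    finally show ?thesis by (simp only: power_0 mult_1 mult_1_right)
  qed
  also have "semicircle3 (((v3x - v3y) * (v3x - v3z) * (v3y - v3z))\<^sup>2 * (\<Sum>t\<in>?T. v3x ^ k t 1 * v3y ^ k t 2 * v3z ^ k t 3 * of_int (wt t))) =
      6 * of_int (\<Sum>t\<in>?T. wt t * det3 (\<lambda>i j. C (k t j + i + j - 2)))"
  proof (rule weyl_determinant[where \<sigma> = "\<lambda>(a, b, c). (b, a, c)" and \<tau> = "\<lambda>(a, b, c). (a, c, b)"])
    show "bij_betw (\<lambda>(a, b, c). (b, a, c)) ?T ?T" "bij_betw (\<lambda>(a, b, c). (a, c, b)) ?T ?T"
      by (rule bij_betw_byWitness[where f' = "\<lambda>(a, b, c). (b, a, c)"]; auto)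
        (rule bij_betw_byWitness[where f' = "\<lambda>(a, b, c). (a, c, b)"]; auto)
  qed (auto simp: finite_compositions_3 wt_def k_def multinomial_def mult_ac)
  also have "1 / 6 * (6 * of_int (\<Sum>t\<in>?T. wt t * det3 (\<lambda>i j. C (k t j + i + j - 2)))) =
    complex_of_int (\<Sum>(n1, n2, n3) \<in> ?T. int (multinomial n [n1, n2, n3]) *
            det3 (\<lambda>i j. C (n - [n1, n2, n3] ! (j - 1) + i + j - 2)))"
    by (simp add: wt_def k_def case_prod_unfold)
  finally show ?thesis .
qed

lemma binomial_twice_plus:
  fixes u v w :: "'a::comm_ring_1"
  shows "(2 * u + w) ^ n = (\<Sum>k\<le>n. of_nat ((n choose k) * 2 ^ k) * (u ^ k * v ^ 0 * w ^ (n - k)))"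
  unfolding binomial_ring by (intro sum.cong refl) (simp add: power_mult_distrib mult_ac)

lemma trace_mpow_minus: "trace (mpow (- X) k) = (-1) ^ k * trace (mpow (X :: complex^'n^'n) k)"
proof -
  have "mpow (- X) k = mat ((-1) ^ k) ** mpow X k"
  proof (induction k)
    case (Suc k)
    have "mpow (- X) (Suc k) = - (X ** (mat ((-1) ^ k) ** mpow X k))"
      using Suc by (simp add: matrix_minus_left)
    also have "\<dots> = mat ((-1) ^ Suc k) ** mpow X (Suc k)"
      by (simp add: vec_eq_iff mat_mult_component matrix_mul_assoc mat_commute[symmetric])
        (simp add: matrix_mul_assoc[symmetric] mat_mult_component)
    finally show ?case .
  qed simp
  thus ?thesis by (simp add: trace_def mat_mult_component sum_distrib_left)
qed

lemma elem_minus: "elem1 (- X) = - elem1 X" "elem3 g (- X) = - elem3 g X"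
  unfolding elem1_def elem3_def trace_mpow_minus by (simp_all add: field_simps power3_eq_cube)

lemma minus_one_USp: "- mat 1 \<in> USp"
proof -
  have "- mat 1 = (mat (-1) :: complex^('a + 'a)^('a + 'a))" by (simp add: vec_eq_iff mat_def)
  hence "conj_transpose (- mat 1) = (- mat 1 :: complex^('a + 'a)^('a + 'a))"
    by (simp add: conj_transpose_linear)
  thus ?thesis
    by (simp add: USp_iff sympl_adjoint_linear matrix_minus_left matrix_minus_right)
qed

text \<open>
  Here \<open>a\<^sub>3 = - (e\<^sub>3 + 2 e\<^sub>1)\<close>. The sign is removed by translating with the group element \<open>-1\<close>, under which \<open>e\<^sub>1\<close> and \<open>e\<^sub>3\<close> are odd.
\<close>

lemma moments_a3_USp6:
  fixes M :: "(complex^(3 + 3)^(3 + 3)) measure"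
  assumes M: "normalized_haar_measure USp M"
  shows "(\<integral>A. (coeff (char_polynomial A) 3) ^ n \<partial>M) =
    of_int (\<Sum>(n1, n2, n3, m) \<in> {(n1, n2, n3, m). n1 + n2 + n3 + m = n}.
            int (multinomial n [n1, n2, n3, m]) * 2 ^ (n - m) *
            det3 (\<lambda>i j. C (m + [n1, n2, n3] ! (j - 1) + i + j - 2)))"
proof -
  let ?T = "{(n1, n2, n3, m). n1 + n2 + n3 + m = n}"
  let ?V = "((v3x - v3y) * (v3x - v3z) * (v3y - v3z))\<^sup>2"
  define wt where "wt = (\<lambda>(n1, n2, n3, m). int (multinomial n [n1, n2, n3, m]) * 2 ^ (n - m))"
  define k where "k = (\<lambda>(n1, n2, n3, m :: nat) j. m + [n1, n2, n3] ! (j - 1))"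
  let ?f = "\<lambda>X :: complex^(3 + 3)^(3 + 3). (- (2 * elem1 X + elem3 3 X)) ^ n"
  have fc: "continuous_on UNIV ?f"
    by (intro continuous_intros C1_complex_continuous[OF C1_complex_elem1] C1_complex_continuous[OF C1_complex_elem3])
  have "(\<integral>A. (coeff (char_polynomial A) 3) ^ n \<partial>M) = (\<integral>X. ?f X \<partial>M)"
  proof (rule Bochner_Integration.integral_cong[OF refl])
    fix X assume "X \<in> space M"
    hence "X \<in> USp" by (simp add: haar_space[OF M])
    then obtain x y z where s: "spectral_data 3 X x y z"
      "coeff (char_polynomial X) 3 = - (x * y * z + 2 * (x + y + z))"
      using USp_spectral_data_3 by blast
    show "(coeff (char_polynomial X) 3) ^ n = ?f X"
      unfolding spectral_data_elem[OF s(1)] s(2) by (simp only: add.commute)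
  qed
  also have "\<dots> = (\<integral>X. ?f (- mat 1 ** X) \<partial>M)"
    by (rule haar_left_invariant[OF M fc minus_one_USp, symmetric])
  also have "\<dots> = (\<integral>X. (2 * elem1 X + elem3 3 X) ^ n \<partial>M)"
    by (simp add: matrix_minus_left elem_minus add.commute)
  also have "\<dots> = (\<integral>X. (\<Sum>k\<le>n. of_nat ((n choose k) * 2 ^ k) * (elem1 X ^ k * elem2 3 X ^ 0 * elem3 3 X ^ (n - k))) \<partial>M)"
    by (intro Bochner_Integration.integral_cong refl binomial_twice_plus)
  also have "\<dots> = (\<Sum>k\<le>n. of_nat ((n choose k) * 2 ^ k) * (\<integral>X. elem1 X ^ k * elem2 3 X ^ 0 * elem3 3 X ^ (n - k) \<partial>M))"
    by (subst Bochner_Integration.integral_sum;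
        (intro integrable_mult_right haar_integrable[OF M C1_complex_continuous[OF C1_complex_monomial]]
          | simp only: integral_mult_right_zero))
  also have "\<dots> = (\<Sum>k\<le>n. of_nat ((n choose k) * 2 ^ k) * (1 / 6 * semicircle3 (?V *
      ((v3x + v3y + v3z) ^ k * (v3x * v3y + v3x * v3z + v3y * v3z) ^ 0 * (v3x * v3y * v3z) ^ (n - k)))))"
    by (simp only: haar_moments_3[OF M])
  also have "\<dots> = 1 / 6 * semicircle3 (?V * (\<Sum>k\<le>n. of_nat ((n choose k) * 2 ^ k) *
      ((v3x + v3y + v3z) ^ k * (v3x * v3y + v3x * v3z + v3y * v3z) ^ 0 * (v3x * v3y * v3z) ^ (n - k))))"
    by (simp only: sum_distrib_left mult.left_commute[of ?V] additive_fun_sum[OF additive_semicircle3]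
        additive_fun_of_nat[OF additive_semicircle3] mult.left_commute[of "1 / 6"])
  also have "\<dots> = 1 / 6 * semicircle3 (?V * (2 * (v3x + v3y + v3z) + v3x * v3y * v3z) ^ n)"
    by (simp only: binomial_twice_plus[symmetric])
  also have "(2 * (v3x + v3y + v3z) + v3x * v3y * v3z) ^ n =
      (\<Sum>t\<in>?T. v3x ^ k t 1 * v3y ^ k t 2 * v3z ^ k t 3 * of_int (wt t))"
  proof -
    have "(2 * (v3x + v3y + v3z) + v3x * v3y * v3z) ^ n = (2 * v3x + 2 * v3y + 2 * v3z + v3x * v3y * v3z) ^ n"
      by (simp only: distrib_left)
    also have "\<dots> = (\<Sum>(n1, n2, n3, m)\<in>?T. of_nat (multinomial n [n1, n2, n3, m]) *
        ((2 * v3x) ^ n1 * (2 * v3y) ^ n2 * (2 * v3z) ^ n3 * (v3x * v3y * v3z) ^ m))"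
      by (rule quadrinomial)
    also have "\<dots> = (\<Sum>t\<in>?T. v3x ^ k t 1 * v3y ^ k t 2 * v3z ^ k t 3 * of_int (wt t))"
    proof (rule sum.cong[OF refl])
      fix t assume "t \<in> ?T"
      then obtain n1 n2 n3 m where t: "t = (n1, n2, n3, m)" "n1 + n2 + n3 + m = n" by auto
      have e: "k t 1 = m + n1" "k t 2 = m + n2" "k t 3 = m + n3" by (simp_all add: k_def t)
      have "n - m = n1 + n2 + n3" using t(2) by simp
      hence w: "(of_int (wt t) :: complex poly poly poly) = of_nat (multinomial n [n1, n2, n3, m]) * 2 ^ (n1 + n2 + n3)"
        by (simp add: wt_def t(1))
      show "(case t of (n1, n2, n3, m) \<Rightarrow> of_nat (multinomial n [n1, n2, n3, m]) *
          ((2 * v3x) ^ n1 * (2 * v3y) ^ n2 * (2 * v3z) ^ n3 * (v3x * v3y * v3z) ^ m)) =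
        v3x ^ k t 1 * v3y ^ k t 2 * v3z ^ k t 3 * of_int (wt t)"
        unfolding e w unfolding t(1) prod.case by (simp only: power_add power_mult_distrib mult_ac)
    qed
    finally show ?thesis .
  qed
  also have "semicircle3 (?V * (\<Sum>t\<in>?T. v3x ^ k t 1 * v3y ^ k t 2 * v3z ^ k t 3 * of_int (wt t))) =
      6 * of_int (\<Sum>t\<in>?T. wt t * det3 (\<lambda>i j. C (k t j + i + j - 2)))"
  proof (rule weyl_determinant[where \<sigma> = "\<lambda>(a, b, c, d). (b, a, c, d)" and \<tau> = "\<lambda>(a, b, c, d). (a, c, b, d)"])
    show "bij_betw (\<lambda>(a, b, c, d). (b, a, c, d)) ?T ?T" "bij_betw (\<lambda>(a, b, c, d). (a, c, b, d)) ?T ?T"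
      by (rule bij_betw_byWitness[where f' = "\<lambda>(a, b, c, d). (b, a, c, d)"]; auto)
        (rule bij_betw_byWitness[where f' = "\<lambda>(a, b, c, d). (a, c, b, d)"]; auto)
  qed (auto simp: finite_compositions_4 wt_def k_def multinomial_def mult_ac)
  also have "1 / 6 * (6 * of_int (\<Sum>t\<in>?T. wt t * det3 (\<lambda>i j. C (k t j + i + j - 2)))) =
    complex_of_int (\<Sum>(n1, n2, n3, m) \<in> ?T. int (multinomial n [n1, n2, n3, m]) * 2 ^ (n - m) *
            det3 (\<lambda>i j. C (m + [n1, n2, n3] ! (j - 1) + i + j - 2)))"
    by (simp add: wt_def k_def case_prod_unfold)
  finally show ?thesis .
qed

theorem proposition3:
  fixes n :: nat
    and M2 :: "(complex^(2 + 2)^(2 + 2)) measure"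
    and M3 :: "(complex^(3 + 3)^(3 + 3)) measure"
  shows
    "(normalized_haar_measure USp M2 \<longrightarrow>
      (\<integral>A. (coeff (char_polynomial A) 2 - 2) ^ n \<partial>M2)
        = of_int (C n * C (n + 2) - (C (n + 1))\<^sup>2)) \<and>
     (normalized_haar_measure USp M3 \<longrightarrow>
      (\<integral>A. (coeff (char_polynomial A) 2 - 3) ^ n \<partial>M3)
        = of_int (\<Sum>(n1, n2, n3) \<in> {(n1, n2, n3). n1 + n2 + n3 = n}.
            int (multinomial n [n1, n2, n3]) *
            det3 (\<lambda>i j. C (n - [n1, n2, n3] ! (j - 1) + i + j - 2)))) \<and>
     (normalized_haar_measure USp M3 \<longrightarrow>
      (\<integral>A. (coeff (char_polynomial A) 3) ^ n \<partial>M3)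
        = of_int (\<Sum>(n1, n2, n3, m) \<in> {(n1, n2, n3, m). n1 + n2 + n3 + m = n}.
            int (multinomial n [n1, n2, n3, m]) * 2 ^ (n - m) *
            det3 (\<lambda>i j. C (m + [n1, n2, n3] ! (j - 1) + i + j - 2))))"
  by (intro conjI impI moments_USp4 moments_a2_USp6 moments_a3_USp6)

end
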